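(* Let $G$ be a finitely presented pro-$p$ group with $d(G)>1$, and suppose it is not the case that $d(G)=2$ and $r(G)=1$. If $G$ is admissible, then $r(G)>d(G)^2/4$.
   Context: $d(G)$ is the generator rank and $r(G)$ the relation rank of the pro-$p$ group $G$. For a profinite group $G$, $a_n(G)$ denotes the number of open subgroups of index $n$. A finitely presented pro-$p$ group $G$ is admissible if there exists $\epsilon>0$ such that $a_n(G)\le n^{(\log_2 n)^{2-\epsilon}}$ for all sufficiently large $n$. *)

theory Defs
  imports "HOL-Analysis.Analysis" "HOL-Computational_Algebra.Primes"
    "HOL-Algebra.Generated_Groups" "HOL-Algebra.Product_Groups"
begin

section \<open>Topological groups and pro-\<open>p\<close> groups\<close>

text \<open>The topology of a group is carried as a separate argument \<open>T\<close>.\<close>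

definition topological_group :: "('a, 'b) monoid_scheme \<Rightarrow> 'a topology \<Rightarrow> bool" where
  "topological_group G T \<longleftrightarrow>
     group G \<and> topspace T = carrier G \<and>
     continuous_map (prod_topology T T) T (\<lambda>(x, y). x \<otimes>\<^bsub>G\<^esub> y) \<and>
     continuous_map T T (\<lambda>x. inv\<^bsub>G\<^esub> x)"

definition totally_disconnected_space :: "'a topology \<Rightarrow> bool" where
  "totally_disconnected_space T \<longleftrightarrow> (\<forall>S. connectedin T S \<longrightarrow> (\<exists>x. S \<subseteq> {x}))"

definition profinite_group :: "('a, 'b) monoid_scheme \<Rightarrow> 'a topology \<Rightarrow> bool" where
  "profinite_group G T \<longleftrightarrow>
     topological_group G T \<and> compact_space T \<and> Hausdorff_space T \<and> totally_disconnected_space T"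

text \<open>Since \<^const>\<open>card\<close> of an infinite set is \<open>0\<close>, which is not a power of a prime, the condition
  below includes finiteness of the index.\<close>

definition p_power_normal_subgroups :: "nat \<Rightarrow> ('a, 'b) monoid_scheme \<Rightarrow> 'a set set" where
  "p_power_normal_subgroups p G = {N. N \<lhd> G \<and> (\<exists>k. card (rcosets\<^bsub>G\<^esub> N) = p ^ k)}"

definition pro_p_group :: "nat \<Rightarrow> ('a, 'b) monoid_scheme \<Rightarrow> 'a topology \<Rightarrow> bool" where
  "pro_p_group p G T \<longleftrightarrow>
     Factorial_Ring.prime p \<and> profinite_group G T \<and>
     (\<forall>N. N \<lhd> G \<and> openin T N \<longrightarrow> N \<in> p_power_normal_subgroups p G)"


section \<open>Free pro-\<open>p\<close> groups of finite rank\<close>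

text \<open>A word over \<open>S\<close> is a list of signed letters; \<open>(x, True)\<close> and \<open>(x, False)\<close> stand for
  \<open>x\<close> and its inverse.\<close>

definition free_words :: "'x set \<Rightarrow> ('x \<times> bool) list set" where
  "free_words S = lists (S \<times> UNIV)"

inductive free_equiv ::
  "'x set \<Rightarrow> ('x \<times> bool) list \<Rightarrow> ('x \<times> bool) list \<Rightarrow> bool" for S where
  refl: "u \<in> free_words S \<Longrightarrow> free_equiv S u u"
| sym: "free_equiv S u v \<Longrightarrow> free_equiv S v u"
| trans: "free_equiv S u v \<Longrightarrow> free_equiv S v w \<Longrightarrow> free_equiv S u w"
| cancel: "u \<in> free_words S \<Longrightarrow> v \<in> free_words S \<Longrightarrow> x \<in> S \<Longrightarrow>
    free_equiv S (u @ (x, b) # (x, \<not> b) # v) (u @ v)"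

definition free_rel :: "'x set \<Rightarrow> (('x \<times> bool) list \<times> ('x \<times> bool) list) set" where
  "free_rel S = {(u, v). free_equiv S u v}"

definition free_group :: "'x set \<Rightarrow> ('x \<times> bool) list set monoid" where
  "free_group S =
     \<lparr>carrier = free_words S // free_rel S,
      mult = (\<lambda>A B. \<Union>u\<in>A. \<Union>v\<in>B. free_rel S `` {u @ v}),
      one = free_rel S `` {[]}\<rparr>"

text \<open>The pro-\<open>p\<close> completion of an abstract group \<open>G\<close> is the inverse limit of the quotients
  \<open>G Mod N\<close> over the normal subgroups \<open>N\<close> of \<open>p\<close>-power index, with finite quotients discrete.
  For \<open>M \<subseteq> N\<close> the transition map sends a coset of \<open>M\<close> to the unique coset of \<open>N\<close> containing it.\<close>

definition pro_p_completion_carrier ::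
  "nat \<Rightarrow> ('a, 'b) monoid_scheme \<Rightarrow> ('a set \<Rightarrow> 'a set) set" where
  "pro_p_completion_carrier p G =
     {\<phi> \<in> (\<Pi>\<^sub>E N\<in>p_power_normal_subgroups p G. carrier (G Mod N)).
        \<forall>M\<in>p_power_normal_subgroups p G. \<forall>N\<in>p_power_normal_subgroups p G.
          M \<subseteq> N \<longrightarrow> \<phi> M \<subseteq> \<phi> N}"

definition pro_p_completion :: "nat \<Rightarrow> ('a, 'b) monoid_scheme \<Rightarrow> ('a set \<Rightarrow> 'a set) monoid" where
  "pro_p_completion p G =
     (product_group (p_power_normal_subgroups p G) (\<lambda>N. G Mod N))
       \<lparr>carrier := pro_p_completion_carrier p G\<rparr>"

definition pro_p_completion_topology ::
  "nat \<Rightarrow> ('a, 'b) monoid_scheme \<Rightarrow> ('a set \<Rightarrow> 'a set) topology" where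
  "pro_p_completion_topology p G =
     subtopology
       (product_topology (\<lambda>N. discrete_topology (carrier (G Mod N)))
          (p_power_normal_subgroups p G))
       (pro_p_completion_carrier p G)"

type_synonym free_pro_p = "(nat \<times> bool) list set set \<Rightarrow> (nat \<times> bool) list set set"

definition free_pro_p_group :: "nat \<Rightarrow> nat \<Rightarrow> free_pro_p monoid" where
  "free_pro_p_group p n = pro_p_completion p (free_group {..<n})"

definition free_pro_p_topology :: "nat \<Rightarrow> nat \<Rightarrow> free_pro_p topology" where
  "free_pro_p_topology p n = pro_p_completion_topology p (free_group {..<n})"


section \<open>Presentations, ranks and subgroup growth\<close>

definition closed_normal_closure ::
  "('a, 'b) monoid_scheme \<Rightarrow> 'a topology \<Rightarrow> 'a set \<Rightarrow> 'a set" where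
  "closed_normal_closure G T R = \<Inter> {N. N \<lhd> G \<and> closedin T N \<and> R \<subseteq> N}"

text \<open>\<open>G\<close> is presented by \<open>n\<close> generators and the set \<open>R\<close> of relators.  A continuous surjection
  from a compact space onto a Hausdorff space is a quotient map, so for pro-\<open>p\<close> groups \<open>G\<close> this
  says that \<open>G\<close> is topologically isomorphic to the quotient of the free pro-\<open>p\<close> group of rank \<open>n\<close>
  by the closed normal subgroup generated by \<open>R\<close>.\<close>

definition pro_p_presentation ::
  "nat \<Rightarrow> ('a, 'b) monoid_scheme \<Rightarrow> 'a topology \<Rightarrow> nat \<Rightarrow> free_pro_p set \<Rightarrow> bool" where
  "pro_p_presentation p G T n R \<longleftrightarrow>
     R \<subseteq> carrier (free_pro_p_group p n) \<and>
     (\<exists>\<pi> \<in> hom (free_pro_p_group p n) G.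
        continuous_map (free_pro_p_topology p n) T \<pi> \<and>
        \<pi> ` carrier (free_pro_p_group p n) = carrier G \<and>
        kernel (free_pro_p_group p n) G \<pi> =
          closed_normal_closure (free_pro_p_group p n) (free_pro_p_topology p n) R)"

definition finitely_presented_pro_p_group ::
  "nat \<Rightarrow> ('a, 'b) monoid_scheme \<Rightarrow> 'a topology \<Rightarrow> bool" where
  "finitely_presented_pro_p_group p G T \<longleftrightarrow>
     pro_p_group p G T \<and> (\<exists>n R. finite R \<and> pro_p_presentation p G T n R)"

text \<open>The least number of topological generators; meaningful for topologically finitely
  generated \<open>G\<close> only (the infimum of the empty set of naturals is \<open>0\<close>).\<close>

definition generator_rank :: "('a, 'b) monoid_scheme \<Rightarrow> 'a topology \<Rightarrow> nat" where
  "generator_rank G T =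
     Inf {card S | S. finite S \<and> S \<subseteq> carrier G \<and> T closure_of (generate G S) = carrier G}"

text \<open>The least number of relators in a presentation on a minimal set of generators; meaningful
  for finitely presented \<open>G\<close> only.  It equals the dimension of the second continuous cohomology
  group of \<open>G\<close> with coefficients in the field of \<open>p\<close> elements.\<close>

definition relation_rank :: "nat \<Rightarrow> ('a, 'b) monoid_scheme \<Rightarrow> 'a topology \<Rightarrow> nat" where
  "relation_rank p G T =
     Inf {card R | R. finite R \<and> pro_p_presentation p G T (generator_rank G T) R}"

definition num_open_subgroups :: "('a, 'b) monoid_scheme \<Rightarrow> 'a topology \<Rightarrow> nat \<Rightarrow> nat" where
  "num_open_subgroups G T n =
     card {H. subgroup H G \<and> openin T H \<and> finite (rcosets\<^bsub>G\<^esub> H) \<and> card (rcosets\<^bsub>G\<^esub> H) = n}"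

text \<open>The growth condition; the notion of an admissible group is only used for finitely presented
  pro-\<open>p\<close> groups, in which the sets of subgroups counted here are finite.\<close>

definition admissible :: "('a, 'b) monoid_scheme \<Rightarrow> 'a topology \<Rightarrow> bool" where
  "admissible G T \<longleftrightarrow>
     (\<exists>\<epsilon>>0. \<forall>\<^sub>F n in sequentially.
        real (num_open_subgroups G T n) \<le> real n powr (log 2 (real n) powr (2 - \<epsilon>)))"

end

theory Submission
  imports Defs "HOL-Algebra.Group_Action" "HOL-Algebra.Multiplicative_Group"
begin

text \<open>Suppose \<open>r \<le> d\<^sup>2 / 4\<close> and present \<open>G\<close> by \<open>d\<close> generators and \<open>r\<close> relators.  Let \<open>B\<close> be the
  quotient of the algebra of noncommutative power series over the field of \<open>p\<close> elements by the ideal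
  generated by the Magnus images \<open>\<rho> - 1\<close> of the relators, let \<open>b n\<close> be the dimension of \<open>B\<close> modulo
  words of length \<open>n\<close>, let \<open>D n\<close> be the subgroup of \<open>G\<close> acting trivially there, and \<open>p ^ e n\<close> its index.
  Minimality of \<open>d\<close> puts the relators into degree \<open>2\<close>, so \<open>b (n + 2) \<ge> 1 + d * b (n + 1) - r * b n\<close>
  (Golod--Shafarevich) and \<open>b\<close> grows at least like \<open>(3/2) ^ n\<close>.  On the other hand \<open>D i / D (2 * i)\<close> is
  elementary abelian of dimension \<open>e (2 * i) - e i\<close>, and its many subgroups of index \<open>p ^ e i\<close> together
  with the growth condition force \<open>e (2 * i) \<le> C * e i powr (2 - \<epsilon>)\<close>; hence \<open>e\<close> grows
  subexponentially.  Since \<open>B\<close> is spanned by ordered products of elements \<open>x - 1\<close> with \<open>x\<close> running through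
  lifts of bases of the quotients \<open>D i / D (i + 1)\<close>, subexponential growth of \<open>e\<close> bounds that of \<open>b\<close>,
  a contradiction.\<close>

section \<open>Additive subgroups and bases modulo a subgroup\<close>

text \<open>The layers \<open>D i / D (2 * i)\<close> are tractable because
  \<open>(x - 1) * (y - 1)\<close> lies twice as deep as its factors, so
  \<open>g \<mapsto> \<mu> g - 1\<close> is additive on \<open>D i\<close> modulo
  \<open>E (2 * i)\<close>, while \<open>p\<close> lies in every ideal. Doubling also makes the
  exponent \<open>2\<close> the threshold: if \<open>e (2 * i) \<le> C * e i powr q\<close> with
  \<open>q < 2\<close>, each doubling multiplies \<open>ln e\<close> by less than \<open>2\<close>
  up to a constant, and \<open>ln (e n)\<close> is sublinear in \<open>n\<close>. The recursion for
  \<open>b\<close> has the characteristic polynomial \<open>t^2 - d * t + r\<close>. Real roots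
  force the larger one up to at least \<open>d / 2\<close>; for \<open>d = 2\<close> and
  \<open>r = 0\<close> it is \<open>2\<close>. The excluded pair \<open>d = 2\<close>,
  \<open>r = 1\<close> has the double root \<open>1\<close>, and the square of the group of
  \<open>p\<close>-adic integers shows that the exception is genuine. The rates meet at
  \<open>x = 3/4\<close>: \<open>e n\<close> is kept below a multiple of \<open>(5/4) ^ n\<close>,
  and \<open>5/4 * 3/4 = 15/16 < 1 < 9/8 = 3/2 * 3/4\<close>. Elements of the completion and of
  \<open>G\<close> are known only through approximating words and chosen preimages. Hence
  multiplicativity is asked only modulo each ideal, and one abstract notion of filtered group serves
  the free group, its completion and \<open>G\<close>.\<close>

definition additive_subgroup_set :: "'a::ring_1 set \<Rightarrow> bool" where
  "additive_subgroup_set K \<longleftrightarrow> 0 \<in> K \<and> (\<forall>x\<in>K. \<forall>y\<in>K. x - y \<in> K)"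

definition add_coset :: "'a::ring_1 set \<Rightarrow> 'a \<Rightarrow> 'a set" where
  "add_coset K u = {v. v - u \<in> K}"

definition add_index :: "'a::ring_1 set \<Rightarrow> 'a set \<Rightarrow> nat" where
  "add_index L K = card (add_coset K ` L)"

text \<open>Scalars are integers because everything stays in one ring: where \<open>p\<close>
  annihilates \<open>L\<close> modulo \<open>K\<close>, they matter only modulo \<open>p\<close>,
  and no quotient module has to be formed.\<close>

definition int_comb :: "('a::ring_1 \<Rightarrow> int) \<Rightarrow> 'a set \<Rightarrow> 'a" where
  "int_comb a B = (\<Sum>b\<in>B. of_int (a b) * b)"

text \<open>This is a basis of \<open>L / K\<close> over the field of \<open>p\<close> elements;
  with integer scalars, linear independence becomes divisibility of the coefficients by
  \<open>p\<close>.\<close>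

definition basis_mod :: "nat \<Rightarrow> 'a::ring_1 set \<Rightarrow> 'a set \<Rightarrow> 'a set \<Rightarrow> bool" where
  "basis_mod p B L K \<longleftrightarrow> finite B \<and> B \<subseteq> L \<and> (\<forall>u\<in>L. \<exists>a. u - int_comb a B \<in> K) \<and>
     (\<forall>a. int_comb a B \<in> K \<longrightarrow> (\<forall>b\<in>B. int p dvd a b))"

context
  fixes K :: "'a::ring_1 set"
  assumes K: "additive_subgroup_set K"
begin

lemma add_zero: "0 \<in> K"
  using K by (auto simp: additive_subgroup_set_def)

lemma add_diff: "x \<in> K \<Longrightarrow> y \<in> K \<Longrightarrow> x - y \<in> K"
  using K by (auto simp: additive_subgroup_set_def)

lemma add_minus: "x \<in> K \<Longrightarrow> - x \<in> K"
  using add_diff[of 0 x] add_zero by simp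

lemma add_plus: "x \<in> K \<Longrightarrow> y \<in> K \<Longrightarrow> x + y \<in> K"
  using add_diff[of x "- y"] add_minus by simp

lemma add_of_nat: "x \<in> K \<Longrightarrow> of_nat n * x \<in> K"
  by (induction n) (auto simp: add_zero distrib_right intro: add_plus)

lemma add_of_int: "x \<in> K \<Longrightarrow> of_int n * x \<in> K"
  by (cases n) (auto simp: add_of_nat intro: add_minus simp del: of_nat_Suc)

lemma add_sum: "(\<And>i. i \<in> I \<Longrightarrow> f i \<in> K) \<Longrightarrow> sum f I \<in> K"
  by (induction I rule: infinite_finite_induct) (auto intro: add_zero add_plus)

lemma add_int_comb: "B \<subseteq> K \<Longrightarrow> int_comb a B \<in> K"
  unfolding int_comb_def by (intro add_sum add_of_int) auto

lemma add_coset_eq_iff: "add_coset K u = add_coset K v \<longleftrightarrow> u - v \<in> K"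
proof
  assume "add_coset K u = add_coset K v"
  moreover have "u \<in> add_coset K u" by (simp add: add_coset_def add_zero)
  ultimately show "u - v \<in> K" by (simp add: add_coset_def)
next
  assume uv: "u - v \<in> K"
  have "w - u \<in> K \<longleftrightarrow> w - v \<in> K" for w
    using add_plus[OF _ uv, of "w - u"] add_diff[OF _ uv, of "w - v"] by auto
  then show "add_coset K u = add_coset K v" by (simp add: add_coset_def)
qed

lemma add_trans: "u - v \<in> K \<Longrightarrow> v - w \<in> K \<Longrightarrow> u - w \<in> K"
  using add_plus[of "u - v" "v - w"] by simp

lemma add_sym: "u - v \<in> K \<Longrightarrow> v - u \<in> K"
  using add_minus[of "u - v"] by simp

lemma add_mem_iff: "u - v \<in> K \<Longrightarrow> u \<in> K \<longleftrightarrow> v \<in> K"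
  using add_plus[of "u - v" v] add_diff[of u "u - v"] by auto

end

lemma int_comb_diff: "int_comb a B - int_comb b B = int_comb (\<lambda>x. a x - b x) B"
  by (simp add: int_comb_def sum_subtractf left_diff_distrib)

lemma int_comb_scale: "of_int c * int_comb a B = int_comb (\<lambda>x. c * a x) B"
  by (simp add: int_comb_def sum_distrib_left mult.assoc)

lemma int_comb_cong: "(\<And>b. b \<in> B \<Longrightarrow> a b = a' b) \<Longrightarrow> int_comb a B = int_comb a' B"
  by (simp add: int_comb_def)

lemma int_comb_single: "finite B \<Longrightarrow> b \<in> B \<Longrightarrow> int_comb (\<lambda>x. if x = b then c else 0) B = of_int c * b"
proof -
  assume "finite B" "b \<in> B"
  have "int_comb (\<lambda>x. if x = b then c else 0) B = (\<Sum>x\<in>B. if x = b then of_int c * x else 0)"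
    unfolding int_comb_def by (intro sum.cong) auto
  then show ?thesis using \<open>finite B\<close> \<open>b \<in> B\<close> by simp
qed

lemma int_comb_mod:
  assumes K: "additive_subgroup_set K" and "finite B"
    and p: "\<And>b. b \<in> B \<Longrightarrow> of_nat p * b \<in> K" and "\<And>b. b \<in> B \<Longrightarrow> int p dvd a b - a' b"
  shows "int_comb a B - int_comb a' B \<in> K"
proof -
  have "of_int (a b - a' b) * b \<in> K" if "b \<in> B" for b
  proof -
    have "int p dvd a b - a' b" using assms(4) that .
    then obtain c where "a b - a' b = int p * c" by (rule dvdE)
    then have "a b - a' b = c * int p" by simp
    then have "of_int (a b - a' b) * b = of_int c * (of_nat p * b)"
      by (simp only: of_int_mult of_int_of_nat_eq mult.assoc)
    then show ?thesis using add_of_int[OF K p[OF that]] by simp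
  qed
  then show ?thesis unfolding int_comb_diff unfolding int_comb_def by (intro add_sum[OF K])
qed

text \<open>A spanning set of least size is independent: in a nontrivial vanishing combination some
  coefficient is invertible modulo \<open>p\<close>, and the element carrying it could be
  dropped.\<close>

lemma basis_mod_exists:
  fixes K L :: "'a::ring_1 set"
  assumes p: "Factorial_Ring.prime p" and K: "additive_subgroup_set K" and L: "additive_subgroup_set L"
    and pL: "\<And>u. u \<in> L \<Longrightarrow> of_nat p * u \<in> K" and fin: "finite (add_coset K ` L)"
  shows "\<exists>B. basis_mod p B L K"
proof -
  define S where "S B \<longleftrightarrow> finite B \<and> B \<subseteq> L \<and> (\<forall>u\<in>L. \<exists>a. u - int_comb a B \<in> K)" for B
  have "\<exists>B. S B"
  proof -
    obtain B where B: "B \<subseteq> L" "finite B" "add_coset K ` L = add_coset K ` B"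
      using finite_subset_image[OF fin subset_refl] by blast
    have "\<exists>a. u - int_comb a B \<in> K" if "u \<in> L" for u
    proof -
      have "add_coset K u \<in> add_coset K ` B" using that B(3) by (metis imageI)
      then obtain b where b: "b \<in> B" "add_coset K u = add_coset K b" by auto
      then have "u - int_comb (\<lambda>x. if x = b then 1 else 0) B \<in> K"
        using add_coset_eq_iff[OF K] int_comb_single[OF B(2) b(1), of 1] by simp
      then show ?thesis by blast
    qed
    then show ?thesis using B unfolding S_def by blast
  qed
  then obtain B where SB: "S B" and min: "\<And>B'. S B' \<Longrightarrow> card B \<le> card B'"
    using ex_has_least_nat[of S _ card] by blast
  have fB: "finite B" and BL: "B \<subseteq> L" and span: "\<And>u. u \<in> L \<Longrightarrow> \<exists>a. u - int_comb a B \<in> K"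
    using SB unfolding S_def by auto
  have "int p dvd a b" if a: "int_comb a B \<in> K" and b: "b \<in> B" for a b
  proof (rule ccontr)
    assume "\<not> int p dvd a b"
    then have "coprime (int p) (a b)" using p by (intro prime_imp_coprime) auto
    then obtain c y where "c * a b + y * int p = 1"
      using bezout_int[of "a b" "int p"] by (auto simp: coprime_iff_gcd_eq_1 gcd.commute)
    then have "c * a b - 1 = int p * (- y)" by (simp add: algebra_simps)
    then have c: "int p dvd c * a b - 1" by (metis dvd_triv_left)
    have "S (B - {b})"
      unfolding S_def
    proof (intro conjI ballI)
      show "finite (B - {b})" "B - {b} \<subseteq> L" using fB BL by auto
      fix u assume "u \<in> L"
      then obtain d where d: "u - int_comb d B \<in> K" using span by blast
      \<comment> \<open>Here \<open>c\<close> inverts \<open>a b\<close> modulo \<open>p\<close>.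
        Subtracting this multiple of the vanishing combination makes the coefficient at
        \<open>b\<close> divisible by \<open>p\<close>.\<close>
      define e where "e x = d x - d b * c * a x" for x
      have 1: "int_comb d B - int_comb e B \<in> K"
      proof -
        have "int_comb d B - int_comb e B = of_int (d b * c) * int_comb a B"
          unfolding int_comb_diff int_comb_scale e_def by (intro int_comb_cong) simp
        then show ?thesis using add_of_int[OF K a, of "d b * c"] by simp
      qed
      have 2: "int_comb e B - int_comb (e(b := 0)) B \<in> K"
      proof (rule int_comb_mod[OF K fB])
        show "of_nat p * x \<in> K" if "x \<in> B" for x using pL BL that by auto
        have "e b = - d b * (c * a b - 1)" by (simp add: e_def algebra_simps)
        then show "int p dvd e x - (e(b := 0)) x" for x using c by auto
      qed
      have 3: "int_comb (e(b := 0)) B = int_comb e (B - {b})"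
        unfolding int_comb_def using fB b by (simp add: sum.remove)
      show "\<exists>a. u - int_comb a (B - {b}) \<in> K"
        using add_trans[OF K add_trans[OF K d 1] 2] 3 by auto
    qed
    then have "card B \<le> card (B - {b})" by (rule min)
    then show False using fB b by (metis card_Diff1_less not_less)
  qed
  then have "basis_mod p B L K"
    unfolding basis_mod_def by (intro conjI allI impI ballI fB BL span) simp_all
  then show ?thesis ..
qed

text \<open>Combinations with coefficients in \<open>{0..<p}\<close> represent every coset exactly
  once.\<close>

lemma basis_mod_index:
  assumes p: "p > 0" and K: "additive_subgroup_set K" and L: "additive_subgroup_set L"
    and pL: "\<And>u. u \<in> L \<Longrightarrow> of_nat p * u \<in> K" and B: "basis_mod p B L K"
  shows "add_index L K = p ^ card B"
proof -
  have fB: "finite B" and BL: "B \<subseteq> L" and span: "\<And>u. u \<in> L \<Longrightarrow> \<exists>a. u - int_comb a B \<in> K"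
    and ind: "\<And>a b. int_comb a B \<in> K \<Longrightarrow> b \<in> B \<Longrightarrow> int p dvd a b"
    using B unfolding basis_mod_def by auto
  have "bij_betw (\<lambda>a. add_coset K (int_comb a B)) (PiE B (\<lambda>_. {0..<int p})) (add_coset K ` L)"
    unfolding bij_betw_def
  proof
    show "inj_on (\<lambda>a. add_coset K (int_comb a B)) (PiE B (\<lambda>_. {0..<int p}))"
    proof (rule inj_onI)
      fix a a' assume a: "a \<in> PiE B (\<lambda>_. {0..<int p})" and a': "a' \<in> PiE B (\<lambda>_. {0..<int p})"
        and "add_coset K (int_comb a B) = add_coset K (int_comb a' B)"
      then have *: "int_comb (\<lambda>x. a x - a' x) B \<in> K" by (simp add: add_coset_eq_iff[OF K] int_comb_diff)
      show "a = a'"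
      proof (rule PiE_ext[OF a a'])
        fix b assume b: "b \<in> B"
        have "int p dvd a b - a' b" using ind[OF * b] by simp
        moreover have "a b \<in> {0..<int p}" "a' b \<in> {0..<int p}" using a a' b by auto
        ultimately show "a b = a' b"
          by (metis atLeastLessThan_iff mod_eq_dvd_iff mod_pos_pos_trivial)
      qed
    qed
    show "(\<lambda>a. add_coset K (int_comb a B)) ` (PiE B (\<lambda>_. {0..<int p})) = add_coset K ` L"
    proof (intro equalityI subsetI)
      fix x assume "x \<in> (\<lambda>a. add_coset K (int_comb a B)) ` (PiE B (\<lambda>_. {0..<int p}))"
      then show "x \<in> add_coset K ` L" using add_int_comb[OF L BL] by auto
    next
      fix x assume "x \<in> add_coset K ` L"
      then obtain u where u: "u \<in> L" "x = add_coset K u" by auto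
      then obtain a where a: "u - int_comb a B \<in> K" using span by blast
      define a' where "a' = restrict (\<lambda>b. a b mod int p) B"
      have "int_comb a B - int_comb a' B \<in> K"
        by (rule int_comb_mod[OF K fB]) (use BL pL in \<open>auto simp: a'_def\<close>)
      then have "x = add_coset K (int_comb a' B)"
        using u add_coset_eq_iff[OF K] add_trans[OF K a] by simp
      moreover have "a' \<in> PiE B (\<lambda>_. {0..<int p})" using p by (auto simp: a'_def)
      ultimately show "x \<in> (\<lambda>a. add_coset K (int_comb a B)) ` (PiE B (\<lambda>_. {0..<int p}))" by blast
    qed
  qed
  then have "add_index L K = card (PiE B (\<lambda>_. {0..<int p}))"
    unfolding add_index_def by (simp add: bij_betw_same_card)
  also have "\<dots> = p ^ card B" using fB by (simp add: card_PiE)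
  finally show ?thesis .
qed

lemma add_index_le_span:
  assumes p: "p > 0" and K: "additive_subgroup_set K"
    and pL: "\<And>u. of_nat p * u \<in> K" and fB: "finite B" and span: "\<And>u. u \<in> L \<Longrightarrow> \<exists>a. u - int_comb a B \<in> K"
  shows "add_index L K \<le> p ^ card B"
proof -
  have "add_coset K ` L \<subseteq> (\<lambda>a. add_coset K (int_comb a B)) ` (PiE B (\<lambda>_. {0..<int p}))"
  proof
    fix x assume "x \<in> add_coset K ` L"
    then obtain u where u: "u \<in> L" "x = add_coset K u" by auto
    then obtain a where a: "u - int_comb a B \<in> K" using span by blast
    define a' where "a' = restrict (\<lambda>b. a b mod int p) B"
    have "int_comb a B - int_comb a' B \<in> K"
      by (rule int_comb_mod[OF K fB]) (use pL in \<open>auto simp: a'_def\<close>)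
    then have "x = add_coset K (int_comb a' B)"
      using u add_coset_eq_iff[OF K] add_trans[OF K a] by simp
    moreover have "a' \<in> PiE B (\<lambda>_. {0..<int p})" using p by (auto simp: a'_def)
    ultimately show "x \<in> (\<lambda>a. add_coset K (int_comb a B)) ` (PiE B (\<lambda>_. {0..<int p}))" by blast
  qed
  then have "add_index L K \<le> card ((\<lambda>a. add_coset K (int_comb a B)) ` (PiE B (\<lambda>_. {0..<int p})))"
    unfolding add_index_def using fB by (intro card_mono finite_imageI finite_PiE) auto
  also have "\<dots> \<le> card (PiE B (\<lambda>_. {0..<int p}))" using fB by (intro card_image_le finite_PiE) auto
  also have "\<dots> = p ^ card B" using fB by (simp add: card_PiE)
  finally show ?thesis .
qed

text \<open>Splitting a basis as \<open>(B - C) \<union> C\<close>, the graphs of the linear maps from the span of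
  \<open>B - C\<close> to the span of \<open>C\<close> are \<open>p ^ (card (B - C) * card C)\<close> distinct subgroups of index \<open>p ^ card C\<close>.\<close>

lemma many_additive_subgroups:
  fixes K L :: "'a::ring_1 set"
  assumes p: "Factorial_Ring.prime p" and K: "additive_subgroup_set K" and L: "additive_subgroup_set L"
    and KL: "K \<subseteq> L" and pL: "\<And>u. u \<in> L \<Longrightarrow> of_nat p * u \<in> K" and fin: "finite (add_coset K ` L)"
    and m: "add_index L K = p ^ m" and k: "k \<le> m"
  shows "\<exists>\<K>. finite \<K> \<and> card \<K> = p ^ (k * (m - k)) \<and>
    (\<forall>M\<in>\<K>. additive_subgroup_set M \<and> K \<subseteq> M \<and> M \<subseteq> L \<and> add_index L M = p ^ k)"
proof -
  have p1: "p > 1" using p prime_gt_1_nat by auto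
  obtain B where B: "basis_mod p B L K" using basis_mod_exists[OF p K L pL fin] by blast
  have "p ^ card B = p ^ m" using basis_mod_index[OF _ K L pL B] m p1 by simp
  then have cB: "card B = m" using p1 by simp
  have fB: "finite B" and BL: "B \<subseteq> L" and span: "\<And>u. u \<in> L \<Longrightarrow> \<exists>a. u - int_comb a B \<in> K"
    and ind: "\<And>a b. int_comb a B \<in> K \<Longrightarrow> b \<in> B \<Longrightarrow> int p dvd a b"
    using B unfolding basis_mod_def by auto
  obtain C where C: "C \<subseteq> B" "card C = k" using k cB by (metis obtain_subset_with_card_n)
  have fC: "finite C" using C fB finite_subset by blast
  define \<Theta> where "\<Theta> = PiE ((B - C) \<times> C) (\<lambda>_. {0..<int p})"
  \<comment> \<open>Modulo \<open>p\<close> this says that the \<open>C\<close>-coordinates are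
    minus the matrix \<theta> applied to the other coordinates, so \<open>M \<theta>\<close> below
    is the graph of a linear map.\<close>
  define ok where "ok \<theta> a \<longleftrightarrow> (\<forall>c\<in>C. int p dvd a c + (\<Sum>b\<in>B - C. \<theta> (b, c) * a b))"
    for \<theta> :: "'a \<times> 'a \<Rightarrow> int" and a :: "'a \<Rightarrow> int"
  define M where "M \<theta> = {u. \<exists>a. u - int_comb a B \<in> K \<and> ok \<theta> a}" for \<theta>
  have ok_cong: "ok \<theta> a'" if "ok \<theta> a" and d: "\<And>b. b \<in> B \<Longrightarrow> int p dvd a b - a' b" for \<theta> a a'
    unfolding ok_def
  proof
    fix c assume c: "c \<in> C"
    have 1: "int p dvd (a c - a' c) + (\<Sum>b\<in>B - C. \<theta> (b, c) * (a b - a' b))"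
      using c C d by (intro dvd_add dvd_sum dvd_mult) auto
    have 2: "a' c + (\<Sum>b\<in>B - C. \<theta> (b, c) * a' b) = (a c + (\<Sum>b\<in>B - C. \<theta> (b, c) * a b))
       - ((a c - a' c) + (\<Sum>b\<in>B - C. \<theta> (b, c) * (a b - a' b)))"
      by (simp add: right_diff_distrib sum_subtractf)
    have 3: "int p dvd a c + (\<Sum>b\<in>B - C. \<theta> (b, c) * a b)" using that(1) c unfolding ok_def by blast
    show "int p dvd a' c + (\<Sum>b\<in>B - C. \<theta> (b, c) * a' b)"
      unfolding 2 by (rule dvd_diff[OF 3 1])
  qed
  have ok_diff: "ok \<theta> (\<lambda>x. a x - a' x)" if "ok \<theta> a" "ok \<theta> a'" for \<theta> a a'
    unfolding ok_def
  proof
    fix c assume c: "c \<in> C"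
    have 1: "a c - a' c + (\<Sum>b\<in>B - C. \<theta> (b, c) * (a b - a' b)) =
      (a c + (\<Sum>b\<in>B - C. \<theta> (b, c) * a b)) - (a' c + (\<Sum>b\<in>B - C. \<theta> (b, c) * a' b))"
      by (simp add: right_diff_distrib sum_subtractf)
    show "int p dvd a c - a' c + (\<Sum>b\<in>B - C. \<theta> (b, c) * (a b - a' b))"
      unfolding 1 using that c unfolding ok_def by (blast intro: dvd_diff)
  qed
  have memM: "int_comb a B \<in> M \<theta> \<longleftrightarrow> ok \<theta> a" for a \<theta>
  proof
    assume "int_comb a B \<in> M \<theta>"
    then obtain a' where a': "int_comb a B - int_comb a' B \<in> K" "ok \<theta> a'" unfolding M_def by auto
    have "int p dvd a' b - a b" if "b \<in> B" for b
      using ind[OF a'(1)[unfolded int_comb_diff] that] by (simp add: dvd_diff_commute)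
    then show "ok \<theta> a" using ok_cong[OF a'(2)] by blast
  next
    assume "ok \<theta> a"
    then show "int_comb a B \<in> M \<theta>" unfolding M_def by (intro CollectI exI[of _ a]) (simp add: add_zero[OF K])
  qed
  have KM: "K \<subseteq> M \<theta>" for \<theta>
  proof
    fix u assume "u \<in> K"
    then have "u - int_comb (\<lambda>_. 0) B \<in> K" by (simp add: int_comb_def)
    moreover have "ok \<theta> (\<lambda>_. 0)" by (simp add: ok_def)
    ultimately show "u \<in> M \<theta>" unfolding M_def by blast
  qed
  have M: "additive_subgroup_set (M \<theta>)" for \<theta>
    unfolding additive_subgroup_set_def
  proof (intro conjI ballI)
    show "0 \<in> M \<theta>" using KM add_zero[OF K] by auto
    fix x y assume "x \<in> M \<theta>" "y \<in> M \<theta>"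
    then obtain a a' where a: "x - int_comb a B \<in> K" "ok \<theta> a" "y - int_comb a' B \<in> K" "ok \<theta> a'"
      unfolding M_def by auto
    have "(x - y) - int_comb (\<lambda>x. a x - a' x) B = (x - int_comb a B) - (y - int_comb a' B)"
      by (simp add: int_comb_diff[symmetric])
    then have "(x - y) - int_comb (\<lambda>x. a x - a' x) B \<in> K" using add_diff[OF K a(1,3)] by (simp only:)
    then show "x - y \<in> M \<theta>" using ok_diff[OF a(2,4)] unfolding M_def by blast
  qed
  have MsubL: "M \<theta> \<subseteq> L" for \<theta>
  proof
    fix u assume "u \<in> M \<theta>"
    then obtain a where "u - int_comb a B \<in> K" unfolding M_def by auto
    then show "u \<in> L" using KL add_int_comb[OF L BL, of a] add_mem_iff[OF L] by blast
  qed
  have extC: "int_comb (\<lambda>x. if x \<in> C then a x else 0) B = int_comb a C" for a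
  proof -
    have "int_comb a C = (\<Sum>x\<in>C. of_int (if x \<in> C then a x else 0) * x)" unfolding int_comb_def by simp
    also have "\<dots> = int_comb (\<lambda>x. if x \<in> C then a x else 0) B"
      unfolding int_comb_def using C fB by (intro sum.mono_neutral_left) auto
    finally show ?thesis by simp
  qed
  have okC: "ok \<theta> (\<lambda>x. if x \<in> C then a x else 0) \<longleftrightarrow> (\<forall>c\<in>C. int p dvd a c)" for \<theta> a
    unfolding ok_def by simp
  \<comment> \<open>The span of \<open>C\<close> is a complement of the graph: subtracting the graph
    point with the same \<open>B - C\<close> coordinates leaves a combination of
    \<open>C\<close>.\<close>
  have "basis_mod p C L (M \<theta>)" for \<theta>
    unfolding basis_mod_def
  proof (intro conjI ballI allI impI)
    show "finite C" "C \<subseteq> L" using fC C BL by auto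
  next
    fix a c assume "int_comb a C \<in> M \<theta>" "c \<in> C"
    then show "int p dvd a c" using memM[of "\<lambda>x. if x \<in> C then a x else 0"] extC okC by simp
  next
    fix u assume "u \<in> L"
    then obtain a where a: "u - int_comb a B \<in> K" using span by blast
    define a' where "a' c = a c + (\<Sum>b\<in>B - C. \<theta> (b, c) * a b)" for c
    have "ok \<theta> (\<lambda>x. a x - (if x \<in> C then a' x else 0))"
      unfolding ok_def by (simp add: a'_def)
    then have "int_comb a B - int_comb a' C \<in> M \<theta>"
      using memM[of "\<lambda>x. a x - (if x \<in> C then a' x else 0)" \<theta>]
      unfolding int_comb_diff[symmetric] extC by blast
    then show "\<exists>a. u - int_comb a C \<in> M \<theta>" using a KM[of \<theta>] add_trans[OF M] by blast
  qed
  then have idx: "add_index L (M \<theta>) = p ^ k" for \<theta>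
    using basis_mod_index[of p "M \<theta>" L C] p1 M L pL KM[of \<theta>] C by (simp add: subset_iff)
  have inj: "inj_on M \<Theta>"
  proof (rule inj_onI)
    fix \<theta> \<theta>' assume t: "\<theta> \<in> \<Theta>" "\<theta>' \<in> \<Theta>" and eq: "M \<theta> = M \<theta>'"
    have "\<theta> (b, c) = \<theta>' (b, c)" if b: "b \<in> B - C" and c: "c \<in> C" for b c
    proof -
      \<comment> \<open>The point of the graph over the single basis vector \<open>b\<close>; its
        coordinates are the entries of \<theta> in the row of \<open>b\<close>, so equal graphs have
        equal entries.\<close>
      define a where "a x = (if x = b then 1 else if x \<in> C then - \<theta> (b, x) else 0)" for x
      have *: "(\<Sum>x\<in>B - C. t (x, c') * a x) = t (b, c')" for t :: "'a \<times> 'a \<Rightarrow> int" and c'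
      proof -
        have "(\<Sum>x\<in>B - C. t (x, c') * a x) = (\<Sum>x\<in>B - C. if x = b then t (x, c') else 0)"
          by (intro sum.cong) (auto simp: a_def)
        then show ?thesis using b fB by simp
      qed
      have "ok \<theta> a" unfolding ok_def * using b by (auto simp: a_def)
      then have "ok \<theta>' a" using memM eq by blast
      then have "int p dvd a c + \<theta>' (b, c)"
        unfolding ok_def * using c by blast
      moreover have "a c = - \<theta> (b, c)" using b c by (auto simp: a_def)
      ultimately have "int p dvd \<theta>' (b, c) - \<theta> (b, c)" by (simp add: algebra_simps)
      moreover have "\<theta> (b, c) \<in> {0..<int p}" "\<theta>' (b, c) \<in> {0..<int p}"
        using t b c unfolding \<Theta>_def by (auto simp: PiE_iff)
      ultimately show ?thesis by (metis atLeastLessThan_iff mod_eq_dvd_iff mod_pos_pos_trivial)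
    qed
    then show "\<theta> = \<theta>'" using t unfolding \<Theta>_def by (intro PiE_ext) auto
  qed
  have f\<Theta>: "finite \<Theta>" unfolding \<Theta>_def using fB fC by (intro finite_PiE) auto
  have "card (M ` \<Theta>) = card \<Theta>" by (rule card_image[OF inj])
  also have "\<dots> = p ^ (card (B - C) * card C)"
    unfolding \<Theta>_def using fB fC by (simp add: card_PiE card_cartesian_product)
  also have "card (B - C) = m - k" using C fC cB by (simp add: card_Diff_subset)
  finally have "card (M ` \<Theta>) = p ^ (k * (m - k))" using C by (simp add: mult.commute)
  then show ?thesis using f\<Theta> M KM MsubL idx by (intro exI[of _ "M ` \<Theta>"]) auto
qed

section \<open>Groups filtered by ideals of a ring\<close>

text \<open>Equality of \<open>f\<close>-values forces equality of \<open>g\<close>-values, so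
  \<open>g\<close> factors through \<open>f\<close>. Together with \<open>card_image_factor\<close>
  this compares different descriptions of the same set of cosets.\<close>

lemma finite_image_factor:
  assumes fin: "finite (f ` S)" and fg: "\<And>x y. x \<in> S \<Longrightarrow> y \<in> S \<Longrightarrow> f x = f y \<Longrightarrow> g x = g y"
  shows "finite (g ` S)"
proof -
  have "g ` S \<subseteq> (\<lambda>c. g (SOME x. x \<in> S \<and> f x = c)) ` (f ` S)"
  proof
    fix y assume "y \<in> g ` S"
    then obtain x where x: "x \<in> S" "y = g x" by auto
    have "(SOME z. z \<in> S \<and> f z = f x) \<in> S \<and> f (SOME z. z \<in> S \<and> f z = f x) = f x"
      by (rule someI[of "\<lambda>z. z \<in> S \<and> f z = f x" x]) (use x in simp)
    then have "g (SOME z. z \<in> S \<and> f z = f x) = g x" using fg x by blast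
    then show "y \<in> (\<lambda>c. g (SOME x. x \<in> S \<and> f x = c)) ` (f ` S)" using x by force
  qed
  then show ?thesis using fin finite_surj by blast
qed

lemma card_image_factor:
  assumes fg: "\<And>x y. x \<in> S \<Longrightarrow> y \<in> S \<Longrightarrow> f x = f y \<longleftrightarrow> g x = g y"
  shows "card (f ` S) = card (g ` S)"
proof -
  define h where "h c = g (SOME x. x \<in> S \<and> f x = c)" for c
  have h: "h (f x) = g x" if x: "x \<in> S" for x
  proof -
    have "(SOME z. z \<in> S \<and> f z = f x) \<in> S \<and> f (SOME z. z \<in> S \<and> f z = f x) = f x"
      by (rule someI[of "\<lambda>z. z \<in> S \<and> f z = f x" x]) (use x in simp)
    then show ?thesis unfolding h_def using fg x by blast
  qed
  have "inj_on h (f ` S)" by (rule inj_onI) (use h fg in auto)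
  moreover have "h ` (f ` S) = g ` S" using h by force
  ultimately show ?thesis by (metis card_image)
qed

section \<open>Cosets and multiplicativity of the index\<close>

context group
begin

lemma rcos_eq_iff:
  assumes H: "subgroup H G" and x: "x \<in> carrier G" and y: "y \<in> carrier G"
  shows "H #> x = H #> y \<longleftrightarrow> x \<otimes> inv y \<in> H"
proof
  assume "H #> x = H #> y"
  then have "x \<in> H #> y" using rcos_self[OF x H] by simp
  then show "x \<otimes> inv y \<in> H" using subgroup.rcos_module[OF H is_group y x] by simp
next
  assume "x \<otimes> inv y \<in> H"
  then have "x \<in> H #> y" using subgroup.rcos_module[OF H is_group y x] by simp
  then show "H #> x = H #> y" using repr_independence[OF _ y H] by simp
qed

lemma rcosets_eq_image: "rcosets H = (\<lambda>x. H #> x) ` carrier G"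
  by (auto simp: RCOSETS_def)

lemma rcosets_whole: "rcosets (carrier G) = {carrier G}"
  unfolding rcosets_eq_image using coset_join2[OF _ subgroup_self] by auto

text \<open>With a representative fixed for each coset of \<open>H\<close>, every coset of
  \<open>K\<close> is uniquely a coset of \<open>K\<close> inside \<open>H\<close> translated by
  such a representative.\<close>

lemma index_tower:
  assumes H: "subgroup H G" and K: "subgroup K G" and KH: "K \<subseteq> H"
    and fH: "finite (rcosets H)" and fK: "finite ((\<lambda>h. K #> h) ` H)"
  shows "finite (rcosets K)" and "card (rcosets K) = card (rcosets H) * card ((\<lambda>h. K #> h) ` H)"
proof -
  define rep where "rep C = (SOME x. x \<in> carrier G \<and> C = H #> x)" for C
  have rep: "rep C \<in> carrier G \<and> C = H #> rep C" if "C \<in> rcosets H" for C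
  proof -
    have "\<exists>x. x \<in> carrier G \<and> C = H #> x" using that by (auto simp: RCOSETS_def)
    then obtain x where "x \<in> carrier G \<and> C = H #> x" ..
    then show ?thesis unfolding rep_def by (rule someI)
  qed
  have Hc: "H \<subseteq> carrier G" and Kc: "K \<subseteq> carrier G" using H K by (auto simp: subgroup.subset)
  have cos: "(K #> h) #> rep C = K #> (h \<otimes> rep C)" if "h \<in> H" "C \<in> rcosets H" for h C
    using coset_mult_assoc[OF Kc] that rep Hc by auto
  have b: "bij_betw (\<lambda>(C, X). X #> rep C) ((rcosets H) \<times> (\<lambda>h. K #> h) ` H) (rcosets K)"
    unfolding bij_betw_def
  proof
    show "inj_on (\<lambda>(C, X). X #> rep C) ((rcosets H) \<times> (\<lambda>h. K #> h) ` H)"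
    proof (rule inj_onI, clarify)
      fix C h C' h'
      assume C: "C \<in> rcosets H" "C' \<in> rcosets H" and h: "h \<in> H" "h' \<in> H"
        and eq: "K #> h #> rep C = K #> h' #> rep C'"
      define c where "c = rep C"
      define c' where "c' = rep C'"
      have cc: "c \<in> carrier G" "c' \<in> carrier G" "h \<in> carrier G" "h' \<in> carrier G"
        using rep C h Hc by (auto simp: c_def c'_def)
      have "K #> (h \<otimes> c) = K #> (h' \<otimes> c')" using eq cos C h by (simp add: c_def c'_def)
      then have k: "(h \<otimes> c) \<otimes> inv (h' \<otimes> c') \<in> K" using rcos_eq_iff[OF K] cc by simp
      define X where "X = (h \<otimes> c) \<otimes> inv (h' \<otimes> c')"
      have e1: "c \<otimes> inv c' = inv h \<otimes> X \<otimes> h'"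
        unfolding X_def using cc by (simp add: inv_mult_group m_assoc inv_solve_left)
      have "X \<in> H" using k KH by (auto simp: X_def)
      then have "c \<otimes> inv c' \<in> H"
        unfolding e1 using h by (intro subgroup.m_closed[OF H] subgroup.m_inv_closed[OF H])
      then have "H #> c = H #> c'" using rcos_eq_iff[OF H] cc by simp
      then have CC: "C = C'" using rep C by (metis c_def c'_def)
      then have "c = c'" by (simp add: c_def c'_def)
      then have "(h \<otimes> c) \<otimes> inv (h' \<otimes> c') = h \<otimes> inv h'"
        using cc by (simp add: inv_mult_group m_assoc) (simp add: m_assoc[symmetric])
      then have "K #> h = K #> h'" using rcos_eq_iff[OF K] cc k by simp
      then show "C = C' \<and> K #> h = K #> h'" using CC by simp
    qed
    show "(\<lambda>(C, X). X #> rep C) ` ((rcosets H) \<times> (\<lambda>h. K #> h) ` H) = rcosets K"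
    proof (intro equalityI subsetI)
      fix Y assume "Y \<in> (\<lambda>(C, X). X #> rep C) ` ((rcosets H) \<times> (\<lambda>h. K #> h) ` H)"
      then obtain C h where "C \<in> rcosets H" "h \<in> H" "Y = K #> h #> rep C" by auto
      then show "Y \<in> rcosets K" using cos rep Hc by (auto intro!: rcosetsI[OF Kc])
    next
      fix Y assume "Y \<in> rcosets K"
      then obtain x where x: "x \<in> carrier G" "Y = K #> x" by (auto simp: RCOSETS_def)
      define C where "C = H #> x"
      have C: "C \<in> rcosets H" unfolding C_def using x Hc by (intro rcosetsI)
      have c: "rep C \<in> carrier G" "H #> x = H #> rep C" using rep[OF C] by (auto simp: C_def)
      then have h: "x \<otimes> inv (rep C) \<in> H" using rcos_eq_iff[OF H x(1)] by simp
      have "Y = K #> (x \<otimes> inv (rep C)) #> rep C"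
        using x c cos[OF h C] by (simp add: m_assoc)
      then show "Y \<in> (\<lambda>(C, X). X #> rep C) ` ((rcosets H) \<times> (\<lambda>h. K #> h) ` H)" using h C by force
    qed
  qed
  show "finite (rcosets K)" using bij_betw_finite[OF b] fH fK by simp
  show "card (rcosets K) = card (rcosets H) * card ((\<lambda>h. K #> h) ` H)"
    using bij_betw_same_card[OF b] by (simp add: card_cartesian_product)
qed

end

section \<open>Congruence subgroups and their layers\<close>

text \<open>Multiplicativity holds modulo every \<open>E n\<close> only, because later maps \<mu>
  come from approximating words and chosen preimages. \<open>E_p\<close> turns each quotient by
  \<open>E n\<close> into a vector space over the field of \<open>p\<close> elements, and
  \<open>E_fin\<close> makes it finite.\<close>

locale filtered_group = group G for G :: "('g, 'h) monoid_scheme" (structure) +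
  fixes p :: nat and E :: "nat \<Rightarrow> 'r::ring_1 set" and \<mu> :: "'g \<Rightarrow> 'r"
  assumes prime_p: "Factorial_Ring.prime p"
    and E_0: "E 0 = UNIV"
    and E_add: "additive_subgroup_set (E n)"
    and E_left: "x \<in> E n \<Longrightarrow> a * x \<in> E n"
    and E_right: "x \<in> E n \<Longrightarrow> x * a \<in> E n"
    and E_mult: "x \<in> E i \<Longrightarrow> y \<in> E j \<Longrightarrow> x * y \<in> E (i + j)"
    and E_Suc: "E (Suc n) \<subseteq> E n"
    and E_p: "of_nat p \<in> E n"
    and E_fin: "finite (range (add_coset (E n)))"
    and mu_mult: "g \<in> carrier G \<Longrightarrow> h \<in> carrier G \<Longrightarrow> \<mu> (g \<otimes> h) - \<mu> g * \<mu> h \<in> E n"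
    and mu_1: "g \<in> carrier G \<Longrightarrow> \<mu> g - 1 \<in> E 1"
    and mu_one: "\<mu> \<one> - 1 \<in> E n"
begin

lemma E_mono: "i \<le> j \<Longrightarrow> E j \<subseteq> E i"
  by (induction j rule: dec_induct) (use E_Suc in auto)

lemmas E_zero = add_zero[OF E_add] and E_diff = add_diff[OF E_add] and E_plus = add_plus[OF E_add]
  and E_minus = add_minus[OF E_add] and E_trans = add_trans[OF E_add] and E_sym = add_sym[OF E_add]
  and E_mem_iff = add_mem_iff[OF E_add]

text \<open>Stated for an arbitrary set \<open>K\<close>: besides the ideals \<open>E n\<close>, the
  additive subgroups between \<open>E (2 * i)\<close> and \<open>E i\<close> are used, and they
  yield the subgroups to be counted.\<close>

definition congruence_subgroup :: "'r set \<Rightarrow> 'g set" where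
  "congruence_subgroup K = {g \<in> carrier G. \<mu> g - 1 \<in> K}"

abbreviation D :: "nat \<Rightarrow> 'g set" where "D n \<equiv> congruence_subgroup (E n)"

lemma D_carrier: "congruence_subgroup K \<subseteq> carrier G"
  by (auto simp: congruence_subgroup_def)

lemma D_mono: "i \<le> j \<Longrightarrow> D j \<subseteq> D i"
  using E_mono by (auto simp: congruence_subgroup_def)

lemma mu_inv: "g \<in> carrier G \<Longrightarrow> \<mu> g * \<mu> (inv g) - 1 \<in> E n"
  using E_trans[OF E_sym[OF mu_mult[of g "inv g"]], of 1 n] mu_one by simp

text \<open>Modulo \<open>E n\<close> the element \<open>\<mu> h\<close> is a unit with inverse
  \<open>\<mu> (inv h)\<close>, and right multiplication by either preserves the ideal.\<close>

lemma mu_div: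
  assumes g: "g \<in> carrier G" and h: "h \<in> carrier G"
  shows "\<mu> (g \<otimes> inv h) - 1 \<in> E n \<longleftrightarrow> \<mu> g - \<mu> h \<in> E n"
proof -
  have 1: "\<mu> (g \<otimes> inv h) - \<mu> g * \<mu> (inv h) \<in> E n" using mu_mult g h by simp
  have 2: "\<mu> g * \<mu> (inv h) - 1 - (\<mu> g - \<mu> h) * \<mu> (inv h) \<in> E n"
    using mu_inv[OF h] by (simp add: left_diff_distrib)
  have 3: "\<mu> g - \<mu> h - (\<mu> g - \<mu> h) * \<mu> (inv h) * \<mu> h \<in> E n"
  proof -
    have "\<mu> (inv h) * \<mu> h - 1 \<in> E n" using mu_inv[of "inv h"] h by simp
    then have "(\<mu> g - \<mu> h) * (1 - \<mu> (inv h) * \<mu> h) \<in> E n" using E_left E_sym by blast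
    then show ?thesis by (simp add: right_diff_distrib mult.assoc)
  qed
  show ?thesis
  proof
    assume "\<mu> (g \<otimes> inv h) - 1 \<in> E n"
    then have "\<mu> g * \<mu> (inv h) - 1 \<in> E n" using E_trans[OF E_sym[OF 1]] by blast
    then have "(\<mu> g - \<mu> h) * \<mu> (inv h) \<in> E n" using E_mem_iff[OF 2] by blast
    then have "(\<mu> g - \<mu> h) * \<mu> (inv h) * \<mu> h \<in> E n" by (rule E_right)
    then show "\<mu> g - \<mu> h \<in> E n" using E_mem_iff[OF 3] by blast
  next
    assume "\<mu> g - \<mu> h \<in> E n"
    then have "(\<mu> g - \<mu> h) * \<mu> (inv h) \<in> E n" by (rule E_right)
    then have "\<mu> g * \<mu> (inv h) - 1 \<in> E n" using E_mem_iff[OF 2] by blast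
    then show "\<mu> (g \<otimes> inv h) - 1 \<in> E n" using E_trans[OF 1] by blast
  qed
qed

lemma D_subgroup: "subgroup (D n) G"
proof (rule subgroupI)
  show "D n \<subseteq> carrier G" by (rule D_carrier)
  show "D n \<noteq> {}" using mu_one by (auto simp: congruence_subgroup_def)
  show inv_closed: "inv a \<in> D n" if a: "a \<in> D n" for a
  proof -
    have "1 - \<mu> a \<in> E n" and ac: "a \<in> carrier G" using a E_sym by (auto simp: congruence_subgroup_def)
    then have "\<mu> \<one> - \<mu> a \<in> E n" using E_trans[OF mu_one] by blast
    then show ?thesis using mu_div[of \<one> a] ac by (simp add: congruence_subgroup_def)
  qed
  show "a \<otimes> b \<in> D n" if a: "a \<in> D n" and b: "b \<in> D n" for a b
  proof -
    have c: "a \<in> carrier G" "b \<in> carrier G" using a b by (auto simp: congruence_subgroup_def)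
    have "1 - \<mu> (inv b) \<in> E n" "\<mu> a - 1 \<in> E n"
      using a inv_closed[OF b] E_sym by (auto simp: congruence_subgroup_def)
    then have "\<mu> a - \<mu> (inv b) \<in> E n" using E_trans by blast
    then show ?thesis using mu_div[of a "inv b"] c by (simp add: congruence_subgroup_def)
  qed
qed

lemma D_normal: "D n \<lhd> G"
  unfolding normal_inv_iff
proof (intro conjI ballI D_subgroup)
  fix x h assume x: "x \<in> carrier G" and h: "h \<in> D n"
  have hc: "h \<in> carrier G" and h1: "\<mu> h - 1 \<in> E n" using h by (auto simp: congruence_subgroup_def)
  have "\<mu> x * (\<mu> h - 1) \<in> E n" using h1 by (rule E_left)
  then have "\<mu> x * \<mu> h - \<mu> x \<in> E n" by (simp add: right_diff_distrib)
  then have "\<mu> (x \<otimes> h) - \<mu> x \<in> E n" using E_trans[OF mu_mult[OF x hc]] by blast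
  then show "x \<otimes> h \<otimes> inv x \<in> D n" using mu_div x hc by (simp add: congruence_subgroup_def)
qed

lemma D_rcos_eq_iff: "g \<in> carrier G \<Longrightarrow> h \<in> carrier G \<Longrightarrow> D n #> g = D n #> h \<longleftrightarrow> \<mu> g - \<mu> h \<in> E n"
  using rcos_eq_iff[OF D_subgroup] mu_div by (simp add: congruence_subgroup_def)

lemma finite_rcosets_D: "finite (rcosets (D n))"
proof -
  have "finite ((\<lambda>g. add_coset (E n) (\<mu> g)) ` carrier G)"
    by (rule finite_subset[OF _ E_fin[of n]]) auto
  then show ?thesis unfolding rcosets_eq_image
    by (rule finite_image_factor) (simp add: add_coset_eq_iff[OF E_add] D_rcos_eq_iff)
qed

text \<open>Modulo \<open>E j\<close> the defect of additivity is
  \<open>(\<mu> g - 1) * (\<mu> h - 1)\<close>, which lies in \<open>E (2 * i)\<close>. This is the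
  source of the condition \<open>j \<le> 2 * i\<close> everywhere below.\<close>

lemma delta_mult:
  assumes g: "g \<in> D i" and h: "h \<in> D i" and j: "j \<le> 2 * i"
  shows "(\<mu> (g \<otimes> h) - 1) - ((\<mu> g - 1) + (\<mu> h - 1)) \<in> E j"
proof -
  have "\<mu> (g \<otimes> h) - \<mu> g * \<mu> h \<in> E j" using mu_mult g h by (auto simp: congruence_subgroup_def)
  moreover have "(\<mu> g - 1) * (\<mu> h - 1) \<in> E j"
    using E_mult[of "\<mu> g - 1" i "\<mu> h - 1" i] E_mono[OF j] g h by (auto simp: congruence_subgroup_def mult_2)
  ultimately have "\<mu> (g \<otimes> h) - \<mu> g * \<mu> h + (\<mu> g - 1) * (\<mu> h - 1) \<in> E j" by (rule E_plus)
  moreover have "\<mu> (g \<otimes> h) - \<mu> g * \<mu> h + (\<mu> g - 1) * (\<mu> h - 1) =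
    (\<mu> (g \<otimes> h) - 1) - ((\<mu> g - 1) + (\<mu> h - 1))" by (simp add: algebra_simps)
  ultimately show ?thesis by (simp only:)
qed

lemma delta_inv:
  assumes g: "g \<in> D i" and j: "j \<le> 2 * i"
  shows "(\<mu> (inv g) - 1) + (\<mu> g - 1) \<in> E j"
proof -
  have "inv g \<in> D i" using g D_subgroup by (simp add: subgroup.m_inv_closed)
  then have "(\<mu> (inv g \<otimes> g) - 1) - ((\<mu> (inv g) - 1) + (\<mu> g - 1)) \<in> E j" using g j by (intro delta_mult) auto
  moreover have "inv g \<otimes> g = \<one>" using g by (simp add: congruence_subgroup_def)
  ultimately show ?thesis using E_mem_iff[of _ _ j] mu_one by metis
qed

text \<open>On \<open>D i\<close> the map \<open>g \<mapsto> \<mu> g - 1\<close> is additive modulo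
  \<open>E j\<close>, so the preimage of an additive subgroup containing \<open>E j\<close> is a
  subgroup.\<close>

lemma congruence_subgroup_subgroup:
  assumes K: "additive_subgroup_set K" and "E j \<subseteq> K" and "K \<subseteq> E i" and j: "j \<le> 2 * i"
  shows "subgroup (congruence_subgroup K) G"
proof (rule subgroupI)
  have Di: "congruence_subgroup K \<subseteq> D i" using assms(3) by (auto simp: congruence_subgroup_def)
  show "congruence_subgroup K \<subseteq> carrier G" by (rule D_carrier)
  show "congruence_subgroup K \<noteq> {}" using mu_one assms(2) by (auto simp: congruence_subgroup_def)
  show "inv a \<in> congruence_subgroup K" if a: "a \<in> congruence_subgroup K" for a
  proof -
    have "(\<mu> (inv a) - 1) + (\<mu> a - 1) \<in> K" using delta_inv[of a i j] a Di j assms(2) by blast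
    then have "(\<mu> (inv a) - 1) - (- (\<mu> a - 1)) \<in> K" by (simp only: diff_minus_eq_add)
    moreover have "- (\<mu> a - 1) \<in> K"
      using a add_minus[OF K, of "\<mu> a - 1"] unfolding congruence_subgroup_def by blast
    ultimately have "\<mu> (inv a) - 1 \<in> K" using add_mem_iff[OF K] by blast
    then show ?thesis using a by (simp add: congruence_subgroup_def)
  qed
  show "a \<otimes> b \<in> congruence_subgroup K" if a: "a \<in> congruence_subgroup K" and b: "b \<in> congruence_subgroup K" for a b
  proof -
    have "(\<mu> (a \<otimes> b) - 1) - ((\<mu> a - 1) + (\<mu> b - 1)) \<in> K" using delta_mult[of a i b j] a b Di j assms(2) by auto
    moreover have "(\<mu> a - 1) + (\<mu> b - 1) \<in> K" using a b add_plus[OF K] by (auto simp: congruence_subgroup_def)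
    ultimately have "\<mu> (a \<otimes> b) - 1 \<in> K" using add_mem_iff[OF K] by blast
    then show ?thesis using a b by (simp add: congruence_subgroup_def)
  qed
qed

text \<open>The full preimage in the ring of the image of \<open>D i\<close> modulo
  \<open>E j\<close>; for \<open>i \<le> j \<le> 2 * i\<close> it represents
  \<open>D i / D j\<close> additively.\<close>

definition layer :: "nat \<Rightarrow> nat \<Rightarrow> 'r set" where
  "layer i j = {u. \<exists>g\<in>D i. u - (\<mu> g - 1) \<in> E j}"

lemma layer_additive:
  assumes j: "j \<le> 2 * i"
  shows "additive_subgroup_set (layer i j)"
  unfolding additive_subgroup_set_def
proof (intro conjI ballI)
  have "\<one> \<in> D i" using D_subgroup by (rule subgroup.one_closed)
  moreover have "0 - (\<mu> \<one> - 1) \<in> E j" using E_minus[OF mu_one] by simp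
  ultimately show "0 \<in> layer i j" unfolding layer_def by blast
  fix x y assume "x \<in> layer i j" "y \<in> layer i j"
  then obtain g h where gh: "g \<in> D i" "h \<in> D i" and x: "x - (\<mu> g - 1) \<in> E j" and y: "y - (\<mu> h - 1) \<in> E j"
    unfolding layer_def by blast
  have ih: "inv h \<in> D i" using gh D_subgroup by (simp add: subgroup.m_inv_closed)
  have 1: "(\<mu> (g \<otimes> inv h) - 1) - ((\<mu> g - 1) + (\<mu> (inv h) - 1)) \<in> E j" using delta_mult gh ih j by blast
  have 2: "(\<mu> (inv h) - 1) + (\<mu> h - 1) \<in> E j" using delta_inv gh j by blast
  have "(x - y) - (\<mu> (g \<otimes> inv h) - 1) =
    (x - (\<mu> g - 1)) - (y - (\<mu> h - 1)) - ((\<mu> (g \<otimes> inv h) - 1) - ((\<mu> g - 1) + (\<mu> (inv h) - 1)))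
      - ((\<mu> (inv h) - 1) + (\<mu> h - 1))"
    by (simp add: algebra_simps)
  then have "(x - y) - (\<mu> (g \<otimes> inv h) - 1) \<in> E j" using E_diff[OF E_diff[OF E_diff[OF x y] 1] 2] by (simp only:)
  moreover have "g \<otimes> inv h \<in> D i" using gh ih D_subgroup by (simp add: subgroup.m_closed)
  ultimately show "x - y \<in> layer i j" unfolding layer_def by blast
qed

lemma E_subset_layer: "E j \<subseteq> layer i j"
proof
  fix x assume x: "x \<in> E j"
  have "\<one> \<in> D i" using D_subgroup by (rule subgroup.one_closed)
  moreover have "x - (\<mu> \<one> - 1) \<in> E j" using E_diff[OF x mu_one] by simp
  ultimately show "x \<in> layer i j" unfolding layer_def by blast
qed

lemma layer_subset_E: "i \<le> j \<Longrightarrow> layer i j \<subseteq> E i"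
proof
  fix x assume ij: "i \<le> j" and "x \<in> layer i j"
  then obtain g where "g \<in> D i" "x - (\<mu> g - 1) \<in> E i" using E_mono[OF ij] unfolding layer_def by blast
  then show "x \<in> E i" using E_mem_iff by (auto simp: congruence_subgroup_def)
qed

lemma delta_layer: "g \<in> D i \<Longrightarrow> \<mu> g - 1 \<in> layer i j"
  unfolding layer_def using E_zero by force

text \<open>The additive map \<open>g \<mapsto> \<mu> g - 1\<close> matches the cosets of the
  congruence subgroup inside \<open>D i\<close> with the cosets of \<open>K\<close> inside the
  layer; the rest is the index of \<open>D i\<close>.\<close>

lemma index_congruence_subgroup:
  assumes K: "additive_subgroup_set K" and EK: "E j \<subseteq> K" and KL: "K \<subseteq> layer i j" and ij: "i \<le> j" "j \<le> 2 * i"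
  shows "finite (rcosets (congruence_subgroup K))"
    and "card (rcosets (congruence_subgroup K)) = card (rcosets (D i)) * add_index (layer i j) K"
proof -
  let ?H = "congruence_subgroup K"
  have KE: "K \<subseteq> E i" using KL layer_subset_E[OF ij(1)] by blast
  have H: "subgroup ?H G" by (rule congruence_subgroup_subgroup[OF K EK KE ij(2)])
  have eq: "?H #> g = ?H #> h \<longleftrightarrow> add_coset K (\<mu> g - 1) = add_coset K (\<mu> h - 1)"
    if g: "g \<in> D i" and h: "h \<in> D i" for g h
  proof -
    have c: "g \<in> carrier G" "h \<in> carrier G" using g h D_carrier by auto
    have ih: "inv h \<in> D i" using h D_subgroup by (simp add: subgroup.m_inv_closed)
    have 1: "(\<mu> (g \<otimes> inv h) - 1) - ((\<mu> g - 1) + (\<mu> (inv h) - 1)) \<in> E j" using delta_mult g ih ij by blast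
    have 2: "(\<mu> (inv h) - 1) + (\<mu> h - 1) \<in> E j" using delta_inv h ij by blast
    have "(\<mu> (g \<otimes> inv h) - 1) - ((\<mu> g - 1) - (\<mu> h - 1)) = 
      ((\<mu> (g \<otimes> inv h) - 1) - ((\<mu> g - 1) + (\<mu> (inv h) - 1))) + ((\<mu> (inv h) - 1) + (\<mu> h - 1))"
      by (simp add: algebra_simps)
    then have "(\<mu> (g \<otimes> inv h) - 1) - ((\<mu> g - 1) - (\<mu> h - 1)) \<in> K" using E_plus[OF 1 2] EK by (simp only: subsetD)
    then have "\<mu> (g \<otimes> inv h) - 1 \<in> K \<longleftrightarrow> (\<mu> g - 1) - (\<mu> h - 1) \<in> K" by (rule add_mem_iff[OF K])
    then show ?thesis unfolding add_coset_eq_iff[OF K] rcos_eq_iff[OF H c]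
      using c by (simp add: congruence_subgroup_def)
  qed
  have im: "add_coset K ` layer i j = (\<lambda>g. add_coset K (\<mu> g - 1)) ` D i"
  proof (intro equalityI subsetI)
    fix y assume "y \<in> add_coset K ` layer i j"
    then obtain u g where u: "y = add_coset K u" "g \<in> D i" "u - (\<mu> g - 1) \<in> E j" unfolding layer_def by auto
    then have "y = add_coset K (\<mu> g - 1)" using add_coset_eq_iff[OF K] EK by auto
    then show "y \<in> (\<lambda>g. add_coset K (\<mu> g - 1)) ` D i" using u by auto
  qed (use delta_layer in auto)
  have "finite (add_coset K ` UNIV)"
    using E_fin[of j] by (rule finite_image_factor)
      (use EK in \<open>auto simp: add_coset_eq_iff[OF K] add_coset_eq_iff[OF E_add]\<close>)
  then have "finite (add_coset K ` layer i j)" by (rule finite_subset[rotated]) auto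
  then have fin: "finite ((\<lambda>h. ?H #> h) ` D i)"
    unfolding im by (rule finite_image_factor) (use eq in auto)
  have card: "card ((\<lambda>h. ?H #> h) ` D i) = add_index (layer i j) K"
    unfolding add_index_def im by (rule card_image_factor) (use eq in auto)
  have sub: "?H \<subseteq> D i" using KE by (auto simp: congruence_subgroup_def)
  show "finite (rcosets ?H)" "card (rcosets ?H) = card (rcosets (D i)) * add_index (layer i j) K"
    using index_tower[OF D_subgroup H sub finite_rcosets_D fin] card by auto
qed

lemma p_mult_E: "of_nat p * u \<in> E n"
  using E_right[OF E_p] .

lemma finite_layer: "finite (add_coset (E n) ` L)"
  by (rule finite_subset[OF _ E_fin[of n]]) auto

text \<open>The exponent \<open>e n\<close> of the overview; \<open>index_D\<close> shows that the
  choice succeeds for \<open>n \<ge> 1\<close>.\<close>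

definition level :: "nat \<Rightarrow> nat" where
  "level n = (SOME k. card (rcosets (D n)) = p ^ k)"

lemma p_gt_1: "p > 1"
  using prime_p prime_gt_1_nat by blast

lemma index_D_layer:
  assumes "i \<le> j" "j \<le> 2 * i"
  shows "card (rcosets (D j)) = card (rcosets (D i)) * add_index (layer i j) (E j)"
  by (rule index_congruence_subgroup(2)[OF E_add subset_refl E_subset_layer assms])

lemma D_1: "D 1 = carrier G"
  using mu_1 by (auto simp: congruence_subgroup_def)

text \<open>From \<open>D 1\<close>, which is the whole group, one passes to \<open>D n\<close>
  through layers of width one; these are admissible since \<open>Suc n \<le> 2 * n\<close> for
  \<open>n \<ge> 1\<close>.\<close>

lemma index_D_power: "n \<ge> 1 \<Longrightarrow> \<exists>k. card (rcosets (D n)) = p ^ k"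
proof (induction n rule: dec_induct)
  case base
  show ?case unfolding D_1 rcosets_whole by (intro exI[of _ 0]) simp
next
  case (step n)
  have j: "n \<le> Suc n" "Suc n \<le> 2 * n" using step by auto
  obtain B where "basis_mod p B (layer n (Suc n)) (E (Suc n))"
    using basis_mod_exists[OF prime_p E_add layer_additive[OF j(2)] p_mult_E finite_layer] by blast
  then have "add_index (layer n (Suc n)) (E (Suc n)) = p ^ card B"
    using basis_mod_index[OF _ E_add layer_additive[OF j(2)] p_mult_E] p_gt_1 by simp
  then show ?case using index_D_layer[OF j] step.IH by (metis power_add)
qed

lemma index_D: "n \<ge> 1 \<Longrightarrow> card (rcosets (D n)) = p ^ level n"
  unfolding level_def using index_D_power by (rule someI_ex)

lemma index_layer:
  assumes "1 \<le> i" "i \<le> j" "j \<le> 2 * i"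
  shows "level i \<le> level j" and "add_index (layer i j) (E j) = p ^ (level j - level i)"
proof -
  have eq: "p ^ level j = p ^ level i * add_index (layer i j) (E j)"
    using index_D_layer[OF assms(2,3)] index_D[of i] index_D[of j] assms by simp
  then have "p ^ level i dvd p ^ level j" by simp
  then show le: "level i \<le> level j" using p_gt_1 by (simp add: dvd_power_iff_le)
  have "p ^ level j = p ^ level i * p ^ (level j - level i)" using le by (simp add: power_add[symmetric])
  then show "add_index (layer i j) (E j) = p ^ (level j - level i)" using eq p_gt_1 by simp
qed

lemma level_mono: "i \<le> j \<Longrightarrow> 1 \<le> i \<Longrightarrow> level i \<le> level j"
proof (induction j rule: dec_induct)
  case (step n)
  then have "level n \<le> level (Suc n)" by (intro index_layer) auto
  then show ?case using step by auto
qed simp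

text \<open>The subgroups of the vector space \<open>D i / D (2 * i)\<close> found by linear algebra
  are pulled back to the group. Distinct ones stay distinct, since each is recovered from its
  preimage by adding \<open>E (2 * i)\<close>.\<close>

lemma many_congruence_subgroups:
  assumes i: "1 \<le> i" and k: "k \<le> level (2 * i) - level i"
  shows "\<exists>\<H>. finite \<H> \<and> card \<H> = p ^ (k * (level (2 * i) - level i - k)) \<and>
    (\<forall>H\<in>\<H>. subgroup H G \<and> D (2 * i) \<subseteq> H \<and> finite (rcosets H) \<and> card (rcosets H) = p ^ (level i + k))"
proof -
  let ?L = "layer i (2 * i)" and ?E = "E (2 * i)" and ?m = "level (2 * i) - level i"
  have j: "i \<le> 2 * i" "2 * i \<le> 2 * i" by auto
  obtain \<K> where f: "finite \<K>" and c: "card \<K> = p ^ (k * (?m - k))" and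
    \<K>: "\<And>M. M \<in> \<K> \<Longrightarrow> additive_subgroup_set M \<and> ?E \<subseteq> M \<and> M \<subseteq> ?L \<and> add_index ?L M = p ^ k"
    using many_additive_subgroups[OF prime_p E_add layer_additive[OF j(2)] E_subset_layer p_mult_E finite_layer
        index_layer(2)[OF i j] k] by blast
  have recover: "M = {u. \<exists>g\<in>congruence_subgroup M. u - (\<mu> g - 1) \<in> ?E}" if "M \<in> \<K>" for M
  proof -
    have M: "additive_subgroup_set M" "?E \<subseteq> M" "M \<subseteq> ?L" using \<K>[OF that] by auto
    show ?thesis
    proof (intro equalityI subsetI CollectI)
      fix u assume u: "u \<in> M"
      then obtain g where g: "g \<in> D i" "u - (\<mu> g - 1) \<in> ?E" using M(3) unfolding layer_def by blast
      then have "\<mu> g - 1 \<in> M" using add_mem_iff[OF M(1)] M(2) u by blast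
      then have "g \<in> congruence_subgroup M" using g by (simp add: congruence_subgroup_def)
      then show "\<exists>g\<in>congruence_subgroup M. u - (\<mu> g - 1) \<in> ?E" using g by blast
    next
      fix u assume "u \<in> {u. \<exists>g\<in>congruence_subgroup M. u - (\<mu> g - 1) \<in> ?E}"
      then obtain g where "\<mu> g - 1 \<in> M" "u - (\<mu> g - 1) \<in> M" using M(2) by (auto simp: congruence_subgroup_def)
      then show "u \<in> M" using add_mem_iff[OF M(1)] by blast
    qed
  qed
  have inj: "inj_on congruence_subgroup \<K>"
  proof (rule inj_onI)
    fix M M' assume "M \<in> \<K>" "M' \<in> \<K>" and eq: "congruence_subgroup M = congruence_subgroup M'"
    then show "M = M'" using recover[of M] recover[of M'] by simp
  qed
  have "subgroup (congruence_subgroup M) G \<and> D (2 * i) \<subseteq> congruence_subgroup M \<and>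
      finite (rcosets (congruence_subgroup M)) \<and> card (rcosets (congruence_subgroup M)) = p ^ (level i + k)"
    if "M \<in> \<K>" for M
  proof -
    have M: "additive_subgroup_set M" "?E \<subseteq> M" "M \<subseteq> ?L" "add_index ?L M = p ^ k" using \<K>[OF that] by auto
    have "M \<subseteq> E i" using M(3) layer_subset_E[OF j(1)] by blast
    then have "subgroup (congruence_subgroup M) G" using congruence_subgroup_subgroup M(1,2) by blast
    moreover have "D (2 * i) \<subseteq> congruence_subgroup M" using M(2) by (auto simp: congruence_subgroup_def)
    ultimately show ?thesis
      using index_congruence_subgroup[OF M(1,2,3) j] M(4) index_D[OF i] by (simp add: power_add)
  qed
  then show ?thesis using f c inj
    by (intro exI[of _ "congruence_subgroup ` \<K>"]) (auto simp: card_image)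
qed

end

section \<open>Spanning the ring by ordered products of group elements\<close>

lemma int_comb_closure_additive:
  assumes E: "additive_subgroup_set E"
  shows "additive_subgroup_set {u. \<exists>a. u - int_comb a V \<in> E}"
  unfolding additive_subgroup_set_def
proof (intro conjI ballI)
  show "0 \<in> {u. \<exists>a. u - int_comb a V \<in> E}"
    using add_zero[OF E] by (intro CollectI exI[of _ "\<lambda>_. 0"]) (simp add: int_comb_def)
  fix x y assume "x \<in> {u. \<exists>a. u - int_comb a V \<in> E}" "y \<in> {u. \<exists>a. u - int_comb a V \<in> E}"
  then obtain a b where ab: "x - int_comb a V \<in> E" "y - int_comb b V \<in> E" by auto
  have "(x - y) - int_comb (\<lambda>v. a v - b v) V = (x - int_comb a V) - (y - int_comb b V)"
    by (simp add: int_comb_diff[symmetric])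
  then have "(x - y) - int_comb (\<lambda>v. a v - b v) V \<in> E" using add_diff[OF E ab] by (simp only:)
  then show "x - y \<in> {u. \<exists>a. u - int_comb a V \<in> E}" by blast
qed

context filtered_group
begin

text \<open>Modulo \<open>E n\<close>, the set \<open>Y\<close> lies in the additive span of finitely many elements carrying weights (depths in
  the filtration), and the generating function of the weights is at most \<open>s\<close> at \<open>x\<close>.\<close>

definition weighted_span :: "real \<Rightarrow> nat \<Rightarrow> 'r set \<Rightarrow> real \<Rightarrow> bool" where
  "weighted_span x n Y s \<longleftrightarrow> (\<exists>M. finite M \<and> (\<forall>(v, w)\<in>M. v \<in> E w) \<and> (\<Sum>(v, w)\<in>M. x ^ w) \<le> s \<and>
     (\<forall>K. additive_subgroup_set K \<longrightarrow> E n \<subseteq> K \<longrightarrow> fst ` M \<subseteq> K \<longrightarrow> Y \<subseteq> K))"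

lemma weighted_span_mono:
  assumes "weighted_span x n Y s" and "s \<le> s'" and Y: "\<And>y. y \<in> Y' \<Longrightarrow> \<exists>z\<in>Y. y - z \<in> E n"
  shows "weighted_span x n Y' s'"
proof -
  obtain M where M: "finite M" "\<forall>(v, w)\<in>M. v \<in> E w" "(\<Sum>(v, w)\<in>M. x ^ w) \<le> s"
    "\<And>K. additive_subgroup_set K \<Longrightarrow> E n \<subseteq> K \<Longrightarrow> fst ` M \<subseteq> K \<Longrightarrow> Y \<subseteq> K"
    using assms(1) unfolding weighted_span_def by blast
  have "Y' \<subseteq> K" if K: "additive_subgroup_set K" "E n \<subseteq> K" "fst ` M \<subseteq> K" for K
  proof
    fix y assume "y \<in> Y'"
    then obtain z where "z \<in> Y" "y - z \<in> E n" using Y by blast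
    then show "y \<in> K" using M(4)[OF K] K(2) add_mem_iff[OF K(1)] by blast
  qed
  then show ?thesis unfolding weighted_span_def using M assms(2) by (intro exI[of _ M]) auto
qed

lemma E_power: "t \<in> E w \<Longrightarrow> t ^ k \<in> E (k * w)"
  by (induction k) (use E_0 E_mult in \<open>auto simp: add.commute\<close>)

lemma geometric_sum_le:
  fixes y :: real
  assumes "0 \<le> y" "y < 1"
  shows "(\<Sum>k<n. y ^ k) \<le> 1 / (1 - y)"
  using assms by (simp add: sum_gp_strict divide_right_mono)

text \<open>Expand \<open>t ^ a\<close> in powers of \<open>t - 1\<close>. The \<open>k\<close>-th
  power has depth \<open>k * w\<close> and vanishes modulo \<open>E n\<close> for
  \<open>k \<ge> n\<close>, so the generating function is multiplied by at most the geometric series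
  in \<open>x ^ w\<close>.\<close>

lemma weighted_span_powers:
  assumes Y: "weighted_span x n Y s" and x: "0 < x" "x < 1" and w: "w \<ge> 1" and t: "t - 1 \<in> E w"
  shows "weighted_span x n {t ^ a * y | a y. y \<in> Y} (s * (1 / (1 - x ^ w)))"
proof -
  obtain M where M: "finite M" "\<forall>(v, w)\<in>M. v \<in> E w" "(\<Sum>(v, w)\<in>M. x ^ w) \<le> s"
    "\<And>K. additive_subgroup_set K \<Longrightarrow> E n \<subseteq> K \<Longrightarrow> fst ` M \<subseteq> K \<Longrightarrow> Y \<subseteq> K"
    using Y unfolding weighted_span_def by blast
  have MD: "v \<in> E w" if "(v, w) \<in> M" for v w using M(2) that by blast
  define f where "f = (\<lambda>(k, v, u). ((t - 1) ^ k * v, k * w + u))"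
  define M' where "M' = f ` ({..<n} \<times> M)"
  have 1: "finite M'" unfolding M'_def using M by auto
  have 2: "v \<in> E u" if vu: "(v, u) \<in> M'" for v u
  proof -
    obtain z where z: "z \<in> {..<n} \<times> M" "(v, u) = f z" using vu unfolding M'_def by auto
    obtain k v' u' where k: "z = (k, v', u')" by (cases z)
    have "(v', u') \<in> M" "v = (t - 1) ^ k * v'" "u = k * w + u'" using z by (auto simp: k f_def)
    then show ?thesis using E_mult[OF E_power[OF t] MD] by simp
  qed
  \<comment> \<open>Different pairs may give the same weighted element, whence only an
    inequality.\<close>
  have "(\<Sum>(v, u)\<in>M'. x ^ u) \<le> (\<Sum>i\<in>{..<n} \<times> M. case f i of (v, u) \<Rightarrow> x ^ u)"
    unfolding M'_def using x M by (intro order_trans[OF sum_image_le]) (auto simp: comp_def split: prod.splits)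
  also have "\<dots> = (\<Sum>i\<in>{..<n} \<times> M. (x ^ w) ^ fst i * x ^ snd (snd i))"
    by (intro sum.cong) (auto simp: f_def power_add power_mult[symmetric] mult.commute)
  also have "\<dots> = (\<Sum>k<n. (x ^ w) ^ k) * (\<Sum>m\<in>M. x ^ snd m)"
    by (simp add: sum_product sum.cartesian_product split_def)
  also have "\<dots> \<le> (1 / (1 - x ^ w)) * s"
  proof (rule mult_mono)
    have "x ^ w < 1" using x w by (simp add: power_less_one_iff)
    then show "(\<Sum>k<n. (x ^ w) ^ k) \<le> 1 / (1 - x ^ w)" using x by (intro geometric_sum_le) auto
    show "(\<Sum>m\<in>M. x ^ snd m) \<le> s" using M(3) by (simp add: split_def)
    show "0 \<le> 1 / (1 - x ^ w)" using \<open>x ^ w < 1\<close> by simp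
    show "0 \<le> (\<Sum>m\<in>M. x ^ snd m)" using x by (intro sum_nonneg) auto
  qed
  finally have 3: "(\<Sum>(v, u)\<in>M'. x ^ u) \<le> s * (1 / (1 - x ^ w))" by (simp add: mult.commute)
  have 4: "{t ^ a * y | a y. y \<in> Y} \<subseteq> K"
    if K: "additive_subgroup_set K" "E n \<subseteq> K" "fst ` M' \<subseteq> K" for K
  proof -
    \<comment> \<open>The part of \<open>K\<close> that stays in \<open>K\<close> under left
      multiplication by all powers of \<open>t - 1\<close>. It is stable under \<open>t - 1\<close>
      and therefore under \<open>t\<close>, which replaces the binomial expansion.\<close>
    define K' where "K' = {u. \<forall>k. (t - 1) ^ k * u \<in> K}"
    have addK': "additive_subgroup_set K'"
      unfolding additive_subgroup_set_def K'_def using add_zero[OF K(1)] add_diff[OF K(1)]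
      by (auto simp: right_diff_distrib)
    have "E n \<subseteq> K'" unfolding K'_def using K(2) E_left by blast
    moreover have "fst ` M \<subseteq> K'"
    proof clarify
      fix v u assume vu: "(v, u) \<in> M"
      have "(t - 1) ^ k * v \<in> K" for k
      proof (cases "k < n")
        case True
        then have "f (k, v, u) \<in> M'" using vu unfolding M'_def by auto
        then have "fst (f (k, v, u)) \<in> K" using K(3) by blast
        then show ?thesis by (simp add: f_def)
      next
        case False
        have "n \<le> k * w" using False w
          by (metis le_trans linorder_not_less mult.right_neutral mult_le_mono2)
        then have "(t - 1) ^ k \<in> E n" using E_power[OF t, of k] E_mono by blast
        then show ?thesis using E_right K(2) by blast
      qed
      then show "fst (v, u) \<in> K'" unfolding K'_def by simp
    qed
    ultimately have YK: "Y \<subseteq> K'" using M(4)[OF addK'] by blast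
    have tK: "t * u \<in> K'" if "u \<in> K'" for u
    proof -
      have "(t - 1) * u \<in> K'" using that unfolding K'_def
        by (simp add: mult.assoc[symmetric] power_Suc2[symmetric] del: power_Suc)
      then have "(t - 1) * u + u \<in> K'" using that add_plus[OF addK'] by blast
      then show ?thesis by (simp add: left_diff_distrib)
    qed
    have "t ^ a * y \<in> K'" if "y \<in> Y" for a y
      by (induction a) (use that YK tK in \<open>auto simp: mult.assoc\<close>)
    then have "(t - 1) ^ 0 * (t ^ a * y) \<in> K" if "y \<in> Y" for a y using that unfolding K'_def by blast
    then show ?thesis by auto
  qed
  show ?thesis unfolding weighted_span_def using 1 2 3 4 by (intro exI[of _ M']) auto
qed

lemma delta_pow:
  assumes g: "g \<in> D w" and w: "w \<ge> 1"
  shows "g [^] (k::nat) \<in> D w" and "(\<mu> (g [^] k) - 1) - of_nat k * (\<mu> g - 1) \<in> E (Suc w)"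
    and "\<mu> (g [^] k) - \<mu> g ^ k \<in> E n"
proof -
  have gc: "g \<in> carrier G" using g D_carrier by blast
  show *: "g [^] k \<in> D w" for k :: nat
    by (induction k) (use g D_subgroup in \<open>auto intro: subgroup.m_closed subgroup.one_closed\<close>)
  show "(\<mu> (g [^] k) - 1) - of_nat k * (\<mu> g - 1) \<in> E (Suc w)"
  proof (induction k)
    case 0 then show ?case using mu_one by simp
  next
    case (Suc k)
    have "(\<mu> (g [^] k \<otimes> g) - 1) - ((\<mu> (g [^] k) - 1) + (\<mu> g - 1)) \<in> E (Suc w)"
      using delta_mult[OF * g] w by simp
    from E_plus[OF this Suc]
    have "(\<mu> (g [^] k \<otimes> g) - 1) - ((\<mu> (g [^] k) - 1) + (\<mu> g - 1)) +
      ((\<mu> (g [^] k) - 1) - of_nat k * (\<mu> g - 1)) \<in> E (Suc w)" .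
    moreover have "(\<mu> (g [^] k \<otimes> g) - 1) - ((\<mu> (g [^] k) - 1) + (\<mu> g - 1)) +
      ((\<mu> (g [^] k) - 1) - of_nat k * (\<mu> g - 1)) = (\<mu> (g [^] Suc k) - 1) - of_nat (Suc k) * (\<mu> g - 1)"
      by (simp add: algebra_simps)
    ultimately show ?case by (simp only:)
  qed
  show "\<mu> (g [^] k) - \<mu> g ^ k \<in> E n"
  proof (induction k)
    case 0 then show ?case using mu_one by simp
  next
    case (Suc k)
    have "(\<mu> (g [^] k) - \<mu> g ^ k) * \<mu> g \<in> E n" using Suc by (rule E_right)
    then have "\<mu> (g [^] k) * \<mu> g - \<mu> g ^ Suc k \<in> E n"
      by (simp add: left_diff_distrib power_Suc2 del: power_Suc)
    moreover have "\<mu> (g [^] Suc k) - \<mu> (g [^] k) * \<mu> g \<in> E n" using mu_mult gc by simp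
    ultimately show ?case using E_trans by blast
  qed
qed

text \<open>The basis of \<open>D w / D (Suc w)\<close> is adjoined one element at a time. If
  \<open>g\<close> lifts the new element \<open>b\<close>, every group element reaching
  \<open>b\<close> is a power of \<open>g\<close> times one that does without \<open>b\<close>, at
  the cost of one factor \<open>1 / (1 - x ^ w)\<close>.\<close>

lemma weighted_span_layer:
  assumes w: "1 \<le> w" "w < n" and x: "0 < x" "x < 1" and Y: "weighted_span x n (\<mu> ` D (Suc w)) s"
  shows "weighted_span x n (\<mu> ` D w) (s * (1 / (1 - x ^ w)) ^ (level (Suc w) - level w))"
proof -
  let ?L = "layer w (Suc w)" and ?E = "E (Suc w)"
  have j: "w \<le> Suc w" "Suc w \<le> 2 * w" using w by auto
  obtain B where B: "basis_mod p B ?L ?E"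
    using basis_mod_exists[OF prime_p E_add layer_additive[OF j(2)] p_mult_E finite_layer] by blast
  have "p ^ card B = p ^ (level (Suc w) - level w)"
    using basis_mod_index[OF _ E_add layer_additive[OF j(2)] p_mult_E B] index_layer(2)[OF w(1) j] p_gt_1 by simp
  then have cB: "card B = level (Suc w) - level w" using p_gt_1 by simp
  have fB: "finite B" and BL: "B \<subseteq> ?L" and span: "\<And>u. u \<in> ?L \<Longrightarrow> \<exists>a. u - int_comb a B \<in> ?E"
    using B unfolding basis_mod_def by auto
  \<comment> \<open>The elements of \<open>D w\<close> whose class in the layer is spanned by
    \<open>A\<close>: this interpolates between \<open>D (Suc w)\<close> for empty \<open>A\<close>
    and \<open>D w\<close> for \<open>A = B\<close>.\<close>
  define S where "S A = \<mu> ` {g \<in> D w. \<exists>a. (\<mu> g - 1) - int_comb a A \<in> ?E}" for A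
  have "A \<subseteq> B \<Longrightarrow> weighted_span x n (S A) (s * (1 / (1 - x ^ w)) ^ card A)" if "finite A" for A
    using that
  proof (induction A rule: finite_induct)
    case empty
    have "S {} \<subseteq> \<mu> ` D (Suc w)" unfolding S_def by (auto simp: int_comb_def congruence_subgroup_def)
    then have "\<exists>z\<in>\<mu> ` D (Suc w). y - z \<in> E n" if "y \<in> S {}" for y
      using that E_zero by (intro bexI[of _ y]) auto
    then show ?case by (intro weighted_span_mono[OF Y]) auto
  next
    case (insert b A)
    have "b \<in> ?L" using insert BL by auto
    then obtain g where g: "g \<in> D w" and bg: "b - (\<mu> g - 1) \<in> ?E" unfolding layer_def by blast
    have gc: "g \<in> carrier G" and gE: "\<mu> g - 1 \<in> E w" using g by (auto simp: congruence_subgroup_def)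
    have "weighted_span x n {\<mu> g ^ a * y | a y. y \<in> S A} (s * (1 / (1 - x ^ w)) ^ card A * (1 / (1 - x ^ w)))"
      using insert by (intro weighted_span_powers x w gE) auto
    then show ?case
    proof (rule weighted_span_mono)
      show "s * (1 / (1 - x ^ w)) ^ card A * (1 / (1 - x ^ w)) \<le> s * (1 / (1 - x ^ w)) ^ card (insert b A)"
        using insert by (simp add: mult_ac)
      fix y assume "y \<in> S (insert b A)"
      then obtain h a where h: "h \<in> D w" "y = \<mu> h" and a: "(\<mu> h - 1) - int_comb a (insert b A) \<in> ?E"
        unfolding S_def by blast
      have hc: "h \<in> carrier G" using h D_carrier by blast
      \<comment> \<open>The coefficient of \<open>b\<close> matters only modulo \<open>p\<close>,
        and its residue is a natural exponent, as \<open>weighted_span_powers\<close>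
        requires.\<close>
      define k where "k = nat (a b mod int p)"
      define q where "q = inv (g [^] k) \<otimes> h"
      have gk: "g [^] k \<in> D w" using delta_pow(1)[OF g w(1)] .
      then have gkc: "g [^] k \<in> carrier G" using D_carrier by blast
      have igk: "inv (g [^] k) \<in> D w" using gk D_subgroup by (simp add: subgroup.m_inv_closed)
      have qD: "q \<in> D w" unfolding q_def using igk h D_subgroup by (simp add: subgroup.m_closed)
      have hq: "h = g [^] k \<otimes> q" unfolding q_def using gkc hc by (simp add: m_assoc[symmetric])
      have e1: "(\<mu> h - 1) - ((\<mu> (g [^] k) - 1) + (\<mu> q - 1)) \<in> ?E"
        unfolding hq using delta_mult[OF gk qD j(2)] .
      have e2: "(\<mu> (g [^] k) - 1) - of_nat k * (\<mu> g - 1) \<in> ?E" by (rule delta_pow(2)[OF g w(1)])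
      have e3: "of_nat k * (b - (\<mu> g - 1)) \<in> ?E" using bg by (rule E_left)
      have e4: "of_int (a b - int k) * b \<in> ?E"
      proof -
        have "a b - int k = int p * (a b div int p)" unfolding k_def using p_gt_1 by (simp add: minus_mod_eq_mult_div)
        then have "of_int (a b - int k) * b = of_nat p * (of_int (a b div int p) * b)" by (simp add: mult.assoc)
        then show ?thesis using p_mult_E by simp
      qed
      have e5: "int_comb a (insert b A) = of_int (a b) * b + int_comb a A"
        using insert by (simp add: int_comb_def)
      have "(\<mu> q - 1) - int_comb a A = ((\<mu> h - 1) - int_comb a (insert b A)) - ((\<mu> h - 1) - ((\<mu> (g [^] k) - 1) + (\<mu> q - 1)))
         - ((\<mu> (g [^] k) - 1) - of_nat k * (\<mu> g - 1)) + of_nat k * (b - (\<mu> g - 1)) + of_int (a b - int k) * b"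
        unfolding e5 by (simp add: algebra_simps)
      then have "(\<mu> q - 1) - int_comb a A \<in> ?E"
        using E_plus[OF E_plus[OF E_diff[OF E_diff[OF a e1] e2] e3] e4] by (simp only:)
      then have "\<mu> q \<in> S A" using qD unfolding S_def by blast
      moreover have "y - \<mu> g ^ k * \<mu> q \<in> E n"
      proof -
        have "\<mu> h - \<mu> (g [^] k) * \<mu> q \<in> E n" unfolding hq using mu_mult gkc qD D_carrier by blast
        moreover have "(\<mu> (g [^] k) - \<mu> g ^ k) * \<mu> q \<in> E n" using delta_pow(3)[OF g w(1)] by (rule E_right)
        ultimately show ?thesis using E_plus h by (fastforce simp: left_diff_distrib)
      qed
      ultimately show "\<exists>z\<in>{\<mu> g ^ a * y | a y. y \<in> S A}. y - z \<in> E n" by blast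
    qed
  qed
  from this[OF fB] have "weighted_span x n (S B) (s * (1 / (1 - x ^ w)) ^ card B)" by simp
  moreover have "S B = \<mu> ` D w" unfolding S_def using span delta_layer by auto
  ultimately show ?thesis using cB by simp
qed

text \<open>Layers are adjoined from \<open>D n\<close> upwards to \<open>D 1\<close>, the whole
  group. Modulo \<open>E n\<close> the image of \<open>D n\<close> is just \<open>1\<close>, which
  costs a single generator of weight \<open>0\<close>.\<close>

lemma weighted_span_carrier:
  assumes n: "1 \<le> n" and x: "0 < x" "x < 1"
  shows "weighted_span x n (\<mu> ` carrier G) (\<Prod>w\<in>{1..<n}. (1 / (1 - x ^ w)) ^ (level (Suc w) - level w))"
proof -
  have "1 \<le> m \<Longrightarrow> weighted_span x n (\<mu> ` D m) (\<Prod>w\<in>{m..<n}. (1 / (1 - x ^ w)) ^ (level (Suc w) - level w))"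
    if "m \<le> n" for m
    using that
  proof (induction m rule: inc_induct)
    case base
    have "\<mu> ` D n \<subseteq> K" if "additive_subgroup_set K" "E n \<subseteq> K" "fst ` {(1::'r, 0::nat)} \<subseteq> K" for K
    proof
      fix y assume "y \<in> \<mu> ` D n"
      then have "y - 1 \<in> E n" by (auto simp: congruence_subgroup_def)
      then show "y \<in> K" using that add_mem_iff[OF that(1), of y 1] by auto
    qed
    then show ?case unfolding weighted_span_def using E_0 by (intro exI[of _ "{(1, 0)}"]) auto
  next
    case (step m)
    then have "weighted_span x n (\<mu> ` D m) ((\<Prod>w\<in>{Suc m..<n}. (1 / (1 - x ^ w)) ^ (level (Suc w) - level w)) *
       (1 / (1 - x ^ m)) ^ (level (Suc m) - level m))"
      by (intro weighted_span_layer x) auto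
    then show ?case using step by (simp add: prod.atLeast_Suc_lessThan mult.commute)
  qed
  from this[OF n] show ?thesis unfolding D_1 by simp
qed

text \<open>Generators of weight at least \<open>n\<close> already lie in \<open>E n\<close>.
  \<open>N\<close> counts the others, and each of them contributes at least \<open>x ^ n\<close> to
  the generating function because \<open>x < 1\<close>.\<close>

lemma index_E_le:
  assumes n: "1 \<le> n" and x: "0 < x" "x < 1"
    and span: "\<And>K. additive_subgroup_set K \<Longrightarrow> E n \<subseteq> K \<Longrightarrow> \<mu> ` carrier G \<subseteq> K \<Longrightarrow> K = UNIV"
  shows "\<exists>N. add_index UNIV (E n) \<le> p ^ N \<and>
    real N * x ^ n \<le> (\<Prod>w\<in>{1..<n}. (1 / (1 - x ^ w)) ^ (level (Suc w) - level w))"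
proof -
  obtain M where M: "finite M" "\<forall>(v, w)\<in>M. v \<in> E w"
    "(\<Sum>(v, w)\<in>M. x ^ w) \<le> (\<Prod>w\<in>{1..<n}. (1 / (1 - x ^ w)) ^ (level (Suc w) - level w))"
    "\<And>K. additive_subgroup_set K \<Longrightarrow> E n \<subseteq> K \<Longrightarrow> fst ` M \<subseteq> K \<Longrightarrow> \<mu> ` carrier G \<subseteq> K"
    using weighted_span_carrier[OF n x] unfolding weighted_span_def by blast
  define M' where "M' = {m \<in> M. snd m < n}"
  define V where "V = fst ` M'"
  define K where "K = {u. \<exists>a. u - int_comb a V \<in> E n}"
  have fM': "finite M'" and fV: "finite V" using M by (auto simp: M'_def V_def)
  have K: "additive_subgroup_set K" unfolding K_def by (rule int_comb_closure_additive[OF E_add])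
  have EK: "E n \<subseteq> K" unfolding K_def by (auto intro!: exI[of _ "\<lambda>_. 0"] simp: int_comb_def)
  have VK: "V \<subseteq> K"
  proof
    fix v assume "v \<in> V"
    then show "v \<in> K" unfolding K_def
      by (intro CollectI exI[of _ "\<lambda>x. if x = v then 1 else 0"]) (simp add: int_comb_single[OF fV] E_zero)
  qed
  have "fst ` M \<subseteq> K"
  proof clarify
    fix v w assume vw: "(v, w) \<in> M"
    show "fst (v, w) \<in> K"
    proof (cases "w < n")
      case True
      then have "v \<in> V" using vw unfolding V_def M'_def by force
      then show ?thesis using VK by auto
    next
      case False
      then show ?thesis using M(2) vw E_mono[of n w] EK by fastforce
    qed
  qed
  then have "K = UNIV" using span K EK M(4) by blast
  then have "add_index UNIV (E n) \<le> p ^ card V"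
    using p_gt_1 by (intro add_index_le_span E_add p_mult_E fV) (auto simp: K_def)
  also have "\<dots> \<le> p ^ card M'" using p_gt_1 fM' by (intro power_increasing) (auto simp: V_def card_image_le)
  finally have 1: "add_index UNIV (E n) \<le> p ^ card M'" .
  have "real (card M') * x ^ n = (\<Sum>m\<in>M'. x ^ n)" by simp
  also have "\<dots> \<le> (\<Sum>m\<in>M'. x ^ snd m)"
    using x by (intro sum_mono power_decreasing) (auto simp: M'_def)
  also have "\<dots> \<le> (\<Sum>m\<in>M. x ^ snd m)" using x M by (intro sum_mono2) (auto simp: M'_def)
  finally have 2: "real (card M') * x ^ n \<le> (\<Prod>w\<in>{1..<n}. (1 / (1 - x ^ w)) ^ (level (Suc w) - level w))"
    using M(3) by (simp add: split_def)
  show ?thesis using 1 2 by blast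
qed

end

section \<open>Noncommutative power series\<close>

text \<open>Unfolded, this is the sum of \<open>f u * g v\<close> over all splittings
  \<open>w = u @ v\<close>; the recursion separates the empty prefix from those that take the first
  letter.\<close>

fun convolution :: "(nat list \<Rightarrow> int) \<Rightarrow> (nat list \<Rightarrow> int) \<Rightarrow> nat list \<Rightarrow> int" where
  "convolution f g [] = f [] * g []"
| "convolution f g (a # w) = f [] * g (a # w) + convolution (\<lambda>v. f (a # v)) g w"

text \<open>A type cannot depend on \<open>d\<close> and \<open>p\<close>, so one ring over all
  letters and all integers serves every case, and both parameters enter through ideals only.\<close>

typedef nc_series = "UNIV :: (nat list \<Rightarrow> int) set"
  morphisms nc_coeff Abs_nc_series by simp

setup_lifting type_definition_nc_series

lemma convolution_add_left: "convolution (\<lambda>v. f v + f' v) g w = convolution f g w + convolution f' g w"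
  by (induction w arbitrary: f f') (auto simp: algebra_simps)

lemma convolution_add_right: "convolution f (\<lambda>v. g v + g' v) w = convolution f g w + convolution f g' w"
  by (induction w arbitrary: f) (auto simp: algebra_simps)

lemma convolution_scale_left: "convolution (\<lambda>v. c * f v) g w = c * convolution f g w"
  by (induction w arbitrary: f) (auto simp: algebra_simps)

lemma convolution_zero_left: "convolution (\<lambda>v. 0) g w = 0"
  by (induction w) auto

lemma convolution_one_left: "convolution (\<lambda>v. if v = [] then 1 else 0) g w = g w"
  by (cases w) (auto simp: convolution_zero_left)

lemma convolution_one_right: "convolution f (\<lambda>v. if v = [] then 1 else 0) w = f w"
  by (induction w arbitrary: f) auto

lemma convolution_assoc: "convolution (convolution f g) h w = convolution f (convolution g h) w"
proof (induction w arbitrary: f g)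
  case (Cons a w)
  have "convolution (\<lambda>v. convolution f g (a # v)) h w =
    convolution (\<lambda>v. f [] * g (a # v)) h w + convolution (convolution (\<lambda>v. f (a # v)) g) h w"
    by (simp add: convolution_add_left)
  then show ?case using Cons by (simp add: convolution_scale_left algebra_simps)
qed simp

lemma convolution_snoc:
  "convolution f g (w @ [i]) = convolution f (\<lambda>v. g (v @ [i])) w + f (w @ [i]) * g []"
  by (induction w arbitrary: f) auto

instantiation nc_series :: ring_1
begin

lift_definition zero_nc_series :: nc_series is "\<lambda>_. 0" .
lift_definition one_nc_series :: nc_series is "\<lambda>w. if w = [] then 1 else 0" .
lift_definition plus_nc_series :: "nc_series \<Rightarrow> nc_series \<Rightarrow> nc_series" is "\<lambda>f g w. f w + g w" .
lift_definition minus_nc_series :: "nc_series \<Rightarrow> nc_series \<Rightarrow> nc_series" is "\<lambda>f g w. f w - g w" .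
lift_definition uminus_nc_series :: "nc_series \<Rightarrow> nc_series" is "\<lambda>f w. - f w" .
lift_definition times_nc_series :: "nc_series \<Rightarrow> nc_series \<Rightarrow> nc_series" is convolution .

instance
proof
  fix a b c :: nc_series
  show "a + b + c = a + (b + c)" "a + b = b + a" "0 + a = a" "- a + a = 0" "a - b = a + - b"
    by (transfer; auto)+
  show "a * b * c = a * (b * c)" by transfer (auto simp: convolution_assoc)
  show "1 * a = a" by transfer (auto simp: convolution_one_left)
  show "a * 1 = a" by transfer (auto simp: convolution_one_right)
  show "(a + b) * c = a * c + b * c" by transfer (auto simp: convolution_add_left)
  show "a * (b + c) = a * b + a * c" by transfer (auto simp: convolution_add_right)
  show "(0::nc_series) \<noteq> 1" by transfer (metis zero_neq_one)
qed

end

lemmas nc_coeff_simps [simp] = zero_nc_series.rep_eq one_nc_series.rep_eq plus_nc_series.rep_eq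
  minus_nc_series.rep_eq uminus_nc_series.rep_eq

lemma nc_coeff_times: "nc_coeff (f * g) w = convolution (nc_coeff f) (nc_coeff g) w"
  by (simp add: times_nc_series.rep_eq)

lemma nc_coeff_times_Nil [simp]: "nc_coeff (f * g) [] = nc_coeff f [] * nc_coeff g []"
  by (simp add: nc_coeff_times)

lemma nc_series_eqI: "(\<And>w. nc_coeff f w = nc_coeff g w) \<Longrightarrow> f = g"
  by (metis ext nc_coeff_inject)

lemma nc_coeff_of_int: "nc_coeff (of_int c) w = (if w = [] then c else 0)"
proof -
  have n: "nc_coeff (of_nat n) w = (if w = [] then int n else 0)" for n
    by (induction n) auto
  show ?thesis by (cases c) (auto simp: n simp del: of_nat_Suc)
qed

lemma nc_coeff_of_int_times: "nc_coeff (of_int c * f) w = c * nc_coeff f w"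
proof -
  have "nc_coeff (of_int c) = (\<lambda>v. c * (if v = [] then 1 else 0))" by (auto simp: nc_coeff_of_int)
  then show ?thesis by (simp only: nc_coeff_times convolution_scale_left convolution_one_left)
qed

lemma nc_coeff_of_nat_times: "nc_coeff (of_nat c * f) w = int c * nc_coeff f w"
  using nc_coeff_of_int_times[of "int c" f w] by simp

lemma nc_coeff_sum: "nc_coeff (sum f I) w = (\<Sum>i\<in>I. nc_coeff (f i) w)"
  by (induction I rule: infinite_finite_induct) auto

lift_definition nc_X :: "nat \<Rightarrow> nc_series" is "\<lambda>i w. if w = [i] then 1 else 0" .

text \<open>Every series \<open>f\<close> is its constant term plus the sum of all \<open>right_derivative i f * nc_X i\<close>.\<close>

lift_definition right_derivative :: "nat \<Rightarrow> nc_series \<Rightarrow> nc_series" is "\<lambda>i f w. f (w @ [i])" .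

text \<open>In a product the last letter of a word comes from \<open>g\<close>, or from
  \<open>f\<close> when \<open>g\<close> contributes its constant term. This is the product rule of
  Fox calculus.\<close>

lemma right_derivative_mult:
  "right_derivative i (f * g) = f * right_derivative i g + of_int (nc_coeff g []) * right_derivative i f"
  by (rule nc_series_eqI)
    (simp add: right_derivative.rep_eq nc_coeff_times[of f] nc_coeff_of_int_times convolution_snoc mult.commute)

lemma right_derivative_diff: "right_derivative i (f - g) = right_derivative i f - right_derivative i g"
  by (rule nc_series_eqI) (simp add: right_derivative.rep_eq)

lemma right_derivative_add: "right_derivative i (f + g) = right_derivative i f + right_derivative i g"
  by (rule nc_series_eqI) (simp add: right_derivative.rep_eq)

lemma right_derivative_sum: "right_derivative i (sum f I) = (\<Sum>j\<in>I. right_derivative i (f j))"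
  by (rule nc_series_eqI) (simp add: right_derivative.rep_eq nc_coeff_sum)

lemma right_derivative_of_int: "right_derivative i (of_int c) = 0"
  by (rule nc_series_eqI) (simp add: right_derivative.rep_eq nc_coeff_of_int)

lemma right_derivative_X: "right_derivative i (nc_X j) = (if i = j then 1 else 0)"
  by (rule nc_series_eqI) (auto simp: right_derivative.rep_eq nc_X.rep_eq)

lemma nc_coeff_X_times: "nc_coeff (nc_X i * f) w = (case w of [] \<Rightarrow> 0 | a # v \<Rightarrow> if a = i then nc_coeff f v else 0)"
proof (cases w)
  case (Cons a v)
  have "(\<lambda>v. nc_coeff (nc_X i) (a # v)) = (\<lambda>v. if a = i then (if v = [] then 1 else 0) else 0)"
    by (auto simp: nc_X.rep_eq)
  then show ?thesis using Cons
    by (simp add: nc_coeff_times nc_X.rep_eq convolution_one_left convolution_zero_left)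
qed (simp add: nc_X.rep_eq)

section \<open>The Magnus embedding\<close>

text \<open>The coefficients of \<open>1 - X + X^2 - ...\<close> in the \<open>i\<close>-th
  variable, the inverse of \<open>1 + nc_X i\<close>.\<close>

fun geometric_coeff :: "nat \<Rightarrow> nat list \<Rightarrow> int" where
  "geometric_coeff i [] = 1"
| "geometric_coeff i (a # w) = (if a = i then - geometric_coeff i w else 0)"

lift_definition nc_geometric :: "nat \<Rightarrow> nc_series" is geometric_coeff .

lemma one_plus_X_geometric: "(1 + nc_X i) * nc_geometric i = 1"
proof (rule nc_series_eqI)
  fix w show "nc_coeff ((1 + nc_X i) * nc_geometric i) w = nc_coeff 1 w"
    by (cases w) (simp_all add: distrib_right nc_coeff_X_times nc_geometric.rep_eq del: nc_coeff_times_Nil)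
qed

lemma geometric_one_plus_X: "nc_geometric i * (1 + nc_X i) = 1"
proof (rule nc_series_eqI)
  define P where "P w = geometric_coeff i w + convolution (geometric_coeff i) (\<lambda>w. if w = [i] then 1 else 0) w" for w
  have neg: "convolution (\<lambda>v. if a = i then - geometric_coeff i v else 0) g w =
    (if a = i then - convolution (geometric_coeff i) g w else 0)" for g a w
    using convolution_scale_left[of "-1" "geometric_coeff i" g w] by (auto simp: convolution_zero_left)
  have P: "P w = (if w = [] then 1 else 0)" for w
    by (induction w) (auto simp: P_def neg)
  fix w show "nc_coeff (nc_geometric i * (1 + nc_X i)) w = nc_coeff 1 w"
    using P[of w] unfolding P_def
    by (simp add: distrib_left nc_coeff_times nc_geometric.rep_eq nc_X.rep_eq del: nc_coeff_times_Nil)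
qed

fun magnus_letter :: "nat \<times> bool \<Rightarrow> nc_series" where
  "magnus_letter (i, True) = 1 + nc_X i"
| "magnus_letter (i, False) = nc_geometric i"

definition magnus :: "(nat \<times> bool) list \<Rightarrow> nc_series" where
  "magnus u = prod_list (map magnus_letter u)"

lemma magnus_simps [simp]:
  "magnus [] = 1" "magnus (x # u) = magnus_letter x * magnus u" "magnus (u @ v) = magnus u * magnus v"
  by (simp_all add: magnus_def)

lemma magnus_letter_cancel: "magnus_letter (x, b) * magnus_letter (x, \<not> b) = 1"
  by (cases b) (simp_all add: one_plus_X_geometric geometric_one_plus_X)

lemma magnus_free_equiv: "free_equiv S u v \<Longrightarrow> magnus u = magnus v"
proof (induction rule: free_equiv.induct)
  case (cancel u v x b)
  then show ?case using magnus_letter_cancel[of x b] by (metis magnus_simps(2,3) mult.assoc mult_1)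
qed auto

lemma magnus_const [simp]: "nc_coeff (magnus u) [] = 1"
proof (induction u)
  case (Cons x u)
  then show ?case by (cases x rule: magnus_letter.cases) (simp_all add: nc_X.rep_eq nc_geometric.rep_eq)
qed simp

definition exponent_sum :: "nat \<Rightarrow> (nat \<times> bool) list \<Rightarrow> int" where
  "exponent_sum i u = (\<Sum>(j, b)\<leftarrow>u. if j = i then (if b then 1 else - 1) else 0)"

text \<open>The linear part of the Magnus image sees only the abelianised word; this is how
  minimality of the generating set reaches the power series.\<close>

lemma magnus_linear_coeff: "nc_coeff (magnus u) [i] = exponent_sum i u"
proof (induction u)
  case (Cons x u)
  have "nc_coeff (magnus (x # u)) [i] = nc_coeff (magnus_letter x) [] * nc_coeff (magnus u) [i] +
     nc_coeff (magnus_letter x) [i] * nc_coeff (magnus u) []"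
    by (simp add: nc_coeff_times)
  then show ?case using Cons
    by (cases x rule: magnus_letter.cases) (simp_all add: nc_X.rep_eq nc_geometric.rep_eq exponent_sum_def)
qed (simp add: exponent_sum_def)

section \<open>Filtration ideals\<close>

text \<open>Keeping integral coefficients and all natural numbers as letters, the ideals contain \<open>p\<close> and the
  letters \<open>i \<ge> d\<close>: the quotient by \<open>trunc_ideal d p n\<close> is the free associative algebra on \<open>d\<close> letters over the
  field of \<open>p\<close> elements, truncated at length \<open>n\<close>.\<close>

definition trunc_ideal :: "nat \<Rightarrow> nat \<Rightarrow> nat \<Rightarrow> nc_series set" where
  "trunc_ideal d p n = {f. \<forall>w. set w \<subseteq> {..<d} \<longrightarrow> length w < n \<longrightarrow> int p dvd nc_coeff f w}"

lemma trunc_ideal_additive: "additive_subgroup_set (trunc_ideal d p n)"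
  unfolding additive_subgroup_set_def trunc_ideal_def by auto

text \<open>When \<open>w\<close> has length below \<open>n + m\<close>, each splitting has a prefix
  shorter than \<open>n\<close> or a suffix shorter than \<open>m\<close>.\<close>

lemma convolution_dvd:
  assumes "\<And>v. set v \<subseteq> S \<Longrightarrow> length v < n \<Longrightarrow> q dvd f v" and "\<And>v. set v \<subseteq> S \<Longrightarrow> length v < m \<Longrightarrow> q dvd g v"
    and "set w \<subseteq> S" and "length w < n + m"
  shows "(q::int) dvd convolution f g w"
  using assms
proof (induction w arbitrary: f n)
  case Nil
  then show ?case by (cases n) auto
next
  case (Cons a w)
  have 1: "q dvd f [] * g (a # w)"
    using Cons.prems by (cases n) (auto intro!: dvd_mult dvd_mult2)
  have "q dvd convolution (\<lambda>v. f (a # v)) g w"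
    by (rule Cons.IH[of "n - 1"]) (use Cons.prems in \<open>auto\<close>)
  then show ?case using 1 by simp
qed

lemma trunc_ideal_mult: "f \<in> trunc_ideal d p i \<Longrightarrow> g \<in> trunc_ideal d p j \<Longrightarrow> f * g \<in> trunc_ideal d p (i + j)"
  by (auto simp: trunc_ideal_def nc_coeff_times intro!: convolution_dvd[of "{..<d}" i _ _ j])

lemma trunc_ideal_0: "trunc_ideal d p 0 = UNIV"
  by (auto simp: trunc_ideal_def)

lemma trunc_ideal_left: "f \<in> trunc_ideal d p n \<Longrightarrow> a * f \<in> trunc_ideal d p n"
  using trunc_ideal_mult[of a d p 0 f n] by (simp add: trunc_ideal_0)

lemma trunc_ideal_right: "f \<in> trunc_ideal d p n \<Longrightarrow> f * a \<in> trunc_ideal d p n"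
  using trunc_ideal_mult[of f d p n a 0] by (simp add: trunc_ideal_0)

lemma trunc_ideal_mono: "m \<le> n \<Longrightarrow> trunc_ideal d p n \<subseteq> trunc_ideal d p m"
  by (auto simp: trunc_ideal_def)

lemma trunc_ideal_p: "of_nat p * f \<in> trunc_ideal d p n"
  by (simp add: trunc_ideal_def nc_coeff_of_nat_times)

lemma trunc_ideal_finite:
  assumes "p > 0"
  shows "finite (range (add_coset (trunc_ideal d p n)))"
proof -
  define W where "W = {w. set w \<subseteq> {..<d} \<and> length w < n}"
  have "W \<subseteq> {w. set w \<subseteq> {..<d} \<and> length w \<le> n}" by (auto simp: W_def)
  then have fW: "finite W" using finite_lists_length_le[of "{..<d}" n] finite_subset by blast
  have "range (\<lambda>f. restrict (\<lambda>w. nc_coeff f w mod int p) W) \<subseteq> PiE W (\<lambda>_. {0..<int p})"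
    using assms by auto
  then have "finite (range (\<lambda>f. restrict (\<lambda>w. nc_coeff f w mod int p) W))"
    using finite_PiE[OF fW, of "\<lambda>_. {0..<int p}"] finite_subset by auto
  then show ?thesis
  proof (rule finite_image_factor)
    fix f g assume eq: "restrict (\<lambda>w. nc_coeff f w mod int p) W = restrict (\<lambda>w. nc_coeff g w mod int p) W"
    have "int p dvd nc_coeff f w - nc_coeff g w" if "w \<in> W" for w
      using fun_cong[OF eq, of w] that by (simp add: mod_eq_dvd_iff)
    then show "add_coset (trunc_ideal d p n) f = add_coset (trunc_ideal d p n) g"
      unfolding add_coset_eq_iff[OF trunc_ideal_additive] by (auto simp: trunc_ideal_def W_def)
  qed
qed

section \<open>The ideals generated by relators\<close>

text \<open>The two-sided ideal generated by \<open>F\<close> and the truncation ideal. With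
  \<open>F\<close> the Magnus images of the relators, its quotient is the algebra \<open>B\<close>
  of the overview modulo words of length \<open>n\<close>.\<close>

inductive_set rel_ideal :: "nat \<Rightarrow> nat \<Rightarrow> nc_series set \<Rightarrow> nat \<Rightarrow> nc_series set"
  for d p F n where
  trunc: "f \<in> trunc_ideal d p n \<Longrightarrow> f \<in> rel_ideal d p F n"
| rel: "f \<in> F \<Longrightarrow> f \<in> rel_ideal d p F n"
| diff: "f \<in> rel_ideal d p F n \<Longrightarrow> g \<in> rel_ideal d p F n \<Longrightarrow> f - g \<in> rel_ideal d p F n"
| left: "f \<in> rel_ideal d p F n \<Longrightarrow> a * f \<in> rel_ideal d p F n"
| right: "f \<in> rel_ideal d p F n \<Longrightarrow> f * a \<in> rel_ideal d p F n"

lemma rel_ideal_additive: "additive_subgroup_set (rel_ideal d p F n)"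
  unfolding additive_subgroup_set_def using add_zero[OF trunc_ideal_additive]
  by (auto intro: rel_ideal.intros)

lemma rel_ideal_0: "rel_ideal d p F 0 = UNIV"
  using rel_ideal.trunc[of _ d p 0] by (auto simp: trunc_ideal_0)

lemma rel_ideal_mono: "m \<le> n \<Longrightarrow> rel_ideal d p F n \<subseteq> rel_ideal d p F m"
proof
  fix f assume mn: "m \<le> n" and "f \<in> rel_ideal d p F n"
  from this(2) show "f \<in> rel_ideal d p F m"
    by induction (use trunc_ideal_mono[OF mn] in \<open>auto intro: rel_ideal.intros\<close>)
qed

text \<open>A factor from \<open>F\<close> lies in the ideal at every level, so only products of two
  truncated factors need the degree count. The inner induction varies \<open>q\<close> because
  \<open>q * (a * g) = (q * a) * g\<close> changes the left factor.\<close>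

lemma rel_ideal_mult:
  assumes "f \<in> rel_ideal d p F i" and "g \<in> rel_ideal d p F j"
  shows "f * g \<in> rel_ideal d p F (i + j)"
proof -
  from assms show ?thesis
  proof (induction arbitrary: g)
    case (trunc f)
    have "q * g \<in> rel_ideal d p F (i + j)" if "q \<in> trunc_ideal d p i" "g \<in> rel_ideal d p F j" for q g
      using that(2,1)
    proof (induction arbitrary: q)
      case (trunc g) then show ?case using trunc_ideal_mult by (blast intro: rel_ideal.trunc)
    next
      case (left g a) then show ?case using trunc_ideal_right[of q d p i a] by (simp add: mult.assoc[symmetric])
    next
      case (right g a) then show ?case by (simp add: mult.assoc[symmetric] rel_ideal.right)
    qed (auto simp: right_diff_distrib intro: rel_ideal.intros)
    then show ?case using trunc by blast
  next
    case (left f a) then show ?case by (simp add: mult.assoc rel_ideal.left)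
  next
    case (right f a) then show ?case using rel_ideal.left[of g d p F j a] by (simp add: mult.assoc)
  qed (auto simp: left_diff_distrib intro: rel_ideal.intros)
qed

lemma rel_ideal_finite:
  assumes "p > 0"
  shows "finite (range (add_coset (rel_ideal d p F n)))"
  using trunc_ideal_finite[OF assms, of d n]
  by (rule finite_image_factor)
    (auto simp: add_coset_eq_iff[OF trunc_ideal_additive] add_coset_eq_iff[OF rel_ideal_additive] intro: rel_ideal.trunc)

definition nc_monomial :: "nat list \<Rightarrow> nc_series" where
  "nc_monomial w = prod_list (map nc_X w)"

lemma nc_coeff_monomial: "nc_coeff (nc_monomial w) v = (if v = w then 1 else 0)"
proof (induction w arbitrary: v)
  case (Cons i w)
  have "nc_coeff (nc_monomial (i # w)) v = (case v of [] \<Rightarrow> 0 | a # u \<Rightarrow> if a = i then nc_coeff (nc_monomial w) u else 0)"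
    by (simp only: nc_monomial_def list.map prod_list.Cons nc_coeff_X_times)
  then show ?case using Cons by (cases v) auto
qed (simp add: nc_monomial_def)

text \<open>Since \<open>X\<close> is \<open>(1 + X) - 1\<close>, a monomial times a Magnus image is
  a difference of two such products with a shorter monomial. Modulo \<open>trunc_ideal d p n\<close>
  the monomials in \<open>d\<close> letters span everything.\<close>

lemma magnus_span:
  assumes K: "additive_subgroup_set K" and E: "trunc_ideal d p n \<subseteq> K" and M: "magnus ` free_words {..<d} \<subseteq> K"
  shows "K = UNIV"
proof -
  have mono: "nc_monomial w * magnus u \<in> K" if "set w \<subseteq> {..<d}" "u \<in> free_words {..<d}" for w u
    using that
  proof (induction w arbitrary: u rule: rev_induct)
    case Nil then show ?case using M by (auto simp: nc_monomial_def)
  next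
    case (snoc i w)
    then have "(i, True) # u \<in> free_words {..<d}" by (auto simp: free_words_def)
    then have "nc_monomial w * magnus ((i, True) # u) - nc_monomial w * magnus u \<in> K"
      using snoc.IH snoc.prems by (intro add_diff[OF K] snoc.IH) auto
    moreover have "nc_monomial (w @ [i]) * magnus u = nc_monomial w * magnus ((i, True) # u) - nc_monomial w * magnus u"
      by (simp add: nc_monomial_def algebra_simps)
    ultimately show ?case by simp
  qed
  have "f \<in> K" for f
  proof -
    define W where "W = {w. set w \<subseteq> {..<d} \<and> length w < n}"
    have "W \<subseteq> {w. set w \<subseteq> {..<d} \<and> length w \<le> n}" by (auto simp: W_def)
    then have fW: "finite W" using finite_lists_length_le[of "{..<d}" n] finite_subset by blast
    define g where "g = (\<Sum>w\<in>W. of_int (nc_coeff f w) * nc_monomial w)"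
    have "nc_monomial w \<in> K" if "w \<in> W" for w
      using mono[of w "[]"] that by (auto simp: W_def free_words_def)
    then have "g \<in> K" unfolding g_def by (intro add_sum[OF K] add_of_int[OF K])
    have "nc_coeff g v = nc_coeff f v" if "v \<in> W" for v
    proof -
      have "nc_coeff g v = (\<Sum>w\<in>W. if w = v then nc_coeff f w else 0)"
        unfolding g_def nc_coeff_sum nc_coeff_of_int_times nc_coeff_monomial by (intro sum.cong) auto
      then show ?thesis using fW that by simp
    qed
    then have "f - g \<in> trunc_ideal d p n" by (auto simp: trunc_ideal_def W_def)
    then show ?thesis using E \<open>g \<in> K\<close> add_mem_iff[OF K] by blast
  qed
  then show ?thesis by auto
qed

section \<open>The Golod--Shafarevich inequality\<close>

lemma right_derivative_trunc: "i < d \<Longrightarrow> f \<in> trunc_ideal d p (Suc n) \<Longrightarrow> right_derivative i f \<in> trunc_ideal d p n"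
  by (auto simp: trunc_ideal_def right_derivative.rep_eq)

lemma p_const_rel_ideal: "int p dvd c \<Longrightarrow> of_int c * f \<in> rel_ideal d p F n"
proof -
  assume "int p dvd c"
  then obtain k where "c = int p * k" by (rule dvdE)
  then have "of_int c * f = of_nat p * (of_int k * f)" by (simp add: mult.assoc)
  then show ?thesis using trunc_ideal_p rel_ideal.trunc by metis
qed

context
  fixes d p :: nat and F :: "nc_series set"
  assumes p: "p > 0" and fF: "finite F" and F2: "F \<subseteq> trunc_ideal d p 2"
begin

abbreviation rel_E :: "nat \<Rightarrow> nc_series set" where "rel_E \<equiv> rel_ideal d p F"

text \<open>This is the exactness behind the inequality. By the product rule, each closure step of
  the ideal changes the derivatives by a left multiple or by terms in the ideal one level lower. The
  point is that one family \<open>b\<close> serves all letters at once.\<close>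

lemma rel_ideal_derivatives:
  assumes "g \<in> rel_E (Suc m)"
  shows "int p dvd nc_coeff g [] \<and>
    (\<exists>b. \<forall>i<d. right_derivative i g - (\<Sum>f\<in>F. b f * right_derivative i f) \<in> rel_E m)"
  using assms
proof induction
  case (trunc q)
  then have "int p dvd nc_coeff q []" by (auto simp: trunc_ideal_def)
  moreover have "right_derivative i q \<in> rel_E m" if "i < d" for i
    using right_derivative_trunc[OF that trunc] by (rule rel_ideal.trunc)
  ultimately show ?case by (intro conjI exI[of _ "\<lambda>_. 0"]) auto
next
  case (rel q)
  then have "int p dvd nc_coeff q []" using F2 by (auto simp: trunc_ideal_def)
  moreover have "(\<Sum>f\<in>F. (if f = q then 1 else 0) * right_derivative i f) = right_derivative i q" for i
  proof -
    have "(\<Sum>f\<in>F. (if f = q then 1 else 0) * right_derivative i f) = (\<Sum>f\<in>F. if f = q then right_derivative i f else 0)"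
      by (intro sum.cong) auto
    then show ?thesis using fF rel by simp
  qed
  ultimately show ?case
    by (intro conjI exI[of _ "\<lambda>f. if f = q then 1 else 0"]) (auto simp: add_zero[OF rel_ideal_additive])
next
  case (diff g h)
  then obtain b c where b: "\<And>i. i < d \<Longrightarrow> right_derivative i g - (\<Sum>f\<in>F. b f * right_derivative i f) \<in> rel_E m"
    and c: "\<And>i. i < d \<Longrightarrow> right_derivative i h - (\<Sum>f\<in>F. c f * right_derivative i f) \<in> rel_E m" by blast
  have "right_derivative i (g - h) - (\<Sum>f\<in>F. (b f - c f) * right_derivative i f) \<in> rel_E m" if "i < d" for i
  proof -
    have "right_derivative i (g - h) - (\<Sum>f\<in>F. (b f - c f) * right_derivative i f) =
      (right_derivative i g - (\<Sum>f\<in>F. b f * right_derivative i f)) - (right_derivative i h - (\<Sum>f\<in>F. c f * right_derivative i f))"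
      by (simp add: right_derivative_diff left_diff_distrib sum_subtractf)
    then show ?thesis using rel_ideal.diff[OF b[OF that] c[OF that]] by simp
  qed
  then show ?case using diff by (intro conjI exI[of _ "\<lambda>f. b f - c f"]) auto
next
  case (left g a)
  then obtain b where b: "\<And>i. i < d \<Longrightarrow> right_derivative i g - (\<Sum>f\<in>F. b f * right_derivative i f) \<in> rel_E m" by blast
  have "right_derivative i (a * g) - (\<Sum>f\<in>F. (a * b f) * right_derivative i f) \<in> rel_E m" if "i < d" for i
  proof -
    have 1: "a * (right_derivative i g - (\<Sum>f\<in>F. b f * right_derivative i f)) \<in> rel_E m" using b[OF that] by (rule rel_ideal.left)
    have 2: "of_int (nc_coeff g []) * right_derivative i a \<in> rel_E m" using left by (intro p_const_rel_ideal) simp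
    have "right_derivative i (a * g) - (\<Sum>f\<in>F. (a * b f) * right_derivative i f) =
      a * (right_derivative i g - (\<Sum>f\<in>F. b f * right_derivative i f)) + of_int (nc_coeff g []) * right_derivative i a"
      by (simp add: right_derivative_mult right_diff_distrib sum_distrib_left mult.assoc)
    then show ?thesis using add_plus[OF rel_ideal_additive 1 2] by simp
  qed
  then show ?case using left by (intro conjI exI[of _ "\<lambda>f. a * b f"]) auto
next
  case (right g a)
  then obtain b where b: "\<And>i. i < d \<Longrightarrow> right_derivative i g - (\<Sum>f\<in>F. b f * right_derivative i f) \<in> rel_E m" by blast
  have gm: "g \<in> rel_E m" using right rel_ideal_mono[of m "Suc m"] by auto
  have "right_derivative i (g * a) - (\<Sum>f\<in>F. (of_int (nc_coeff a []) * b f) * right_derivative i f) \<in> rel_E m" if "i < d" for i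
  proof -
    have 1: "of_int (nc_coeff a []) * (right_derivative i g - (\<Sum>f\<in>F. b f * right_derivative i f)) \<in> rel_E m"
      using b[OF that] by (rule rel_ideal.left)
    have 2: "g * right_derivative i a \<in> rel_E m" using gm by (rule rel_ideal.right)
    have "right_derivative i (g * a) - (\<Sum>f\<in>F. (of_int (nc_coeff a []) * b f) * right_derivative i f) =
      of_int (nc_coeff a []) * (right_derivative i g - (\<Sum>f\<in>F. b f * right_derivative i f)) + g * right_derivative i a"
      by (simp add: right_derivative_mult right_diff_distrib sum_distrib_left mult.assoc)
    then show ?thesis using add_plus[OF rel_ideal_additive 1 2] by simp
  qed
  then show ?case using right by (intro conjI exI[of _ "\<lambda>f. of_int (nc_coeff a []) * b f"]) auto
qed

text \<open>Exactness of the sequence \<open>(A / rel_E n) ^ F \<rightarrow> (A / rel_E (n + 1)) ^ d \<times> \<int> / p \<rightarrow> A / rel_E (n + 2)\<close>, whose second map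
  sends \<open>(a, c)\<close> to \<open>c + \<Sum>i. a i * X i\<close>, bounds the size of the middle term.\<close>

lemma golod_shafarevich:
  "p * add_index UNIV (rel_E (n + 1)) ^ d \<le> add_index UNIV (rel_E (n + 2)) * add_index UNIV (rel_E n) ^ card F"
proof -
  let ?k = "\<lambda>m. add_coset (rel_E m)"
  have fin: "finite (range (?k m))" for m using rel_ideal_finite[OF p] .
  note eq = add_coset_eq_iff[OF rel_ideal_additive]
  \<comment> \<open>The middle term of the sequence, with classes as coordinates and the constant
    term as a residue.\<close>
  define Dm where "Dm = (PiE {..<d} (\<lambda>_. range (?k (n + 1)))) \<times> {0..<int p}"
  define rep where "rep C = (SOME u. C = ?k (n + 1) u)" for C
  have rep: "?k (n + 1) (rep C) = C" if "C \<in> range (?k (n + 1))" for C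
  proof -
    have "\<exists>u. C = ?k (n + 1) u" using that by auto
    from someI_ex[OF this] show ?thesis by (simp add: rep_def)
  qed
  define h where "h = (\<lambda>(\<alpha>, c). of_int c + (\<Sum>i<d. rep (\<alpha> i) * nc_X i))"
  define s where "s x = ?k (n + 2) (h x)" for x
  \<comment> \<open>One base point is fixed in each fibre of \<open>s\<close>, the second map of the
    sequence, so that the position of any other point in the fibre is a difference.\<close>
  define base where "base t = (SOME x. x \<in> Dm \<and> s x = t)" for t
  have base: "base (s x) \<in> Dm \<and> s (base (s x)) = s x" if "x \<in> Dm" for x
    unfolding base_def by (rule someI[of "\<lambda>y. y \<in> Dm \<and> s y = s x" x]) (use that in simp)
  have hN: "nc_coeff (h (\<alpha>, c)) [] = c" for \<alpha> c
    by (simp add: h_def nc_coeff_of_int nc_coeff_sum nc_X.rep_eq)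
  have hD: "right_derivative i (h (\<alpha>, c)) = rep (\<alpha> i)" if "i < d" for \<alpha> c i
  proof -
    have "right_derivative i (h (\<alpha>, c)) = (\<Sum>j<d. right_derivative i (rep (\<alpha> j) * nc_X j))"
      by (simp add: h_def right_derivative_add right_derivative_of_int right_derivative_sum)
    also have "\<dots> = (\<Sum>j<d. if j = i then rep (\<alpha> j) else 0)"
      by (intro sum.cong) (auto simp: right_derivative_mult right_derivative_X nc_X.rep_eq)
    finally have "right_derivative i (h (\<alpha>, c)) = (\<Sum>j<d. if j = i then rep (\<alpha> j) else 0)" .
    then show ?thesis using that by simp
  qed
  have diff: "int p dvd snd x - snd y \<and> (\<exists>b. \<forall>i<d. rep (fst x i) - rep (fst y i) - (\<Sum>f\<in>F. b f * right_derivative i f) \<in> rel_E (n + 1))"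
    if xy: "s x = s y" for x y
  proof -
    have "h x - h y \<in> rel_E (Suc (n + 1))" using xy eq unfolding s_def by simp
    from rel_ideal_derivatives[OF this]
    show ?thesis using hN[of "fst x" "snd x"] hN[of "fst y" "snd y"] hD[of _ "fst x" "snd x"] hD[of _ "fst y" "snd y"]
      by (simp add: right_derivative_diff)
  qed
  \<comment> \<open>A preimage, under the first map, of the difference between a point and its base
    point. The value of \<open>s\<close> and the class of \<open>bb\<close> modulo
    \<open>rel_E n\<close> then determine the point.\<close>
  define bb where "bb x = (SOME b. \<forall>i<d. rep (fst x i) - rep (fst (base (s x)) i) - (\<Sum>f\<in>F. b f * right_derivative i f) \<in> rel_E (n + 1))" for x
  have bb: "rep (fst x i) - rep (fst (base (s x)) i) - (\<Sum>f\<in>F. bb x f * right_derivative i f) \<in> rel_E (n + 1)"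
    if "x \<in> Dm" "i < d" for x i
  proof -
    have "\<exists>b. \<forall>i<d. rep (fst x i) - rep (fst (base (s x)) i) - (\<Sum>f\<in>F. b f * right_derivative i f) \<in> rel_E (n + 1)"
      using diff base that by metis
    from someI_ex[OF this] show ?thesis using that unfolding bb_def by blast
  qed
  define \<Phi> where "\<Phi> x = (s x, restrict (\<lambda>f. ?k n (bb x f)) F)" for x
  have inj: "inj_on \<Phi> Dm"
  proof (rule inj_onI)
    fix x y assume x: "x \<in> Dm" and y: "y \<in> Dm" and "\<Phi> x = \<Phi> y"
    then have sxy: "s x = s y" and r: "restrict (\<lambda>f. ?k n (bb x f)) F = restrict (\<lambda>f. ?k n (bb y f)) F"
      by (auto simp: \<Phi>_def)
    have bE: "bb x f - bb y f \<in> rel_E n" if "f \<in> F" for f using fun_cong[OF r, of f] that eq by simp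
    have "int p dvd snd x - snd y" using diff[OF sxy] by blast
    moreover have "snd x \<in> {0..<int p}" "snd y \<in> {0..<int p}" using x y by (auto simp: Dm_def)
    ultimately have c: "snd x = snd y" by (metis atLeastLessThan_iff mod_eq_dvd_iff mod_pos_pos_trivial)
    have "fst x = fst y"
    proof (rule PiE_ext)
      show x1: "fst x \<in> PiE {..<d} (\<lambda>_. range (?k (n + 1)))" and y1: "fst y \<in> PiE {..<d} (\<lambda>_. range (?k (n + 1)))"
        using x y by (simp_all only: Dm_def mem_Times_iff)
      fix i assume i: "i \<in> {..<d}"
      then have id: "i < d" by simp
      have 1: "rep (fst x i) - rep (fst (base (s x)) i) - (\<Sum>f\<in>F. bb x f * right_derivative i f) \<in> rel_E (n + 1)"
        by (rule bb[OF x id])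
      have 2: "rep (fst y i) - rep (fst (base (s x)) i) - (\<Sum>f\<in>F. bb y f * right_derivative i f) \<in> rel_E (n + 1)"
        using bb[OF y id] sxy by simp
      \<comment> \<open>Here degree two of the relators is used: their derivatives lie in
        \<open>rel_E 1\<close>, so changing a coefficient by \<open>rel_E n\<close> changes the sum
        only by \<open>rel_E (n + 1)\<close>.\<close>
      have 3: "(\<Sum>f\<in>F. (bb x f - bb y f) * right_derivative i f) \<in> rel_E (n + 1)"
      proof (rule add_sum[OF rel_ideal_additive])
        fix f assume f: "f \<in> F"
        have "right_derivative i f \<in> trunc_ideal d p 1"
          using right_derivative_trunc[OF id, of f p 1] F2 f by (auto simp: numeral_2_eq_2)
        then have "right_derivative i f \<in> rel_E 1" by (rule rel_ideal.trunc)
        then show "(bb x f - bb y f) * right_derivative i f \<in> rel_E (n + 1)" using rel_ideal_mult[OF bE[OF f]] by blast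
      qed
      have "rep (fst x i) - rep (fst y i) = (rep (fst x i) - rep (fst (base (s x)) i) - (\<Sum>f\<in>F. bb x f * right_derivative i f)) -
        (rep (fst y i) - rep (fst (base (s x)) i) - (\<Sum>f\<in>F. bb y f * right_derivative i f)) + (\<Sum>f\<in>F. (bb x f - bb y f) * right_derivative i f)"
        by (simp add: left_diff_distrib sum_subtractf)
      then have "rep (fst x i) - rep (fst y i) \<in> rel_E (n + 1)"
        using add_plus[OF rel_ideal_additive add_diff[OF rel_ideal_additive 1 2] 3] by (simp only:)
      then have "?k (n + 1) (rep (fst x i)) = ?k (n + 1) (rep (fst y i))" using eq by blast
      moreover have "fst x i \<in> range (?k (n + 1))" "fst y i \<in> range (?k (n + 1))" using PiE_mem[OF x1 i] PiE_mem[OF y1 i] .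
      ultimately show "fst x i = fst y i" using rep by simp
    qed
    then show "x = y" using c by (simp add: prod_eq_iff)
  qed
  have sub: "\<Phi> ` Dm \<subseteq> range (?k (n + 2)) \<times> PiE F (\<lambda>_. range (?k n))"
    by (auto simp: \<Phi>_def s_def)
  have "card Dm \<le> card (range (?k (n + 2)) \<times> PiE F (\<lambda>_. range (?k n)))"
    using fin fF by (intro card_inj_on_le[OF inj sub]) (auto intro!: finite_PiE)
  then show ?thesis
    unfolding Dm_def add_index_def using fF by (simp add: card_cartesian_product card_PiE mult.commute)
qed

lemma rel_index_pos: "add_index UNIV (rel_E n) > 0"
  unfolding add_index_def using rel_ideal_finite[OF p] by (simp add: card_gt_0_iff)

text \<open>Constant terms of elements of the ideal are divisible by \<open>p\<close>, so the
  constants \<open>0, ..., p - 1\<close> lie in distinct cosets.\<close>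

lemma rel_index_1: "p \<le> add_index UNIV (rel_E 1)"
proof -
  have "inj_on (\<lambda>c. add_coset (rel_E 1) (of_int c)) {0..<int p}"
  proof (rule inj_onI)
    fix a b assume a: "a \<in> {0..<int p}" and b: "b \<in> {0..<int p}"
      and "add_coset (rel_E 1) (of_int a) = add_coset (rel_E 1) (of_int b)"
    then have "of_int a - of_int b \<in> rel_E (Suc 0)" using add_coset_eq_iff[OF rel_ideal_additive] by simp
    then have "int p dvd a - b" using rel_ideal_derivatives by (fastforce simp: nc_coeff_of_int)
    then show "a = b" using a b by (metis atLeastLessThan_iff mod_eq_dvd_iff mod_pos_pos_trivial)
  qed
  then have "card {0..<int p} \<le> card (range (add_coset (rel_E 1)))"
    by (rule card_inj_on_le) (auto simp: rel_ideal_finite[OF p])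
  then show ?thesis by (simp add: add_index_def)
qed

end

text \<open>For roots \<open>l\<close> and \<open>m\<close> of the characteristic polynomial, the
  difference \<open>\<beta> (n + 1) - m * \<beta> n\<close> grows by a factor of at least
  \<open>l\<close> in each step; since \<open>m\<close> and \<beta> are nonnegative, it is a lower
  bound for \<open>\<beta> (n + 1)\<close>.\<close>

lemma linear_recursion_growth:
  fixes \<beta> :: "nat \<Rightarrow> real"
  assumes 0: "\<beta> 0 = 0" and 1: "\<beta> 1 \<ge> 1" and pos: "\<And>n. \<beta> n \<ge> 0"
    and rec: "\<And>n. \<beta> (n + 2) \<ge> 1 + (l + m) * \<beta> (n + 1) - l * m * \<beta> n"
    and l: "l \<ge> 3 / 2" and m: "m \<ge> 0"
  shows "\<beta> (Suc n) \<ge> (3 / 2) ^ n"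
proof -
  have g: "\<beta> (Suc n) - m * \<beta> n \<ge> (3 / 2) ^ n" for n
  proof (induction n)
    case 0 then show ?case using assms by simp
  next
    case (Suc n)
    have "\<beta> (Suc (Suc n)) - m * \<beta> (Suc n) \<ge> l * (\<beta> (Suc n) - m * \<beta> n)"
      using rec[of n] by (simp add: algebra_simps)
    moreover have "l * (\<beta> (Suc n) - m * \<beta> n) \<ge> l * (3 / 2) ^ n" using Suc l by (intro mult_left_mono) auto
    moreover have "l * (3 / 2) ^ n \<ge> (3 / 2) * (3 / 2) ^ n" using l by (intro mult_right_mono) auto
    ultimately show ?case unfolding power_Suc by linarith
  qed
  then show ?thesis using m pos[of n] by (smt (verit) mult_nonneg_nonneg)
qed

text \<open>Logarithms turn the product inequality into a linear recursion. The bound on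
  \<open>card F\<close> makes the roots real, and then the larger one is at least
  \<open>d / 2\<close>; two letters without relators give the root \<open>2\<close>.\<close>

lemma golod_shafarevich_growth:
  assumes p: "p > 1" and fF: "finite F" and F2: "F \<subseteq> trunc_ideal d p 2"
    and r: "real (card F) \<le> (real d)\<^sup>2 / 4" and d: "d \<ge> 3 \<or> d = 2 \<and> F = {}"
  shows "log p (add_index UNIV (rel_ideal d p F (Suc n))) \<ge> (3 / 2) ^ n"
proof -
  have p0: "p > 0" using p by simp
  define \<beta> where "\<beta> n = log p (add_index UNIV (rel_ideal d p F n))" for n
  define l where "l = (d + sqrt ((real d)\<^sup>2 - 4 * card F)) / 2"
  define m where "m = (d - sqrt ((real d)\<^sup>2 - 4 * card F)) / 2"
  have idx: "add_index UNIV (rel_ideal d p F n) > 0" for n using rel_index_pos[OF p0 fF F2] .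
  have sq: "(sqrt ((real d)\<^sup>2 - 4 * card F))\<^sup>2 = (real d)\<^sup>2 - 4 * card F" using r by simp
  have lm: "l + m = d" "l * m = card F"
    using sq by (auto simp: l_def m_def field_simps power2_eq_square)
  have "sqrt ((real d)\<^sup>2 - 4 * card F) \<le> sqrt ((real d)\<^sup>2)" by (intro real_sqrt_le_mono) simp
  then have m0: "m \<ge> 0" by (simp add: m_def)
  have l32: "l \<ge> 3 / 2"
  proof (cases "d \<ge> 3")
    case True
    have "sqrt ((real d)\<^sup>2 - 4 * card F) \<ge> 0" using r by simp
    moreover have "real d \<ge> 3" using True by simp
    moreover have "3 / 2 \<le> (a + b) / 2" if "0 \<le> b" "3 \<le> a" for a b :: real using that by simp
    ultimately show ?thesis unfolding l_def by blast
  next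
    case False
    then show ?thesis using d by (simp add: l_def)
  qed
  have "\<beta> (Suc n) \<ge> (3 / 2) ^ n"
  proof (rule linear_recursion_growth[OF _ _ _ _ l32 m0])
    show "\<beta> 0 = 0"
    proof -
      have "add_coset UNIV u = UNIV" for u :: nc_series by (auto simp: add_coset_def)
      then show ?thesis by (simp add: \<beta>_def rel_ideal_0 add_index_def)
    qed
    show "\<beta> n \<ge> 0" for n using idx[of n] p by (simp add: \<beta>_def Suc_le_eq)
    show "\<beta> 1 \<ge> 1" using rel_index_1[OF p0 fF F2] p by (simp add: \<beta>_def le_log_iff)
    fix n
    have "real (p * add_index UNIV (rel_ideal d p F (n + 1)) ^ d) \<le>
       real (add_index UNIV (rel_ideal d p F (n + 2)) * add_index UNIV (rel_ideal d p F n) ^ card F)"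
      using golod_shafarevich[OF p0 fF F2, of n] by (rule of_nat_mono)
    then have "log p (p * real (add_index UNIV (rel_ideal d p F (n + 1))) ^ d) \<le>
       log p (real (add_index UNIV (rel_ideal d p F (n + 2))) * real (add_index UNIV (rel_ideal d p F n)) ^ card F)"
      using p idx[of "n + 1"] idx[of "n + 2"] idx[of n] by (subst log_le_cancel_iff) auto
    also have "log p (p * real (add_index UNIV (rel_ideal d p F (n + 1))) ^ d) = 1 + d * \<beta> (n + 1)"
      using p idx[of "n + 1"] by (subst log_mult_pos) (auto simp: \<beta>_def log_nat_power)
    also have "log p (real (add_index UNIV (rel_ideal d p F (n + 2))) * real (add_index UNIV (rel_ideal d p F n)) ^ card F) =
      \<beta> (n + 2) + card F * \<beta> n"
      using p idx[of "n + 2"] idx[of n] by (subst log_mult_pos) (auto simp: \<beta>_def log_nat_power)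
    finally show "\<beta> (n + 2) \<ge> 1 + (l + m) * \<beta> (n + 1) - l * m * \<beta> n" unfolding lm by simp
  qed
  then show ?thesis by (simp add: \<beta>_def)
qed

section \<open>Growth estimates\<close>

text \<open>Along the indices \<open>2 ^ j * i0\<close> the logarithm of \<open>e\<close> grows at
  most like \<open>q ^ j\<close>, which is negligible against \<open>2 ^ j\<close>; monotonicity
  fills the gaps.\<close>

lemma doubling_subexponential:
  fixes e :: "nat \<Rightarrow> nat" and C q :: real
  assumes mono: "\<And>i j. 1 \<le> i \<Longrightarrow> i \<le> j \<Longrightarrow> e i \<le> e j"
    and i0: "i0 \<ge> 1" and e1: "e i0 \<ge> 1"
    and rec: "\<And>i. i \<ge> i0 \<Longrightarrow> e (2 * i) \<le> C * e i powr q" and C: "C \<ge> 1" and q: "3 / 2 \<le> q" "q < 2"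
  shows "\<exists>K. \<forall>n\<ge>1. e n \<le> K * (5 / 4) ^ n"
proof -
  define L where "L i = ln (real (e i))" for i
  define c where "c = ln C"
  \<comment> \<open>The shift by \<open>2 * c\<close> absorbs the additive constant of each step,
    because \<open>3 * c \<le> q * (2 * c)\<close> for \<open>q \<ge> 3/2\<close>.\<close>
  define A where "A = L i0 + 2 * c"
  define \<delta> where "\<delta> = ln (5 / 4 :: real)"
  have c0: "c \<ge> 0" using C by (simp add: c_def)
  have ei: "e i \<ge> 1" if "i \<ge> i0" for i using mono[OF i0 that] e1 by simp
  have Lmono: "L i \<le> L j" if "i0 \<le> i" "i \<le> j" for i j
    using mono[of i j] ei[of i] that i0 by (simp add: L_def)
  have L0: "L i0 \<ge> 0" using e1 by (simp add: L_def)
  have A0: "A \<ge> 0" using c0 L0 by (simp add: A_def)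
  have Lrec: "L (2 * i) \<le> q * L i + c" if i: "i \<ge> i0" for i
  proof -
    have "L (2 * i) \<le> ln (C * e i powr q)"
      unfolding L_def using rec[OF i] ei[of i] ei[of "2 * i"] i C by (subst ln_le_cancel_iff) auto
    also have "\<dots> = q * L i + c"
      using ei[OF i] C by (subst ln_mult_pos) (auto simp: L_def c_def ln_powr)
    finally show ?thesis .
  qed
  have Lj: "L (2 ^ j * i0) + 2 * c \<le> A * q ^ j" for j
  proof (induction j)
    case 0 then show ?case by (simp add: A_def)
  next
    case (Suc j)
    have "L (2 ^ Suc j * i0) \<le> q * L (2 ^ j * i0) + c" using Lrec[of "2 ^ j * i0"] by (simp add: mult.assoc)
    moreover have "3 * c \<le> q * (2 * c)" using q c0 mult_right_mono[of "3 / 2" q "2 * c"] by simp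
    ultimately have "L (2 ^ Suc j * i0) + 2 * c \<le> q * (L (2 ^ j * i0) + 2 * c)" by (simp add: distrib_left)
    also have "\<dots> \<le> q * (A * q ^ j)" using Suc q by (intro mult_left_mono) auto
    finally show ?case by (simp add: mult_ac)
  qed
  have \<delta>0: "\<delta> > 0" by (simp add: \<delta>_def)
  have "(\<lambda>j. A * q * (q / 2) ^ j) \<longlonglongrightarrow> A * q * 0"
    using q by (intro tendsto_intros LIMSEQ_power_zero) auto
  then have "\<forall>\<^sub>F j in sequentially. A * q * (q / 2) ^ j < \<delta>" using \<delta>0 by (intro order_tendstoD) auto
  then obtain J where J: "\<And>j. j \<ge> J \<Longrightarrow> A * q * (q / 2) ^ j < \<delta>" by (auto simp: eventually_sequentially)
  \<comment> \<open>Covers the finitely many \<open>j\<close> below \<open>J\<close>, where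
    \<open>q ^ j\<close> is not yet dominated by \<open>2 ^ j\<close>.\<close>
  define M where "M = A * q ^ Suc J"
  have M0: "M \<ge> 0" using A0 q by (simp add: M_def)
  have bound: "A * q ^ Suc j \<le> \<delta> * 2 ^ j + M" for j
  proof (cases "j \<ge> J")
    case True
    have "A * q ^ Suc j = (A * q * (q / 2) ^ j) * 2 ^ j" by (simp add: power_divide)
    also have "\<dots> \<le> \<delta> * 2 ^ j" using J[OF True] by (intro mult_right_mono) auto
    finally show ?thesis using M0 by simp
  next
    case False
    then have "A * q ^ Suc j \<le> M" unfolding M_def using A0 q by (intro mult_left_mono power_increasing) auto
    moreover have "\<delta> * 2 ^ j \<ge> 0" using \<delta>0 by simp
    ultimately show ?thesis by linarith
  qed
  have main: "e n \<le> exp (M + A) * (5 / 4) ^ n" if n: "n \<ge> i0" for n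
  proof -
    have "\<exists>j. n < 2 ^ j * i0"
    proof
      have "n < 2 ^ n" by simp
      also have "2 ^ n \<le> 2 ^ n * i0" using i0 by simp
      finally show "n < 2 ^ n * i0" .
    qed
    then have ex: "n < 2 ^ (LEAST j. n < 2 ^ j * i0) * i0" by (rule LeastI_ex)
    define l where "l = (LEAST j. n < 2 ^ j * i0)"
    have "l \<noteq> 0" using ex n unfolding l_def[symmetric] by (intro notI) simp
    then obtain j where j: "l = Suc j" by (cases l) auto
    have "\<not> n < 2 ^ j * i0" using not_less_Least[of j "\<lambda>j. n < 2 ^ j * i0"] j unfolding l_def by simp
    then have "2 ^ j * 1 \<le> n" using i0 by (meson le_trans linorder_not_less mult_le_mono2)
    then have jn: "(2::real) ^ j \<le> n" by (metis mult_1_right of_nat_le_iff of_nat_numeral of_nat_power)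
    have "L n \<le> L (2 ^ Suc j * i0)" using ex j n unfolding l_def[symmetric] by (intro Lmono) auto
    also have "\<dots> \<le> A * q ^ Suc j" using Lj[of "Suc j"] c0 by linarith
    also have "\<dots> \<le> \<delta> * 2 ^ j + M" by (rule bound)
    also have "\<dots> \<le> \<delta> * n + M" using jn \<delta>0 by simp
    finally have "L n \<le> \<delta> * n + M" .
    then have "exp (L n) \<le> exp (\<delta> * n + (M + A))" using A0 by simp
    also have "exp (L n) = e n" using ei[OF n] by (simp add: L_def)
    also have "exp (\<delta> * n + (M + A)) = exp (M + A) * (5 / 4) ^ n"
      by (simp add: exp_add \<delta>_def mult.commute[of "ln (5/4)"] exp_of_nat_mult)
    finally show ?thesis .
  qed
  have "e n \<le> max (exp (M + A)) (e i0) * (5 / 4) ^ n" if "n \<ge> 1" for n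
  proof (cases "n \<ge> i0")
    case True
    have "exp (M + A) * (5 / 4) ^ n \<le> max (exp (M + A)) (e i0) * (5 / 4) ^ n" by (intro mult_right_mono) auto
    then show ?thesis using main[OF True] by linarith
  next
    case False
    then have "real (e n) \<le> e i0" using mono[of n i0] that by simp
    also have "\<dots> \<le> e i0 * (5 / 4) ^ n" by (simp add: mult_le_cancel_left1)
    also have "\<dots> \<le> max (exp (M + A)) (e i0) * (5 / 4) ^ n" by (intro mult_right_mono) auto
    finally show ?thesis .
  qed
  then show ?thesis by blast
qed

text \<open>For \<open>y \<le> 3/4\<close> one has \<open>1 / (1 - y) \<le> exp (4 * y)\<close>, so
  the exponents are bounded by multiples of \<open>(5/4 * 3/4) ^ w = (15/16) ^ w\<close>. The
  constant is \<open>80 = 5 * 16\<close>: the factor \<open>4\<close> times the \<open>5/4\<close>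
  of \<open>Suc w\<close>, and the sum \<open>16\<close> of the geometric series.\<close>

lemma weighted_product_bounded:
  fixes e :: "nat \<Rightarrow> nat"
  assumes mono: "\<And>i j. 1 \<le> i \<Longrightarrow> i \<le> j \<Longrightarrow> e i \<le> e j" and K: "\<And>n. n \<ge> 1 \<Longrightarrow> e n \<le> K * (5 / 4) ^ n"
  shows "(\<Prod>w\<in>{1..<n}. (1 / (1 - (3 / 4) ^ w)) ^ (e (Suc w) - e w)) \<le> exp (80 * K)"
proof -
  have K0: "K \<ge> 0" using K[of 1] by simp
  have f: "(1 / (1 - (3 / 4) ^ w)) ^ (e (Suc w) - e w) \<le> exp (5 * K * (15 / 16) ^ w)" if w: "w \<ge> 1" for w
  proof -
    define y where "y = (3 / 4 :: real) ^ w"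
    have y: "0 < y" "y \<le> 3 / 4" using power_decreasing[of 1 w "3 / 4 :: real"] w by (auto simp: y_def)
    have "1 / (1 - y) = 1 + y / (1 - y)" using y by (simp add: field_simps)
    also have "\<dots> \<le> exp (y / (1 - y))" by (rule exp_ge_add_one_self)
    also have "y / (1 - y) \<le> y / (1 / 4)" using y by (intro divide_left_mono) auto
    finally have "1 / (1 - y) \<le> exp (4 * y)" by (simp add: mult.commute)
    then have "(1 / (1 - y)) ^ (e (Suc w) - e w) \<le> exp (4 * y) ^ (e (Suc w) - e w)"
      using y by (intro power_mono) auto
    also have "\<dots> = exp (real (e (Suc w) - e w) * (4 * y))" by (simp add: exp_of_nat_mult)
    also have "real (e (Suc w) - e w) * (4 * y) \<le> (K * (5 / 4) ^ Suc w) * (4 * y)"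
      using K[of "Suc w"] y by (intro mult_right_mono) auto
    also have "\<dots> = 5 * K * (15 / 16) ^ w"
      by (simp add: y_def field_simps power_mult_distrib[symmetric])
    finally show ?thesis by (simp add: y_def)
  qed
  have 1: "(\<Prod>w\<in>{1..<n}. (1 / (1 - (3 / 4 :: real) ^ w)) ^ (e (Suc w) - e w)) \<le> (\<Prod>w\<in>{1..<n}. exp (5 * K * (15 / 16) ^ w))"
    using f by (intro prod_mono) (auto simp: power_le_one)
  have 2: "(\<Prod>w\<in>{1..<n}. exp (5 * K * (15 / 16 :: real) ^ w)) = exp (5 * K * (\<Sum>w\<in>{1..<n}. (15 / 16) ^ w))"
    by (simp add: exp_sum sum_distrib_left)
  have "(\<Sum>w\<in>{1..<n}. (15 / 16 :: real) ^ w) \<le> (\<Sum>w<n. (15 / 16) ^ w)" by (intro sum_mono2) auto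
  also have "(\<Sum>w<n. (15 / 16 :: real) ^ w) \<le> 16" by (simp add: sum_gp_strict)
  finally have "5 * K * (\<Sum>w\<in>{1..<n}. (15 / 16 :: real) ^ w) \<le> 5 * K * 16" using K0 by (intro mult_left_mono) auto
  then show ?thesis using 1 unfolding 2 by (smt (verit) exp_le_cancel_iff)
qed

text \<open>Up to the constant \<open>3/4\<close>, the left side is at least
  \<open>(3/2 * 3/4) ^ n = (9/8) ^ n\<close>, while the product stays bounded.\<close>

lemma no_growth_bound:
  fixes e :: "nat \<Rightarrow> nat"
  assumes mono: "\<And>i j. 1 \<le> i \<Longrightarrow> i \<le> j \<Longrightarrow> e i \<le> e j" and K: "\<And>n. n \<ge> 1 \<Longrightarrow> e n \<le> K * (5 / 4) ^ n"
    and N: "\<And>n. \<exists>N. (3 / 2) ^ n \<le> N \<and> N * (3 / 4) ^ Suc n \<le> (\<Prod>w\<in>{1..<Suc n}. (1 / (1 - (3 / 4 :: real) ^ w)) ^ (e (Suc w) - e w))"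
  shows False
proof -
  obtain n where n: "4 / 3 * exp (80 * K) < (9 / 8) ^ n" using real_arch_pow[of "9 / 8" "4 / 3 * exp (80 * K)"] by auto
  obtain N where N: "(3 / 2) ^ n \<le> N" "N * (3 / 4) ^ Suc n \<le> exp (80 * K)"
    using assms(3)[of n] weighted_product_bounded[OF mono K, of "Suc n"] by (meson order_trans)
  have "(9 / 8 :: real) ^ n = 4 / 3 * ((3 / 2) ^ n * (3 / 4) ^ Suc n)" by (simp add: power_mult_distrib[symmetric])
  also have "\<dots> \<le> 4 / 3 * (N * (3 / 4) ^ Suc n)" using N by (intro mult_left_mono mult_right_mono) auto
  also have "\<dots> \<le> 4 / 3 * exp (80 * K)" using N by simp
  finally show False using n by simp
qed

text \<open>Taking \<open>k = e i\<close> in the subgroup count makes the logarithm of the index \<open>2 * e i\<close> and that of the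
  number of subgroups quadratic in \<open>e\<close>, which is what the exponent \<open>2 - \<epsilon>\<close> has to beat.\<close>

lemma subgroup_count_growth:
  fixes e a :: "nat \<Rightarrow> nat" and \<epsilon> :: real
  assumes mono: "\<And>i j. 1 \<le> i \<Longrightarrow> i \<le> j \<Longrightarrow> e i \<le> e j" and p: "p > 1" and \<epsilon>: "\<epsilon> > 0"
    and count: "\<And>i k. 1 \<le> i \<Longrightarrow> k \<le> e (2 * i) - e i \<Longrightarrow> p ^ (k * (e (2 * i) - e i - k)) \<le> a (p ^ (e i + k))"
    and growth: "\<And>n. n \<ge> N0 \<Longrightarrow> real (a n) \<le> real n powr (log 2 (real n) powr (2 - \<epsilon>))"
  shows "\<exists>K. \<forall>n\<ge>1. e n \<le> K * (5 / 4) ^ n"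
proof (cases "\<exists>i0\<ge>1. e i0 \<ge> 1 \<and> p ^ (2 * e i0) \<ge> N0")
  \<comment> \<open>The growth hypothesis may never become applicable; then the indices stay below
    \<open>N0\<close>, and \<open>e\<close> is bounded.\<close>
  case False
  have "e n \<le> N0" if "n \<ge> 1" for n
  proof (cases "e n \<ge> 1")
    case True
    have "e n < 2 ^ e n" by simp
    also have "(2::nat) ^ e n \<le> p ^ e n" using p by (intro power_mono) auto
    also have "\<dots> \<le> p ^ (2 * e n)" using p by (intro power_increasing) auto
    also have "\<dots> < N0" using False that True by (meson not_less)
    finally show ?thesis by simp
  qed simp
  then have "real (e n) \<le> N0 * (5 / 4) ^ n" if "n \<ge> 1" for n
  proof -
    have "real N0 * 1 \<le> N0 * (5 / 4) ^ n" by (intro mult_left_mono) auto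
    moreover have "real (e n) \<le> N0" using \<open>\<And>n. n \<ge> 1 \<Longrightarrow> e n \<le> N0\<close> that by simp
    ultimately show ?thesis by linarith
  qed
  then show ?thesis by blast
next
  case True
  then obtain i0 where i0: "i0 \<ge> 1" "e i0 \<ge> 1" "p ^ (2 * e i0) \<ge> N0" by blast
  define B where "B = log 2 p"
  \<comment> \<open>The saving \<epsilon> is cut off at \<open>1/2\<close> because
    \<open>doubling_subexponential\<close> asks for \<open>q \<ge> 3/2\<close>.\<close>
  define q where "q = 2 - min \<epsilon> (1 / 2)"
  \<comment> \<open>Collects the bound \<open>2 * e i + 2 * (2 * B * e i) powr q\<close>, using
    \<open>e i \<le> e i powr q\<close>.\<close>
  define C where "C = 2 + 2 * (2 * B) powr q"
  have B1: "B \<ge> 1" using p by (simp add: B_def le_log_iff)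
  have "e (2 * i) \<le> C * e i powr q" if i: "i \<ge> i0" for i
  proof -
    have ei: "e i \<ge> 1" "e i \<ge> e i0" using mono[of i0 i] i i0 by auto
    have e1: "real (e i) \<ge> 1" using ei by simp
    have main: "real (e (2 * i)) \<le> 2 * e i + 2 * (2 * (e i * B)) powr (2 - \<epsilon>)"
    \<comment> \<open>The choice \<open>k = e i\<close> is possible only if the layer has dimension
      at least \<open>e i\<close>; otherwise \<open>e (2 * i)\<close> is already below
      \<open>2 * e i\<close>.\<close>
    proof (cases "e i \<le> e (2 * i) - e i")
      case False
      then have "real (e (2 * i)) \<le> 2 * e i" by simp
      moreover have "0 \<le> 2 * (2 * (e i * B)) powr (2 - \<epsilon>)" by simp
      ultimately show ?thesis by linarith
    next
      case True
      define n where "n = p ^ (2 * e i)"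
      define m where "m = e (2 * i) - e i - e i"
      have m: "real m = e (2 * i) - 2 * e i" using True by (simp add: m_def)
      have "p ^ (2 * e i0) \<le> n" unfolding n_def using ei p by (intro power_increasing) auto
      then have nN: "n \<ge> N0" using i0 by simp
      have logn: "log 2 (real n) = 2 * (e i * B)" using p by (simp add: n_def B_def log_nat_power)
      have n0: "real n > 0" using p by (simp add: n_def)
      have "p ^ (e i * m) \<le> a n" using count[OF _ True] i i0 by (simp add: n_def m_def mult_2)
      then have "real (p ^ (e i * m)) \<le> real n powr (log 2 (real n) powr (2 - \<epsilon>))"
        using growth[OF nN] of_nat_mono by (meson order_trans)
      then have "log 2 (real p ^ (e i * m)) \<le> log 2 (real n powr (log 2 (real n) powr (2 - \<epsilon>)))"
        using p n0 by (subst log_le_cancel_iff) auto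
      then have "real (e i * m) * B \<le> (2 * (e i * B)) powr (2 - \<epsilon>) * (2 * (e i * B))"
        using p n0 by (simp add: log_nat_power B_def[symmetric] log_powr logn)
      then have "(e i * B) * m \<le> (e i * B) * (2 * (2 * (e i * B)) powr (2 - \<epsilon>))" by (simp add: mult_ac)
      then have "m \<le> 2 * (2 * (e i * B)) powr (2 - \<epsilon>)"
        using B1 e1 by (subst (asm) mult_le_cancel_left_pos) auto
      then show ?thesis using m by simp
    qed
    have base1: "2 * (e i * B) \<ge> 1" using mult_mono[of 1 "real (e i)" 1 B] e1 B1 by simp
    have "(2 * (e i * B)) powr (2 - \<epsilon>) \<le> (2 * (e i * B)) powr q"
      using base1 by (intro powr_mono) (auto simp: q_def)
    also have "\<dots> = (2 * B) powr q * e i powr q" using B1 by (simp add: powr_mult[symmetric] mult_ac)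
    finally have 1: "(2 * (e i * B)) powr (2 - \<epsilon>) \<le> (2 * B) powr q * e i powr q" .
    have "real (e i) powr 1 \<le> e i powr q" using e1 by (intro powr_mono) (auto simp: q_def)
    then have "real (e i) \<le> e i powr q" using e1 by simp
    then have "real (e (2 * i)) \<le> 2 * e i powr q + 2 * ((2 * B) powr q * e i powr q)" using main 1 by linarith
    then show ?thesis by (simp add: C_def algebra_simps)
  qed
  moreover have "C \<ge> 1" by (simp add: C_def add_increasing2)
  moreover have "3 / 2 \<le> q" "q < 2" using \<epsilon> by (auto simp: q_def)
  ultimately show ?thesis
    using doubling_subexponential[of e i0 C q] mono i0 by blast
qed

section \<open>Free groups\<close>

lemma free_words_simps [simp]:
  "[] \<in> free_words S" "x # u \<in> free_words S \<longleftrightarrow> fst x \<in> S \<and> u \<in> free_words S"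
  "u @ v \<in> free_words S \<longleftrightarrow> u \<in> free_words S \<and> v \<in> free_words S"
  by (cases x; auto simp: free_words_def)+

lemma free_equiv_words: "free_equiv S u v \<Longrightarrow> u \<in> free_words S \<and> v \<in> free_words S"
  by (induction rule: free_equiv.induct) auto

lemma free_equiv_append:
  assumes "free_equiv S u u'" and "w \<in> free_words S" and "w' \<in> free_words S"
  shows "free_equiv S (w @ u @ w') (w @ u' @ w')"
  using assms(1)
proof (induction rule: free_equiv.induct)
  case (refl u)
  then show ?case using assms by (intro free_equiv.refl) auto
next
  case (cancel u v x b)
  then have "free_equiv S ((w @ u) @ (x, b) # (x, \<not> b) # (v @ w')) ((w @ u) @ (v @ w'))"
    using assms by (intro free_equiv.cancel) auto
  then show ?case by simp
qed (blast intro: free_equiv.intros)+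

lemma free_equiv_append2:
  assumes "free_equiv S u u'" and "free_equiv S v v'"
  shows "free_equiv S (u @ v) (u' @ v')"
  using free_equiv_append[OF assms(1), of "[]" v] free_equiv_append[OF assms(2), of u' "[]"]
    free_equiv_words[OF assms(1)] free_equiv_words[OF assms(2)] by (auto intro: free_equiv.trans)

lemma free_rel_equiv: "equiv (free_words S) (free_rel S)"
  by (rule equivI) (auto simp: refl_on_def sym_def trans_def free_rel_def
      dest: free_equiv_words intro: free_equiv.intros)

definition word_class :: "'x set \<Rightarrow> ('x \<times> bool) list \<Rightarrow> ('x \<times> bool) list set" where
  "word_class S u = free_rel S `` {u}"

lemma word_class_eq_iff:
  "u \<in> free_words S \<Longrightarrow> v \<in> free_words S \<Longrightarrow> word_class S u = word_class S v \<longleftrightarrow> free_equiv S u v"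
  unfolding word_class_def using eq_equiv_class_iff[OF free_rel_equiv, of u S v] by (simp add: free_rel_def)

lemma in_word_class: "v \<in> word_class S u \<longleftrightarrow> free_equiv S u v"
  by (simp add: word_class_def free_rel_def)

lemma word_class_self: "u \<in> free_words S \<Longrightarrow> u \<in> word_class S u"
  by (simp add: in_word_class free_equiv.refl)

lemma free_group_carrier: "carrier (free_group S) = word_class S ` free_words S"
  by (auto simp: free_group_def quotient_def word_class_def)

lemma free_group_one: "\<one>\<^bsub>free_group S\<^esub> = word_class S []"
  by (simp add: free_group_def word_class_def)

lemma free_group_mult:
  assumes u: "u \<in> free_words S" and v: "v \<in> free_words S"
  shows "word_class S u \<otimes>\<^bsub>free_group S\<^esub> word_class S v = word_class S (u @ v)"
proof -
  have "word_class S (u' @ v') = word_class S (u @ v)" if "u' \<in> word_class S u" "v' \<in> word_class S v" for u' v'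
  proof -
    have e: "free_equiv S (u @ v) (u' @ v')" using that free_equiv_append2 by (simp add: in_word_class)
    then show ?thesis using word_class_eq_iff free_equiv_words[OF e] by blast
  qed
  then have "(\<Union>u'\<in>word_class S u. \<Union>v'\<in>word_class S v. word_class S (u' @ v')) = word_class S (u @ v)"
    using word_class_self[OF u] word_class_self[OF v] by blast
  then show ?thesis by (simp add: free_group_def word_class_def)
qed

definition inverse_word :: "('x \<times> bool) list \<Rightarrow> ('x \<times> bool) list" where
  "inverse_word u = rev (map (\<lambda>(x, b). (x, \<not> b)) u)"

lemma inverse_word_in: "u \<in> free_words S \<Longrightarrow> inverse_word u \<in> free_words S"
  by (induction u) (auto simp: inverse_word_def)

lemma inverse_word_cancel: "u \<in> free_words S \<Longrightarrow> free_equiv S (inverse_word u @ u) []"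
proof (induction u)
  case Nil then show ?case by (simp add: inverse_word_def free_equiv.refl)
next
  case (Cons xb u)
  obtain x b where xb: "xb = (x, b)" by (cases xb)
  have x: "x \<in> S" and u: "u \<in> free_words S" using Cons xb by auto
  have "free_equiv S (inverse_word u @ (x, \<not> b) # (x, \<not> \<not> b) # u) (inverse_word u @ u)"
    by (rule free_equiv.cancel[OF inverse_word_in[OF u] u x])
  then have "free_equiv S (inverse_word u @ (x, \<not> b) # (x, b) # u) []" using Cons.IH[OF u] free_equiv.trans by simp blast
  then show ?case by (simp add: xb inverse_word_def)
qed

lemma free_group_group: "group (free_group S)"
proof (rule groupI)
  fix a assume "a \<in> carrier (free_group S)"
  then obtain u where u: "u \<in> free_words S" "a = word_class S u" by (auto simp: free_group_carrier)
  show "\<one>\<^bsub>free_group S\<^esub> \<otimes>\<^bsub>free_group S\<^esub> a = a" using u by (simp add: free_group_one free_group_mult)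
  have "word_class S (inverse_word u) \<otimes>\<^bsub>free_group S\<^esub> a = \<one>\<^bsub>free_group S\<^esub>"
    using u inverse_word_in[OF u(1)] inverse_word_cancel[OF u(1)]
    by (simp add: free_group_one free_group_mult word_class_eq_iff)
  then show "\<exists>b\<in>carrier (free_group S). b \<otimes>\<^bsub>free_group S\<^esub> a = \<one>\<^bsub>free_group S\<^esub>"
    using inverse_word_in[OF u(1)] by (auto simp: free_group_carrier)
next
  fix a b assume "a \<in> carrier (free_group S)" "b \<in> carrier (free_group S)"
  then show "a \<otimes>\<^bsub>free_group S\<^esub> b \<in> carrier (free_group S)"
    by (auto simp: free_group_carrier free_group_mult)
next
  fix a b c assume "a \<in> carrier (free_group S)" "b \<in> carrier (free_group S)" "c \<in> carrier (free_group S)"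
  then show "a \<otimes>\<^bsub>free_group S\<^esub> b \<otimes>\<^bsub>free_group S\<^esub> c = a \<otimes>\<^bsub>free_group S\<^esub> (b \<otimes>\<^bsub>free_group S\<^esub> c)"
    by (auto simp: free_group_carrier free_group_mult)
qed (simp add: free_group_carrier free_group_one)

section \<open>The universal property of the free group\<close>

fun word_eval :: "('h, 'b) monoid_scheme \<Rightarrow> ('x \<Rightarrow> 'h) \<Rightarrow> ('x \<times> bool) list \<Rightarrow> 'h" where
  "word_eval H y [] = \<one>\<^bsub>H\<^esub>"
| "word_eval H y ((x, b) # u) = (if b then y x else inv\<^bsub>H\<^esub> y x) \<otimes>\<^bsub>H\<^esub> word_eval H y u"

lemma word_eval_closed:
  assumes "group H" and "y ` S \<subseteq> carrier H"
  shows "u \<in> free_words S \<Longrightarrow> word_eval H y u \<in> carrier H"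
proof (induction u)
  case Nil then show ?case using assms by (simp add: group.is_monoid)
next
  case (Cons xb u)
  interpret group H by fact
  show ?case using Cons assms(2) by (cases xb) auto
qed

lemma word_eval_append:
  assumes "group H" and "y ` S \<subseteq> carrier H" and v: "v \<in> free_words S"
  shows "u \<in> free_words S \<Longrightarrow> word_eval H y (u @ v) = word_eval H y u \<otimes>\<^bsub>H\<^esub> word_eval H y v"
proof (induction u)
  case Nil
  interpret group H by fact
  show ?case using word_eval_closed[OF assms] by simp
next
  case (Cons xb u)
  interpret group H by fact
  have "word_eval H y u \<in> carrier H" "word_eval H y v \<in> carrier H"
    using Cons v by (auto intro: word_eval_closed[OF assms(1,2)])
  then show ?case using Cons assms(2) by (cases xb) (auto simp: m_assoc image_subset_iff)
qed

lemma word_eval_free_equiv: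
  assumes "group H" and y: "y ` S \<subseteq> carrier H"
  shows "free_equiv S u v \<Longrightarrow> word_eval H y u = word_eval H y v"
proof (induction rule: free_equiv.induct)
  case (cancel u v x b)
  interpret group H by fact
  have c: "y x \<in> carrier H" "word_eval H y v \<in> carrier H"
    using cancel y word_eval_closed[OF assms] by auto
  have "word_eval H y ((x, b) # (x, \<not> b) # v) = word_eval H y v"
    using c by (cases b) (auto simp: m_assoc[symmetric])
  then show ?case using cancel by (simp add: word_eval_append[OF assms])
qed auto

text \<open>Evaluates a chosen word of the class; \<open>word_eval_free_equiv\<close> makes the
  choice irrelevant.\<close>

definition free_lift :: "('h, 'b) monoid_scheme \<Rightarrow> ('x \<Rightarrow> 'h) \<Rightarrow> ('x \<times> bool) list set \<Rightarrow> 'h" where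
  "free_lift H y C = word_eval H y (SOME u. u \<in> C)"

lemma class_choice:
  assumes "u \<in> free_words S"
  shows "free_equiv S u (SOME v. v \<in> word_class S u)"
  using someI[of "\<lambda>v. v \<in> word_class S u", OF word_class_self[OF assms]] by (simp add: in_word_class)

lemma free_lift_class:
  assumes "group H" and "y ` S \<subseteq> carrier H" and "u \<in> free_words S"
  shows "free_lift H y (word_class S u) = word_eval H y u"
  unfolding free_lift_def using word_eval_free_equiv[OF assms(1,2) class_choice[OF assms(3)]] by simp

lemma free_lift_hom:
  assumes "group H" and "y ` S \<subseteq> carrier H"
  shows "free_lift H y \<in> hom (free_group S) H"
  by (rule homI) (auto simp: free_group_carrier free_group_mult free_lift_class[OF assms]
      word_eval_closed[OF assms] word_eval_append[OF assms])

lemma free_group_hom_eval: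
  assumes H: "group H" and h: "h \<in> hom (free_group S) H" and u: "u \<in> free_words S"
  shows "h (word_class S u) = word_eval H (\<lambda>x. h (word_class S [(x, True)])) u"
  using u
proof (induction u)
  case Nil
  interpret group_hom "free_group S" H h
    using H h by (simp add: group_hom_def group_hom_axioms_def free_group_group)
  show ?case using hom_one by (simp add: free_group_one)
next
  case (Cons xb u)
  interpret group_hom "free_group S" H h
    using H h by (simp add: group_hom_def group_hom_axioms_def free_group_group)
  obtain x b where xb: "xb = (x, b)" by (cases xb)
  have x: "x \<in> S" and u: "u \<in> free_words S" using Cons xb by auto
  have c: "word_class S [(x, c)] \<in> carrier (free_group S)" for c using x by (auto simp: free_group_carrier)
  have inv: "inv\<^bsub>free_group S\<^esub> word_class S [(x, True)] = word_class S [(x, False)]"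
  proof (rule G.inv_equality[OF _ c c])
    have "free_equiv S ([] @ (x, False) # (x, \<not> False) # []) ([] @ [])"
      by (rule free_equiv.cancel) (use x in auto)
    then show "word_class S [(x, False)] \<otimes>\<^bsub>free_group S\<^esub> word_class S [(x, True)] = \<one>\<^bsub>free_group S\<^esub>"
      using x by (simp add: free_group_mult free_group_one word_class_eq_iff)
  qed
  have "word_class S (xb # u) = word_class S [(x, b)] \<otimes>\<^bsub>free_group S\<^esub> word_class S u"
    using x u xb by (simp add: free_group_mult)
  then have "h (word_class S (xb # u)) = h (word_class S [(x, b)]) \<otimes>\<^bsub>H\<^esub> h (word_class S u)"
    using c u by (auto simp: free_group_carrier)
  also have "h (word_class S [(x, b)]) = (if b then h (word_class S [(x, True)]) else inv\<^bsub>H\<^esub> h (word_class S [(x, True)]))"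
    using inv hom_inv[OF c[of True]] by (cases b) auto
  finally show ?case using Cons.IH[OF u] xb by simp
qed

lemma free_group_hom_eqI:
  assumes H: "group H" and "h \<in> hom (free_group S) H" and "h' \<in> hom (free_group S) H"
    and eq: "\<And>x. x \<in> S \<Longrightarrow> h (word_class S [(x, True)]) = h' (word_class S [(x, True)])"
    and c: "c \<in> carrier (free_group S)"
  shows "h c = h' c"
proof -
  obtain u where u: "u \<in> free_words S" "c = word_class S u" using c by (auto simp: free_group_carrier)
  have "word_eval H (\<lambda>x. h (word_class S [(x, True)])) u = word_eval H (\<lambda>x. h' (word_class S [(x, True)])) u"
    using u(1) by (induction u) (auto simp: eq)
  then show ?thesis
    unfolding u(2) free_group_hom_eval[OF H assms(2) u(1)] free_group_hom_eval[OF H assms(3) u(1)] .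
qed

definition magnus_class :: "(nat \<times> bool) list set \<Rightarrow> nc_series" where
  "magnus_class C = magnus (SOME u. u \<in> C)"

lemma magnus_class_word: "u \<in> free_words S \<Longrightarrow> magnus_class (word_class S u) = magnus u"
  unfolding magnus_class_def using magnus_free_equiv[OF class_choice] by metis

text \<open>The congruence subgroups of this instance have \<open>p\<close>-power index. They are
  the coordinates of the completion on which all later approximation by words takes place.\<close>

lemma magnus_filtered:
  assumes p: "Factorial_Ring.prime p"
  shows "filtered_group (free_group {..<d}) p (trunc_ideal d p) magnus_class"
proof -
  have p0: "p > 0" using p prime_gt_0_nat by blast
  interpret group "free_group {..<d}" by (rule free_group_group)
  show ?thesis
  proof unfold_locales
    show "of_nat p \<in> trunc_ideal d p n" for n using trunc_ideal_p[of p 1 d n] by simp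
    show "trunc_ideal d p (Suc n) \<subseteq> trunc_ideal d p n" for n by (rule trunc_ideal_mono) simp
    fix g h n assume "g \<in> carrier (free_group {..<d})" "h \<in> carrier (free_group {..<d})"
    then obtain u v where "u \<in> free_words {..<d}" "v \<in> free_words {..<d}" "g = word_class {..<d} u" "h = word_class {..<d} v"
      by (auto simp: free_group_carrier)
    then show "magnus_class (g \<otimes>\<^bsub>free_group {..<d}\<^esub> h) - magnus_class g * magnus_class h \<in> trunc_ideal d p n"
      by (simp add: free_group_mult magnus_class_word add_zero[OF trunc_ideal_additive])
  next
    fix g assume "g \<in> carrier (free_group {..<d})"
    then show "magnus_class g - 1 \<in> trunc_ideal d p 1"
      by (auto simp: free_group_carrier magnus_class_word trunc_ideal_def)
  next
    fix n show "magnus_class \<one>\<^bsub>free_group {..<d}\<^esub> - 1 \<in> trunc_ideal d p n"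
      by (simp add: free_group_one magnus_class_word add_zero[OF trunc_ideal_additive])
  qed (use p trunc_ideal_0 trunc_ideal_additive trunc_ideal_left trunc_ideal_right trunc_ideal_mult
      trunc_ideal_finite[OF p0] in auto)
qed

section \<open>Pro-\<open>p\<close> completions\<close>

locale completed_group = group G for G :: "('a, 'b) monoid_scheme" (structure) +
  fixes p :: nat
  assumes prime_p: "Factorial_Ring.prime p"
begin

abbreviation "\<N> \<equiv> p_power_normal_subgroups p G"
abbreviation "Ghat \<equiv> pro_p_completion p G"
abbreviation "That \<equiv> pro_p_completion_topology p G"

lemma p_gt_1: "p > 1"
  using prime_p prime_gt_1_nat by blast

lemma N_normal: "N \<in> \<N> \<Longrightarrow> N \<lhd> G"
  by (simp add: p_power_normal_subgroups_def)

lemma N_subgroup: "N \<in> \<N> \<Longrightarrow> subgroup N G"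
  using N_normal normal_imp_subgroup by blast

lemma N_carrier: "N \<in> \<N> \<Longrightarrow> N \<subseteq> carrier G"
  using N_subgroup subgroup.subset by blast

lemma N_finite: "N \<in> \<N> \<Longrightarrow> finite (rcosets N)"
  using p_gt_1 by (intro card_ge_0_finite) (auto simp: p_power_normal_subgroups_def)

lemma carrier_in_N: "carrier G \<in> \<N>"
proof -
  have "carrier G \<lhd> G" unfolding normal_inv_iff using subgroup_self by auto
  then show ?thesis
    unfolding p_power_normal_subgroups_def by (intro CollectI conjI exI[of _ 0]) (simp_all add: rcosets_whole)
qed

text \<open>The index of \<open>N \<inter> M\<close> in \<open>N\<close> is the order of the image
  of \<open>N\<close> in \<open>G Mod M\<close>, hence divides a power of \<open>p\<close>.\<close>

lemma N_inter:
  assumes N: "N \<in> \<N>" and M: "M \<in> \<N>"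
  shows "N \<inter> M \<in> \<N>"
proof -
  interpret M: normal M G using N_normal[OF M] .
  interpret Q: group "G Mod M" by (rule M.factorgroup_is_group)
  have sub: "subgroup (N \<inter> M) G" using N_subgroup N M by (simp add: subgroups_Inter_pair)
  have nor: "N \<inter> M \<lhd> G" using normal_subgroup_intersect[OF N_normal[OF N] N_normal[OF M]] .
  have "group_hom G (G Mod M) (\<lambda>h. M #> h)"
    using M.r_coset_hom_Mod by (simp add: group_hom_def group_hom_axioms_def is_group Q.is_group)
  then have s: "subgroup ((\<lambda>h. M #> h) ` N) (G Mod M)"
    using group_hom.subgroup_img_is_subgroup N_subgroup[OF N] by blast
  obtain k where k: "card (rcosets M) = p ^ k" using M by (auto simp: p_power_normal_subgroups_def)
  have fs: "finite ((\<lambda>h. M #> h) ` N)"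
    using N_finite[OF M] subgroup.subset[OF s] by (auto simp: FactGroup_def intro: finite_subset)
  have "card ((\<lambda>h. M #> h) ` N) dvd p ^ k"
    using Q.lagrange[OF s] k by (metis FactGroup_def dvd_triv_right order_def partial_object.select_convs(1))
  then obtain l where l: "card ((\<lambda>h. M #> h) ` N) = p ^ l" using prime_p divides_primepow_nat by blast
  have eq: "(N \<inter> M) #> g = (N \<inter> M) #> h \<longleftrightarrow> M #> g = M #> h" if "g \<in> N" "h \<in> N" for g h
  proof -
    have c: "g \<in> carrier G" "h \<in> carrier G" using that N_carrier[OF N] by auto
    have "g \<otimes> inv h \<in> N" using that N_subgroup[OF N] by (simp add: subgroup.m_closed subgroup.m_inv_closed)
    then show ?thesis using rcos_eq_iff[OF sub c] rcos_eq_iff[OF N_subgroup[OF M] c] by simp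
  qed
  have c: "card ((\<lambda>h. (N \<inter> M) #> h) ` N) = p ^ l"
    using l card_image_factor[of N "\<lambda>h. (N \<inter> M) #> h" "\<lambda>h. M #> h"] eq by simp
  have f: "finite ((\<lambda>h. (N \<inter> M) #> h) ` N)"
    using fs by (rule finite_image_factor) (use eq in auto)
  obtain m where "card (rcosets N) = p ^ m" using N by (auto simp: p_power_normal_subgroups_def)
  then have "card (rcosets (N \<inter> M)) = p ^ (m + l)"
    using index_tower(2)[OF N_subgroup[OF N] sub _ N_finite[OF N] f] c by (simp add: power_add)
  then show ?thesis using nor unfolding p_power_normal_subgroups_def by blast
qed

lemma hat_carrier: "carrier Ghat = pro_p_completion_carrier p G"
  by (simp add: pro_p_completion_def)

lemma hat_coset: "\<phi> \<in> carrier Ghat \<Longrightarrow> N \<in> \<N> \<Longrightarrow> \<exists>g\<in>carrier G. \<phi> N = N #> g"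
proof -
  assume "\<phi> \<in> carrier Ghat" and N: "N \<in> \<N>"
  then have "\<phi> \<in> (\<Pi>\<^sub>E N\<in>\<N>. carrier (G Mod N))" unfolding hat_carrier pro_p_completion_carrier_def by blast
  then have "\<phi> N \<in> carrier (G Mod N)" using N by (rule PiE_mem)
  then show "\<exists>g\<in>carrier G. \<phi> N = N #> g" unfolding carrier_FactGroup by blast
qed

lemma hat_mono: "\<phi> \<in> carrier Ghat \<Longrightarrow> M \<in> \<N> \<Longrightarrow> N \<in> \<N> \<Longrightarrow> M \<subseteq> N \<Longrightarrow> \<phi> M \<subseteq> \<phi> N"
  by (auto simp: hat_carrier pro_p_completion_carrier_def)

lemma hat_mem:
  assumes "\<phi> \<in> carrier Ghat" and N: "N \<in> \<N>" and "g \<in> \<phi> N"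
  shows "g \<in> carrier G" and "\<phi> N = N #> g"
proof -
  obtain h where h: "h \<in> carrier G" "\<phi> N = N #> h" using hat_coset assms by blast
  then show "g \<in> carrier G" using assms N_carrier[OF N] r_coset_subset_G by blast
  show "\<phi> N = N #> g" using h assms repr_independence[OF _ h(1) N_subgroup[OF N]] by simp
qed

lemma hat_nonempty:
  assumes "\<phi> \<in> carrier Ghat" and N: "N \<in> \<N>"
  shows "\<exists>g\<in>carrier G. g \<in> \<phi> N"
  using hat_coset[OF assms] rcos_self[OF _ N_subgroup[OF N]] by blast

lemma hat_agree:
  assumes "\<phi> \<in> carrier Ghat" "\<psi> \<in> carrier Ghat" "M \<in> \<N>" "N \<in> \<N>" "M \<subseteq> N" "\<phi> M = \<psi> M"
  shows "\<phi> N = \<psi> N"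
proof -
  obtain g where g: "g \<in> \<phi> M" using hat_nonempty assms by blast
  then have "g \<in> \<phi> N" "g \<in> \<psi> N" using hat_mono assms by blast+
  then show ?thesis using hat_mem(2) assms by blast
qed

lemma hat_eqI:
  assumes "\<phi> \<in> carrier Ghat" "\<psi> \<in> carrier Ghat" "\<And>N. N \<in> \<N> \<Longrightarrow> \<phi> N = \<psi> N"
  shows "\<phi> = \<psi>"
  using assms by (auto simp: hat_carrier pro_p_completion_carrier_def intro: PiE_ext)

lemma hat_mult: "N \<in> \<N> \<Longrightarrow> (\<phi> \<otimes>\<^bsub>Ghat\<^esub> \<psi>) N = \<phi> N <#> \<psi> N"
  by (simp add: pro_p_completion_def product_group_def)

lemma hat_one: "N \<in> \<N> \<Longrightarrow> \<one>\<^bsub>Ghat\<^esub> N = N"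
  by (simp add: pro_p_completion_def product_group_def)

lemma hat_group: "group Ghat"
proof -
  let ?P = "product_group \<N> (\<lambda>N. G Mod N)"
  have gr: "group (G Mod N)" if "N \<in> \<N>" for N using N_normal[OF that] by (rule normal.factorgroup_is_group)
  then have P: "group ?P" by simp
  have "subgroup (pro_p_completion_carrier p G) ?P"
  proof (rule group.subgroupI[OF P])
    show "pro_p_completion_carrier p G \<subseteq> carrier ?P" by (auto simp: pro_p_completion_carrier_def)
    have "restrict (\<lambda>N. N) \<N> \<in> pro_p_completion_carrier p G"
      using coset_mult_one[OF N_carrier]
      by (auto simp: pro_p_completion_carrier_def carrier_FactGroup intro!: image_eqI[of _ _ \<one>])
    then show "pro_p_completion_carrier p G \<noteq> {}" by blast
    fix a assume a: "a \<in> pro_p_completion_carrier p G"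
    then have aP: "a \<in> carrier ?P" by (auto simp: pro_p_completion_carrier_def)
    have inv: "(inv\<^bsub>?P\<^esub> a) N = set_inv (a N)" if "N \<in> \<N>" for N
      using that aP gr normal.inv_FactGroup[OF N_normal[OF that], of "a N"] by (auto simp: PiE_iff)
    have memI: "x \<in> pro_p_completion_carrier p G"
      if "x \<in> carrier ?P" "\<And>M N. M \<in> \<N> \<Longrightarrow> N \<in> \<N> \<Longrightarrow> M \<subseteq> N \<Longrightarrow> x M \<subseteq> x N" for x
      using that unfolding pro_p_completion_carrier_def carrier_product_group by blast
    have mono: "x M \<subseteq> x N" if "x \<in> pro_p_completion_carrier p G" "M \<in> \<N>" "N \<in> \<N>" "M \<subseteq> N" for x M N
      using that unfolding pro_p_completion_carrier_def by blast
    show "inv\<^bsub>?P\<^esub> a \<in> pro_p_completion_carrier p G"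
    proof (rule memI)
      fix M N assume MN: "M \<in> \<N>" "N \<in> \<N>" "M \<subseteq> N"
      show "(inv\<^bsub>?P\<^esub> a) M \<subseteq> (inv\<^bsub>?P\<^esub> a) N"
        unfolding inv[OF MN(1)] inv[OF MN(2)] SET_INV_def using mono[OF a MN] by blast
    qed (rule group.inv_closed[OF P aP])
    fix b assume b: "b \<in> pro_p_completion_carrier p G"
    then have bP: "b \<in> carrier ?P" by (simp add: pro_p_completion_carrier_def)
    show "a \<otimes>\<^bsub>?P\<^esub> b \<in> pro_p_completion_carrier p G"
    proof (rule memI)
      show "a \<otimes>\<^bsub>?P\<^esub> b \<in> carrier ?P" using aP bP by (rule monoid.m_closed[OF group.is_monoid[OF P]])
      fix M N assume MN: "M \<in> \<N>" "N \<in> \<N>" "M \<subseteq> N"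
      then show "(a \<otimes>\<^bsub>?P\<^esub> b) M \<subseteq> (a \<otimes>\<^bsub>?P\<^esub> b) N"
        using mono_set_mult[OF mono[OF a MN] mono[OF b MN]] by simp
    qed
  qed
  from subgroup.subgroup_is_group[OF this P] show ?thesis by (simp add: pro_p_completion_def)
qed

lemma hat_coord_hom: "N \<in> \<N> \<Longrightarrow> (\<lambda>\<phi>. \<phi> N) \<in> hom Ghat (G Mod N)"
  by (rule homI) (auto simp: hat_mult carrier_FactGroup dest: hat_coset)

lemma hat_mult_mem:
  "N \<in> \<N> \<Longrightarrow> g \<in> \<phi> N \<Longrightarrow> h \<in> \<psi> N \<Longrightarrow> g \<otimes> h \<in> (\<phi> \<otimes>\<^bsub>Ghat\<^esub> \<psi>) N"
  by (auto simp: hat_mult set_mult_def)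

definition embed :: "'a \<Rightarrow> 'a set \<Rightarrow> 'a set" where
  "embed g = restrict (\<lambda>N. N #> g) \<N>"

lemma embed_apply: "N \<in> \<N> \<Longrightarrow> embed g N = N #> g"
  by (simp add: embed_def)

lemma embed_carrier: "g \<in> carrier G \<Longrightarrow> embed g \<in> carrier Ghat"
  by (auto simp: hat_carrier pro_p_completion_carrier_def embed_def carrier_FactGroup r_coset_def)

lemma embed_mem: "g \<in> carrier G \<Longrightarrow> N \<in> \<N> \<Longrightarrow> g \<in> embed g N"
  using rcos_self N_subgroup by (simp add: embed_apply)

lemma embed_hom: "embed \<in> hom G Ghat"
proof (rule homI)
  fix g h assume gh: "g \<in> carrier G" "h \<in> carrier G"
  interpret hat: group Ghat by (rule hat_group)
  show "embed (g \<otimes> h) = embed g \<otimes>\<^bsub>Ghat\<^esub> embed h"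
  proof (rule hat_eqI)
    fix N assume N: "N \<in> \<N>"
    then show "embed (g \<otimes> h) N = (embed g \<otimes>\<^bsub>Ghat\<^esub> embed h) N"
      using normal.rcos_sum[OF N_normal[OF N] gh] by (simp add: hat_mult embed_apply)
  qed (use gh embed_carrier in auto)
qed (rule embed_carrier)

lemma embed_dense: "\<phi> \<in> carrier Ghat \<Longrightarrow> N \<in> \<N> \<Longrightarrow> \<exists>g\<in>carrier G. embed g N = \<phi> N"
  using hat_coset by (metis embed_apply)

lemma hat_topspace: "topspace That = carrier Ghat"
  by (auto simp: pro_p_completion_topology_def hat_carrier pro_p_completion_carrier_def)

lemma N_finite_inter:
  assumes "finite I" "I \<subseteq> \<N>"
  shows "\<exists>M\<in>\<N>. \<forall>N\<in>I. M \<subseteq> N"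
  using assms
proof (induction I rule: finite_induct)
  case empty then show ?case using carrier_in_N by blast
next
  case (insert N I)
  then obtain M where "M \<in> \<N>" "\<forall>N\<in>I. M \<subseteq> N" by auto
  then show ?case using N_inter[of N M] insert by (intro bexI[of _ "N \<inter> M"]) auto
qed

text \<open>Finitely many coordinate conditions follow from a single one: the indexing family is
  closed under finite intersections, and a coordinate determines those at larger subgroups. Hence
  single coordinates give a basis of neighbourhoods.\<close>

lemma hat_openin_iff:
  "openin That U \<longleftrightarrow> U \<subseteq> carrier Ghat \<and> (\<forall>\<phi>\<in>U. \<exists>N\<in>\<N>. \<forall>\<psi>\<in>carrier Ghat. \<psi> N = \<phi> N \<longrightarrow> \<psi> \<in> U)"
proof
  assume U: "openin That U"
  then have "U \<subseteq> carrier Ghat" using openin_subset hat_topspace by blast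
  moreover have "\<exists>N\<in>\<N>. \<forall>\<psi>\<in>carrier Ghat. \<psi> N = \<phi> N \<longrightarrow> \<psi> \<in> U" if \<phi>: "\<phi> \<in> U" for \<phi>
  proof -
    obtain V where V: "openin (product_topology (\<lambda>N. discrete_topology (carrier (G Mod N))) \<N>) V"
      "U = V \<inter> carrier Ghat"
      using U unfolding pro_p_completion_topology_def openin_subtopology hat_carrier by blast
    then have "\<phi> \<in> V" using \<phi> by blast
    then obtain W where W: "finite {N \<in> \<N>. W N \<noteq> topspace (discrete_topology (carrier (G Mod N)))}"
      "\<phi> \<in> PiE \<N> W" "PiE \<N> W \<subseteq> V"
      using V(1) unfolding openin_product_topology_alt by meson
    obtain M where M: "M \<in> \<N>" "\<And>N. N \<in> \<N> \<Longrightarrow> W N \<noteq> carrier (G Mod N) \<Longrightarrow> M \<subseteq> N"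
      using N_finite_inter[OF W(1)] by auto
    have "\<psi> \<in> U" if \<psi>: "\<psi> \<in> carrier Ghat" "\<psi> M = \<phi> M" for \<psi>
    proof -
      have \<phi>c: "\<phi> \<in> carrier Ghat" using \<phi> V(2) by blast
      have "\<psi> N \<in> W N" if N: "N \<in> \<N>" for N
      proof (cases "W N = carrier (G Mod N)")
        case True
        then show ?thesis using \<psi>(1) N by (auto simp: hat_carrier pro_p_completion_carrier_def)
      next
        case False
        then have "\<psi> N = \<phi> N" using hat_agree[OF \<psi>(1) \<phi>c M(1) N M(2)[OF N]] \<psi>(2) by blast
        then show ?thesis using W(2) N by auto
      qed
      then have "\<psi> \<in> PiE \<N> W" using \<psi>(1) by (auto simp: hat_carrier pro_p_completion_carrier_def PiE_iff)
      then show ?thesis using W(3) V(2) \<psi>(1) by blast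
    qed
    then show ?thesis using M(1) by blast
  qed
  ultimately show "U \<subseteq> carrier Ghat \<and> (\<forall>\<phi>\<in>U. \<exists>N\<in>\<N>. \<forall>\<psi>\<in>carrier Ghat. \<psi> N = \<phi> N \<longrightarrow> \<psi> \<in> U)" by blast
next
  assume U: "U \<subseteq> carrier Ghat \<and> (\<forall>\<phi>\<in>U. \<exists>N\<in>\<N>. \<forall>\<psi>\<in>carrier Ghat. \<psi> N = \<phi> N \<longrightarrow> \<psi> \<in> U)"
  have cyl: "openin That {\<psi> \<in> carrier Ghat. \<psi> N = \<phi> N}" if N: "N \<in> \<N>" and \<phi>: "\<phi> \<in> carrier Ghat" for N \<phi>
  proof -
    let ?X = "\<lambda>N. discrete_topology (carrier (G Mod N))"
    define W where "W M = (if M = N then {\<phi> N} else carrier (G Mod M))" for M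
    have WN: "\<phi> N \<in> carrier (G Mod N)" using N \<phi> by (auto simp: hat_carrier pro_p_completion_carrier_def)
    have "openin (product_topology ?X \<N>) (PiE \<N> W)"
      unfolding openin_product_topology_alt
    proof (intro ballI exI[of _ W] conjI)
      have "{M \<in> \<N>. W M \<noteq> topspace (?X M)} \<subseteq> {N}" by (auto simp: W_def)
      then show "finite {M \<in> \<N>. W M \<noteq> topspace (?X M)}" using finite_subset by blast
      show "openin (?X M) (W M)" for M using WN by (auto simp: W_def)
    qed auto
    moreover have "{\<psi> \<in> carrier Ghat. \<psi> N = \<phi> N} = PiE \<N> W \<inter> pro_p_completion_carrier p G"
    proof (intro equalityI subsetI)
      fix \<psi> assume "\<psi> \<in> {\<psi> \<in> carrier Ghat. \<psi> N = \<phi> N}"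
      then have \<psi>: "\<psi> \<in> pro_p_completion_carrier p G" "\<psi> N = \<phi> N" by (auto simp: hat_carrier)
      then have P: "\<psi> \<in> (\<Pi>\<^sub>E N\<in>\<N>. carrier (G Mod N))" by (simp add: pro_p_completion_carrier_def)
      have "\<psi> \<in> PiE \<N> W"
      proof (rule PiE_I)
        show "\<psi> M \<in> W M" if "M \<in> \<N>" for M using PiE_mem[OF P that] \<psi>(2) by (simp add: W_def)
        show "\<psi> M = undefined" if "M \<notin> \<N>" for M using PiE_arb[OF P that] .
      qed
      then show "\<psi> \<in> PiE \<N> W \<inter> pro_p_completion_carrier p G" using \<psi>(1) by blast
    next
      fix \<psi> assume "\<psi> \<in> PiE \<N> W \<inter> pro_p_completion_carrier p G"
      then have \<psi>: "\<psi> \<in> PiE \<N> W" "\<psi> \<in> carrier Ghat" by (simp_all add: hat_carrier)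
      show "\<psi> \<in> {\<psi> \<in> carrier Ghat. \<psi> N = \<phi> N}"
        using PiE_mem[OF \<psi>(1) N] \<psi>(2) by (simp add: W_def)
    qed
    ultimately show ?thesis
      unfolding pro_p_completion_topology_def openin_subtopology by blast
  qed
  have "\<exists>V. openin That V \<and> \<phi> \<in> V \<and> V \<subseteq> U" if \<phi>: "\<phi> \<in> U" for \<phi>
  proof -
    obtain N where N: "N \<in> \<N>" "\<forall>\<psi>\<in>carrier Ghat. \<psi> N = \<phi> N \<longrightarrow> \<psi> \<in> U" using U \<phi> by blast
    have "\<phi> \<in> carrier Ghat" using U \<phi> by blast
    then show ?thesis using cyl[OF N(1), of \<phi>] N(2) by (intro exI[of _ "{\<psi> \<in> carrier Ghat. \<psi> N = \<phi> N}"]) auto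
  qed
  then show "openin That U" by (subst openin_subopen) blast
qed

lemma hat_locally_constant_openin:
  assumes "N \<in> \<N>" and "\<And>\<phi> \<psi>. \<phi> \<in> carrier Ghat \<Longrightarrow> \<psi> \<in> carrier Ghat \<Longrightarrow> \<phi> N = \<psi> N \<Longrightarrow> P \<phi> \<Longrightarrow> P \<psi>"
  shows "openin That {\<phi> \<in> carrier Ghat. P \<phi>}" and "closedin That {\<phi> \<in> carrier Ghat. P \<phi>}"
proof -
  show "openin That {\<phi> \<in> carrier Ghat. P \<phi>}" unfolding hat_openin_iff using assms by auto metis
  have "openin That (carrier Ghat - {\<phi> \<in> carrier Ghat. P \<phi>})" unfolding hat_openin_iff using assms by auto metis
  then show "closedin That {\<phi> \<in> carrier Ghat. P \<phi>}" unfolding closedin_def hat_topspace by auto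
qed

text \<open>The inverse limit is closed in a product of finite discrete spaces: a violation of
  compatibility is visible in two coordinates.\<close>

lemma hat_compact: "compact_space That"
proof -
  let ?X = "\<lambda>N. discrete_topology (carrier (G Mod N))"
  let ?P = "product_topology ?X \<N>"
  have "compact_space (?X N)" if "N \<in> \<N>" for N
    using N_finite[OF that] by (simp add: compact_space_discrete_topology FactGroup_def)
  then have cP: "compact_space ?P" by (simp add: compact_space_product_topology)
  have "openin ?P (topspace ?P - pro_p_completion_carrier p G)"
    unfolding openin_product_topology_alt
  proof
    fix \<phi> assume \<phi>: "\<phi> \<in> topspace ?P - pro_p_completion_carrier p G"
    then have \<phi>P: "\<phi> \<in> (\<Pi>\<^sub>E N\<in>\<N>. carrier (G Mod N))" by simp
    then obtain M N where MN: "M \<in> \<N>" "N \<in> \<N>" "M \<subseteq> N" "\<not> \<phi> M \<subseteq> \<phi> N"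
      using \<phi> unfolding pro_p_completion_carrier_def by auto
    define W where "W L = (if L = M \<or> L = N then {\<phi> L} else carrier (G Mod L))" for L
    have "{L \<in> \<N>. W L \<noteq> topspace (?X L)} \<subseteq> {M, N}" by (auto simp: W_def)
    then have f: "finite {L \<in> \<N>. W L \<noteq> topspace (?X L)}" using finite_subset by blast
    have o: "openin (?X L) (W L)" if "L \<in> \<N>" for L using \<phi>P that MN by (auto simp: W_def PiE_iff)
    have \<phi>W: "\<phi> \<in> PiE \<N> W" using \<phi>P by (auto simp: W_def PiE_iff)
    have "PiE \<N> W \<subseteq> topspace ?P - pro_p_completion_carrier p G"
    proof
      fix \<psi> assume \<psi>: "\<psi> \<in> PiE \<N> W"
      have "\<psi> M = \<phi> M" "\<psi> N = \<phi> N" using PiE_mem[OF \<psi> MN(1)] PiE_mem[OF \<psi> MN(2)] by (auto simp: W_def)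
      then have "\<psi> \<notin> pro_p_completion_carrier p G"
        using hat_mono[OF _ MN(1-3), of \<psi>] MN(4) unfolding hat_carrier by auto
      moreover have "\<psi> \<in> topspace ?P"
        using \<psi> o openin_subset by (fastforce simp: PiE_iff)
      ultimately show "\<psi> \<in> topspace ?P - pro_p_completion_carrier p G" by blast
    qed
    then show "\<exists>U. finite {i \<in> \<N>. U i \<noteq> topspace (?X i)} \<and> (\<forall>i\<in>\<N>. openin (?X i) (U i)) \<and> \<phi> \<in> PiE \<N> U \<and>
       PiE \<N> U \<subseteq> topspace ?P - pro_p_completion_carrier p G"
      using f o \<phi>W by blast
  qed
  moreover have "pro_p_completion_carrier p G \<subseteq> topspace ?P" by (auto simp: pro_p_completion_carrier_def)
  ultimately have "closedin ?P (pro_p_completion_carrier p G)" unfolding closedin_def by blast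
  then have "compactin ?P (pro_p_completion_carrier p G)" using cP closedin_compact_space by blast
  then show ?thesis unfolding pro_p_completion_topology_def by (rule compact_space_subtopology)
qed

lemma hat_openin_dense:
  assumes "openin That U" and "U \<noteq> {}"
  shows "\<exists>g\<in>carrier G. embed g \<in> U"
proof -
  obtain \<phi> where \<phi>: "\<phi> \<in> U" "\<phi> \<in> carrier Ghat" using assms hat_openin_iff by blast
  then obtain N where N: "N \<in> \<N>" "\<And>\<psi>. \<psi> \<in> carrier Ghat \<Longrightarrow> \<psi> N = \<phi> N \<Longrightarrow> \<psi> \<in> U"
    using assms(1) unfolding hat_openin_iff by blast
  then show ?thesis using embed_dense[OF \<phi>(2) N(1)] embed_carrier by metis
qed

end

lemma (in completed_group) hat_inv_cong:
  assumes N: "N \<in> \<N>" and "\<phi> \<in> carrier Ghat" "\<psi> \<in> carrier Ghat" "\<phi> N = \<psi> N"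
  shows "(inv\<^bsub>Ghat\<^esub> \<phi>) N = (inv\<^bsub>Ghat\<^esub> \<psi>) N"
proof -
  have "group_hom Ghat (G Mod N) (\<lambda>\<phi>. \<phi> N)"
    using hat_coord_hom[OF N] hat_group normal.factorgroup_is_group[OF N_normal[OF N]]
    by (simp add: group_hom_def group_hom_axioms_def)
  then show ?thesis using group_hom.hom_inv assms by fastforce
qed

section \<open>Extending and comparing maps on completions\<close>

lemma completion_continuous_locally:
  assumes A: "completed_group A p" and B: "completed_group B p"
    and c: "continuous_map (pro_p_completion_topology p A) (pro_p_completion_topology p B) \<alpha>"
    and \<phi>: "\<phi> \<in> carrier (pro_p_completion p A)" and M: "M \<in> p_power_normal_subgroups p B"
  shows "\<exists>N\<in>p_power_normal_subgroups p A. \<forall>\<psi>\<in>carrier (pro_p_completion p A). \<psi> N = \<phi> N \<longrightarrow> \<alpha> \<psi> M = \<alpha> \<phi> M"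
proof -
  interpret A: completed_group A p by fact
  interpret B: completed_group B p by fact
  have "openin B.That {\<xi> \<in> carrier B.Ghat. \<xi> M = \<alpha> \<phi> M}"
    by (rule B.hat_locally_constant_openin(1)[OF M]) simp
  then have "openin A.That {\<psi> \<in> topspace A.That. \<alpha> \<psi> \<in> {\<xi> \<in> carrier B.Ghat. \<xi> M = \<alpha> \<phi> M}}"
    using c unfolding continuous_map_def by blast
  moreover have "\<phi> \<in> {\<psi> \<in> topspace A.That. \<alpha> \<psi> \<in> {\<xi> \<in> carrier B.Ghat. \<xi> M = \<alpha> \<phi> M}}"
    using \<phi> c by (auto simp: A.hat_topspace B.hat_topspace continuous_map_def)
  ultimately obtain N where "N \<in> A.\<N>" "\<forall>\<psi>\<in>carrier A.Ghat. \<psi> N = \<phi> N \<longrightarrow>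
      \<psi> \<in> {\<psi> \<in> topspace A.That. \<alpha> \<psi> \<in> {\<xi> \<in> carrier B.Ghat. \<xi> M = \<alpha> \<phi> M}}"
    unfolding A.hat_openin_iff by meson
  then show ?thesis by (intro bexI[of _ N]) auto
qed

text \<open>Each coordinate \<open>M\<close> of \<sigma> maps \<open>A\<close> to a finite
  \<open>p\<close>-group, so its kernel \<open>K M\<close> has \<open>p\<close>-power index. The
  \<open>M\<close>-coordinate of the extension can therefore be read off from the
  \<open>K M\<close>-coordinate of the argument, which also gives continuity.\<close>

lemma completion_extend:
  assumes A: "completed_group A p" and B: "completed_group B p" and \<sigma>: "\<sigma> \<in> hom A (pro_p_completion p B)"
  shows "\<exists>\<alpha>\<in>hom (pro_p_completion p A) (pro_p_completion p B).
    continuous_map (pro_p_completion_topology p A) (pro_p_completion_topology p B) \<alpha> \<and>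
    (\<forall>a\<in>carrier A. \<alpha> (completed_group.embed A p a) = \<sigma> a)"
proof -
  interpret A: completed_group A p by fact
  interpret B: completed_group B p by fact
  interpret BH: group B.Ghat by (rule B.hat_group)
  have \<sigma>c: "\<sigma> a \<in> carrier B.Ghat" if "a \<in> carrier A" for a using \<sigma> that by (auto simp: hom_def)
  define K where "K M = {a \<in> carrier A. \<sigma> a M = M}" for M
  have gh: "group_hom A (B Mod M) (\<lambda>a. \<sigma> a M)" if M: "M \<in> B.\<N>" for M
  proof -
    have "(\<lambda>\<phi>. \<phi> M) \<circ> \<sigma> \<in> hom A (B Mod M)" using \<sigma> B.hat_coord_hom[OF M] by (rule hom_compose)
    then show ?thesis using normal.factorgroup_is_group[OF B.N_normal[OF M]] A.is_group
      by (simp add: group_hom_def group_hom_axioms_def comp_def)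
  qed
  have ker: "K M = kernel A (B Mod M) (\<lambda>a. \<sigma> a M)" for M by (simp add: K_def kernel_def)
  have eq: "K M #>\<^bsub>A\<^esub> a = K M #>\<^bsub>A\<^esub> b \<longleftrightarrow> \<sigma> a M = \<sigma> b M"
    if M: "M \<in> B.\<N>" and ab: "a \<in> carrier A" "b \<in> carrier A" for M a b
  proof -
    interpret h: group_hom A "B Mod M" "\<lambda>a. \<sigma> a M" by (rule gh[OF M])
    have s: "subgroup (K M) A" unfolding ker by (rule h.subgroup_kernel)
    have "a \<otimes>\<^bsub>A\<^esub> inv\<^bsub>A\<^esub> b \<in> K M \<longleftrightarrow> \<sigma> a M \<otimes>\<^bsub>B Mod M\<^esub> inv\<^bsub>B Mod M\<^esub> (\<sigma> b M) = \<one>\<^bsub>B Mod M\<^esub>"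
      unfolding ker kernel_def using ab h.hom_mult[of a "inv\<^bsub>A\<^esub> b"] h.hom_inv[of b] by simp
    also have "\<dots> \<longleftrightarrow> \<sigma> a M = \<sigma> b M"
      using h.hom_closed[OF ab(1)] h.hom_closed[OF ab(2)] by (metis h.H.inv_equality h.H.inv_inv h.H.inv_closed h.H.r_inv)
    finally show ?thesis using A.rcos_eq_iff[OF s ab] by simp
  qed
  have KN: "K M \<in> A.\<N>" if M: "M \<in> B.\<N>" for M
  proof -
    interpret h: group_hom A "B Mod M" "\<lambda>a. \<sigma> a M" by (rule gh[OF M])
    have nor: "K M \<lhd> A" unfolding ker by (rule h.normal_kernel)
    obtain k where k: "card (rcosets\<^bsub>B\<^esub> M) = p ^ k" using M by (auto simp: p_power_normal_subgroups_def)
    have s: "subgroup ((\<lambda>a. \<sigma> a M) ` carrier A) (B Mod M)" by (rule h.img_is_subgroup)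
    have "card ((\<lambda>a. \<sigma> a M) ` carrier A) dvd p ^ k"
      using h.H.lagrange[OF s] k by (metis FactGroup_def dvd_triv_right order_def partial_object.select_convs(1))
    then obtain l where "card ((\<lambda>a. \<sigma> a M) ` carrier A) = p ^ l" using A.prime_p divides_primepow_nat by blast
    then have "card (rcosets\<^bsub>A\<^esub> (K M)) = p ^ l"
      unfolding A.rcosets_eq_image using card_image_factor[of "carrier A" "\<lambda>a. K M #>\<^bsub>A\<^esub> a" "\<lambda>a. \<sigma> a M"] eq[OF M] by simp
    then show ?thesis using nor unfolding p_power_normal_subgroups_def by blast
  qed
  have Kmono: "K M \<subseteq> K M'" if "M \<in> B.\<N>" "M' \<in> B.\<N>" "M \<subseteq> M'" for M M'
  proof
    fix a assume "a \<in> K M"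
    then have a: "a \<in> carrier A" "\<sigma> a M = M" by (auto simp: K_def)
    then have "\<sigma> a M' = \<one>\<^bsub>B.Ghat\<^esub> M'"
      using B.hat_agree[OF \<sigma>c[OF a(1)] BH.one_closed that] B.hat_one[OF that(1)] by simp
    then show "a \<in> K M'" using a B.hat_one[OF that(2)] by (simp add: K_def)
  qed
  define \<alpha> where "\<alpha> \<phi> = restrict (\<lambda>M. \<sigma> (SOME a. a \<in> \<phi> (K M)) M) B.\<N>" for \<phi>
  have \<alpha>: "\<alpha> \<phi> M = \<sigma> a M" if \<phi>: "\<phi> \<in> carrier A.Ghat" and M: "M \<in> B.\<N>" and a: "a \<in> \<phi> (K M)" for \<phi> M a
  proof -
    let ?b = "SOME a. a \<in> \<phi> (K M)"
    have b: "?b \<in> \<phi> (K M)" using a by (rule someI)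
    have "\<sigma> ?b M = \<sigma> a M"
      using eq[OF M A.hat_mem(1)[OF \<phi> KN[OF M] b] A.hat_mem(1)[OF \<phi> KN[OF M] a]]
        A.hat_mem(2)[OF \<phi> KN[OF M] b] A.hat_mem(2)[OF \<phi> KN[OF M] a] by simp
    then show ?thesis using M by (simp add: \<alpha>_def)
  qed
  have ex: "\<exists>a\<in>carrier A. a \<in> \<phi> (K M) \<and> \<alpha> \<phi> M = \<sigma> a M" if "\<phi> \<in> carrier A.Ghat" "M \<in> B.\<N>" for \<phi> M
    using A.hat_nonempty[OF that(1) KN[OF that(2)]] \<alpha>[OF that] by blast
  have closed: "\<alpha> \<phi> \<in> carrier B.Ghat" if \<phi>: "\<phi> \<in> carrier A.Ghat" for \<phi>
    unfolding B.hat_carrier pro_p_completion_carrier_def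
  proof (intro CollectI conjI ballI impI)
    show "\<alpha> \<phi> \<in> (\<Pi>\<^sub>E N\<in>B.\<N>. carrier (B Mod N))"
    proof (rule PiE_I)
      fix M assume M: "M \<in> B.\<N>"
      then obtain a where "a \<in> carrier A" "\<alpha> \<phi> M = \<sigma> a M" using ex[OF \<phi>] by blast
      then show "\<alpha> \<phi> M \<in> carrier (B Mod M)" using group_hom.hom_closed[OF gh[OF M]] by simp
    qed (simp add: \<alpha>_def)
    fix M M' assume M: "M \<in> B.\<N>" "M' \<in> B.\<N>" "M \<subseteq> M'"
    obtain a where a: "a \<in> carrier A" "a \<in> \<phi> (K M)" "\<alpha> \<phi> M = \<sigma> a M" using ex[OF \<phi> M(1)] by blast
    have "a \<in> \<phi> (K M')" using A.hat_mono[OF \<phi> KN[OF M(1)] KN[OF M(2)] Kmono[OF M]] a(2) by blast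
    then show "\<alpha> \<phi> M \<subseteq> \<alpha> \<phi> M'" using \<alpha>[OF \<phi> M(2)] a B.hat_mono[OF \<sigma>c[OF a(1)] M] by simp
  qed
  have "\<alpha> \<in> hom A.Ghat B.Ghat"
  proof (rule homI[OF closed])
    fix \<phi> \<psi> assume \<phi>: "\<phi> \<in> carrier A.Ghat" and \<psi>: "\<psi> \<in> carrier A.Ghat"
    have \<phi>\<psi>: "\<phi> \<otimes>\<^bsub>A.Ghat\<^esub> \<psi> \<in> carrier A.Ghat" using \<phi> \<psi> A.hat_group by (simp add: group.is_monoid monoid.m_closed)
    show "\<alpha> (\<phi> \<otimes>\<^bsub>A.Ghat\<^esub> \<psi>) = \<alpha> \<phi> \<otimes>\<^bsub>B.Ghat\<^esub> \<alpha> \<psi>"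
    proof (rule B.hat_eqI)
      show "\<alpha> (\<phi> \<otimes>\<^bsub>A.Ghat\<^esub> \<psi>) \<in> carrier B.Ghat" "\<alpha> \<phi> \<otimes>\<^bsub>B.Ghat\<^esub> \<alpha> \<psi> \<in> carrier B.Ghat"
        using closed \<phi> \<psi> \<phi>\<psi> by auto
      fix M assume M: "M \<in> B.\<N>"
      obtain a where a: "a \<in> carrier A" "a \<in> \<phi> (K M)" "\<alpha> \<phi> M = \<sigma> a M" using ex[OF \<phi> M] by blast
      obtain b where b: "b \<in> carrier A" "b \<in> \<psi> (K M)" "\<alpha> \<psi> M = \<sigma> b M" using ex[OF \<psi> M] by blast
      have "\<alpha> (\<phi> \<otimes>\<^bsub>A.Ghat\<^esub> \<psi>) M = \<sigma> (a \<otimes>\<^bsub>A\<^esub> b) M"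
        using \<alpha>[OF \<phi>\<psi> M A.hat_mult_mem[where \<phi> = \<phi> and \<psi> = \<psi>, OF KN[OF M] a(2) b(2)]] .
      also have "\<dots> = (\<sigma> a \<otimes>\<^bsub>B.Ghat\<^esub> \<sigma> b) M" using \<sigma> a b by (simp add: hom_mult)
      also have "\<dots> = (\<alpha> \<phi> \<otimes>\<^bsub>B.Ghat\<^esub> \<alpha> \<psi>) M" using a b by (simp add: B.hat_mult[OF M])
      finally show "\<alpha> (\<phi> \<otimes>\<^bsub>A.Ghat\<^esub> \<psi>) M = (\<alpha> \<phi> \<otimes>\<^bsub>B.Ghat\<^esub> \<alpha> \<psi>) M" .
    qed
  qed
  moreover have "continuous_map A.That B.That \<alpha>"
    unfolding continuous_map_def
  proof (intro conjI allI impI)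
    show "\<alpha> \<in> topspace A.That \<rightarrow> topspace B.That" using closed by (simp add: A.hat_topspace B.hat_topspace)
    fix U assume U: "openin B.That U"
    show "openin A.That {\<phi> \<in> topspace A.That. \<alpha> \<phi> \<in> U}"
      unfolding A.hat_openin_iff A.hat_topspace
    proof (intro conjI ballI)
      fix \<phi> assume "\<phi> \<in> {\<phi> \<in> carrier A.Ghat. \<alpha> \<phi> \<in> U}"
      then have \<phi>: "\<phi> \<in> carrier A.Ghat" "\<alpha> \<phi> \<in> U" by auto
      then obtain M where M: "M \<in> B.\<N>" "\<And>\<psi>. \<psi> \<in> carrier B.Ghat \<Longrightarrow> \<psi> M = \<alpha> \<phi> M \<Longrightarrow> \<psi> \<in> U"
        using U unfolding B.hat_openin_iff by blast
      have "\<alpha> \<psi> \<in> U" if \<psi>: "\<psi> \<in> carrier A.Ghat" "\<psi> (K M) = \<phi> (K M)" for \<psi>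
        using M(2)[OF closed[OF \<psi>(1)]] \<psi>(2) M(1) by (simp add: \<alpha>_def)
      then show "\<exists>N\<in>A.\<N>. \<forall>\<psi>\<in>carrier A.Ghat. \<psi> N = \<phi> N \<longrightarrow> \<psi> \<in> {\<phi> \<in> carrier A.Ghat. \<alpha> \<phi> \<in> U}"
        using KN[OF M(1)] by blast
    qed auto
  qed
  moreover have "\<alpha> (A.embed a) = \<sigma> a" if a: "a \<in> carrier A" for a
  proof (rule B.hat_eqI[OF closed[OF A.embed_carrier[OF a]] \<sigma>c[OF a]])
    fix M assume M: "M \<in> B.\<N>"
    show "\<alpha> (A.embed a) M = \<sigma> a M" by (rule \<alpha>[OF A.embed_carrier[OF a] M A.embed_mem[OF a KN[OF M]]])
  qed
  ultimately show ?thesis by blast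
qed

lemma (in completed_group) hat_maps_eq:
  assumes "continuous_map That T f" and "continuous_map That T g" and "Hausdorff_space T"
    and "\<And>a. a \<in> carrier G \<Longrightarrow> f (embed a) = g (embed a)" and "\<phi> \<in> carrier Ghat"
  shows "f \<phi> = g \<phi>"
proof (rule ccontr)
  assume ne: "f \<phi> \<noteq> g \<phi>"
  have "closedin That {x \<in> topspace That. f x = g x}"
    using assms(1-3) by (intro closedin_continuous_maps_eq)
  then have "openin That (topspace That - {x \<in> topspace That. f x = g x})" by blast
  moreover have "\<phi> \<in> topspace That - {x \<in> topspace That. f x = g x}" using ne assms(5) by (simp add: hat_topspace)
  ultimately obtain a where "a \<in> carrier G" "embed a \<in> topspace That - {x \<in> topspace That. f x = g x}"
    using hat_openin_dense by blast
  then show False using assms(4) by auto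
qed

lemma completed_free_group: "Factorial_Ring.prime p \<Longrightarrow> completed_group (free_group S) p"
  by (simp add: completed_group_def completed_group_axioms_def free_group_group)

definition free_gen :: "nat \<Rightarrow> nat \<Rightarrow> nat \<Rightarrow> free_pro_p" where
  "free_gen p n i = completed_group.embed (free_group {..<n}) p (word_class {..<n} [(i, True)])"

lemma free_gen_carrier: "Factorial_Ring.prime p \<Longrightarrow> i < n \<Longrightarrow> free_gen p n i \<in> carrier (free_pro_p_group p n)"
  unfolding free_gen_def free_pro_p_group_def
  by (rule completed_group.embed_carrier[OF completed_free_group]) (auto simp: free_group_carrier)

lemma free_pro_p_extend:
  assumes p: "Factorial_Ring.prime p" and y: "\<And>i. i < m \<Longrightarrow> y i \<in> carrier (free_pro_p_group p n)"
  shows "\<exists>\<alpha>\<in>hom (free_pro_p_group p m) (free_pro_p_group p n).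
    continuous_map (free_pro_p_topology p m) (free_pro_p_topology p n) \<alpha> \<and> (\<forall>i<m. \<alpha> (free_gen p m i) = y i)"
proof -
  interpret B: completed_group "free_group {..<n}" p by (rule completed_free_group[OF p])
  have y': "y ` {..<m} \<subseteq> carrier (pro_p_completion p (free_group {..<n}))"
    using y by (auto simp: free_pro_p_group_def)
  obtain \<alpha> where \<alpha>: "\<alpha> \<in> hom (free_pro_p_group p m) (free_pro_p_group p n)"
    "continuous_map (free_pro_p_topology p m) (free_pro_p_topology p n) \<alpha>"
    "\<And>a. a \<in> carrier (free_group {..<m}) \<Longrightarrow> \<alpha> (completed_group.embed (free_group {..<m}) p a) =
       free_lift (pro_p_completion p (free_group {..<n})) y a"
    using completion_extend[OF completed_free_group[OF p] completed_free_group[OF p] free_lift_hom[OF B.hat_group y']]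
    unfolding free_pro_p_group_def free_pro_p_topology_def by blast
  have "\<alpha> (free_gen p m i) = y i" if i: "i < m" for i
  proof -
    interpret hat: group "pro_p_completion p (free_group {..<n})" by (rule B.hat_group)
    have w: "[(i, True)] \<in> free_words {..<m}" using i by simp
    have "\<alpha> (free_gen p m i) = word_eval (pro_p_completion p (free_group {..<n})) y [(i, True)]"
      unfolding free_gen_def using w by (subst \<alpha>(3)) (auto simp: free_group_carrier free_lift_class[OF B.hat_group y'])
    then show ?thesis using y' i by auto
  qed
  then show ?thesis using \<alpha>(1,2) by blast
qed

text \<open>Modulo \<open>M\<close>, \<theta> and the identity agree on the generators and so on all
  words. If \<phi> violated the claim, closedness of \<open>M\<close> and continuity of \<theta>
  would let a word close to \<phi> violate it too.\<close>

lemma free_pro_p_endo_mod: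
  assumes p: "Factorial_Ring.prime p"
    and M: "M \<lhd> free_pro_p_group p d" and cl: "closedin (free_pro_p_topology p d) M"
    and \<theta>: "\<theta> \<in> hom (free_pro_p_group p d) (free_pro_p_group p d)"
    and c: "continuous_map (free_pro_p_topology p d) (free_pro_p_topology p d) \<theta>"
    and gen: "\<And>i. i < d \<Longrightarrow> \<theta> (free_gen p d i) \<otimes>\<^bsub>free_pro_p_group p d\<^esub> inv\<^bsub>free_pro_p_group p d\<^esub> (free_gen p d i) \<in> M"
    and \<phi>: "\<phi> \<in> carrier (free_pro_p_group p d)"
  shows "\<theta> \<phi> \<otimes>\<^bsub>free_pro_p_group p d\<^esub> inv\<^bsub>free_pro_p_group p d\<^esub> \<phi> \<in> M"
proof (rule ccontr)
  interpret F: completed_group "free_group {..<d}" p by (rule completed_free_group[OF p])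
  let ?H = "free_pro_p_group p d" and ?A = "free_group {..<d}"
  have Hd: "?H = F.Ghat" and Td: "free_pro_p_topology p d = F.That"
    by (simp_all add: free_pro_p_group_def free_pro_p_topology_def)
  interpret H: group ?H unfolding Hd by (rule F.hat_group)
  interpret M: normal M ?H by (rule M)
  have \<theta>c: "\<theta> \<psi> \<in> carrier ?H" if "\<psi> \<in> carrier ?H" for \<psi> using \<theta> that by (auto simp: hom_def)
  have emb: "F.embed a \<in> carrier ?H" if "a \<in> carrier ?A" for a using F.embed_carrier[OF that] by (simp add: Hd)
  have words: "\<theta> (F.embed a) \<otimes>\<^bsub>?H\<^esub> inv\<^bsub>?H\<^esub> (F.embed a) \<in> M" if a: "a \<in> carrier ?A" for a
  proof -
    have e: "F.embed \<in> hom ?A ?H" using F.embed_hom by (simp add: Hd)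
    have h1: "(\<lambda>\<psi>. M #>\<^bsub>?H\<^esub> \<psi>) \<circ> (\<theta> \<circ> F.embed) \<in> hom ?A (?H Mod M)"
      using hom_compose[OF hom_compose[OF e \<theta>] M.r_coset_hom_Mod] .
    have h2: "(\<lambda>\<psi>. M #>\<^bsub>?H\<^esub> \<psi>) \<circ> F.embed \<in> hom ?A (?H Mod M)"
      using hom_compose[OF e M.r_coset_hom_Mod] .
    have "((\<lambda>\<psi>. M #>\<^bsub>?H\<^esub> \<psi>) \<circ> (\<theta> \<circ> F.embed)) a = ((\<lambda>\<psi>. M #>\<^bsub>?H\<^esub> \<psi>) \<circ> F.embed) a"
    proof (rule free_group_hom_eqI[OF M.factorgroup_is_group h1 h2 _ a])
      fix i assume i: "i \<in> {..<d}"
      have "free_gen p d i \<in> carrier ?H" using i free_gen_carrier[OF p] by simp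
      then show "((\<lambda>\<psi>. M #>\<^bsub>?H\<^esub> \<psi>) \<circ> (\<theta> \<circ> F.embed)) (word_class {..<d} [(i, True)]) =
         ((\<lambda>\<psi>. M #>\<^bsub>?H\<^esub> \<psi>) \<circ> F.embed) (word_class {..<d} [(i, True)])"
        using H.rcos_eq_iff[OF M.subgroup_axioms \<theta>c] gen[of i] i by (simp add: free_gen_def)
    qed
    then show ?thesis using H.rcos_eq_iff[OF M.subgroup_axioms \<theta>c[OF emb[OF a]] emb[OF a]] by simp
  qed
  let ?c = "\<theta> \<phi> \<otimes>\<^bsub>?H\<^esub> inv\<^bsub>?H\<^esub> \<phi>"
  assume notM: "?c \<notin> M"
  have "?c \<in> carrier ?H" using \<phi> \<theta>c by simp
  then have "?c \<in> topspace F.That - M" using notM F.hat_topspace by (simp add: Hd)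
  moreover have "openin F.That (topspace F.That - M)" using cl unfolding Td by blast
  ultimately obtain N where N: "N \<in> F.\<N>" "\<And>\<psi>. \<psi> \<in> carrier ?H \<Longrightarrow> \<psi> N = ?c N \<Longrightarrow> \<psi> \<notin> M"
    unfolding F.hat_openin_iff Hd by blast
  obtain N' where N': "N' \<in> F.\<N>" "\<And>\<psi>. \<psi> \<in> carrier ?H \<Longrightarrow> \<psi> N' = \<phi> N' \<Longrightarrow> \<theta> \<psi> N = \<theta> \<phi> N"
    using completion_continuous_locally[OF F.completed_group_axioms F.completed_group_axioms c[unfolded Td] \<phi>[unfolded Hd] N(1)]
    unfolding Hd by blast
  obtain a where a: "a \<in> carrier ?A" "F.embed a (N \<inter> N') = \<phi> (N \<inter> N')"
    using F.embed_dense[OF \<phi>[unfolded Hd] F.N_inter[OF N(1) N'(1)]] by blast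
  have aN: "F.embed a N = \<phi> N" "F.embed a N' = \<phi> N'"
    using F.hat_agree[OF F.embed_carrier[OF a(1)] \<phi>[unfolded Hd] F.N_inter[OF N(1) N'(1)] _ _ a(2)] N(1) N'(1) by auto
  have "(\<theta> (F.embed a) \<otimes>\<^bsub>?H\<^esub> inv\<^bsub>?H\<^esub> (F.embed a)) N = ?c N"
    using F.hat_mult[OF N(1)] N'(2)[OF emb[OF a(1)] aN(2)]
      F.hat_inv_cong[OF N(1) F.embed_carrier[OF a(1)] \<phi>[unfolded Hd] aN(1)] by (simp add: Hd)
  moreover have "\<theta> (F.embed a) \<otimes>\<^bsub>?H\<^esub> inv\<^bsub>?H\<^esub> (F.embed a) \<in> carrier ?H" using emb[OF a(1)] \<theta>c by simp
  ultimately show False using N(2) words[OF a(1)] by blast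
qed

section \<open>Presentations\<close>

lemma word_eval_generate:
  assumes "group H"
  shows "u \<in> free_words S \<Longrightarrow> word_eval H y u \<in> generate H (y ` S)"
proof (induction u)
  case (Cons xb u)
  then show ?case by (cases xb) (auto intro!: generate.eng intro: generate.incl generate.inv)
qed (auto intro: generate.one)

text \<open>The relators are left out so that the locale is available for the given presentation,
  before one on a minimal generating set has been found.\<close>

locale pro_p_quotient = group G for G :: "('a, 'b) monoid_scheme" (structure) +
  fixes T :: "'a topology" and p n :: nat and \<pi> :: "free_pro_p \<Rightarrow> 'a"
  assumes prime_p: "Factorial_Ring.prime p" and T_space: "topspace T = carrier G" and T_Hausdorff: "Hausdorff_space T"
    and \<pi>_hom: "\<pi> \<in> hom (free_pro_p_group p n) G"
    and \<pi>_cont: "continuous_map (free_pro_p_topology p n) T \<pi>"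
    and \<pi>_surj: "\<pi> ` carrier (free_pro_p_group p n) = carrier G"
begin

abbreviation "\<Phi> \<equiv> free_group {..<n}"
abbreviation "H \<equiv> free_pro_p_group p n"
abbreviation "TH \<equiv> free_pro_p_topology p n"

sublocale F: completed_group \<Phi> p
  by (rule completed_free_group[OF prime_p])

lemma H_eq: "H = F.Ghat" and TH_eq: "TH = F.That"
  by (simp_all add: free_pro_p_group_def free_pro_p_topology_def)

sublocale H: group H unfolding H_eq by (rule F.hat_group)

sublocale \<pi>: group_hom H G \<pi>
  using \<pi>_hom by (simp add: group_hom_def group_hom_axioms_def is_group H.is_group)

lemma TH_space: "topspace TH = carrier H"
  using F.hat_topspace by (simp add: H_eq TH_eq)

text \<open>A continuous surjection from a compact space onto a Hausdorff space is closed, and so a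
  quotient map.\<close>

lemma quotient_openin:
  assumes U: "U \<subseteq> carrier G" and o: "openin TH {\<phi> \<in> carrier H. \<pi> \<phi> \<in> U}"
  shows "openin T U"
proof -
  let ?V = "{\<phi> \<in> carrier H. \<pi> \<phi> \<in> U}"
  have "closedin TH (topspace TH - ?V)" using o by blast
  then have "compactin TH (topspace TH - ?V)"
    using F.hat_compact closedin_compact_space unfolding TH_eq by blast
  then have "compactin T (\<pi> ` (topspace TH - ?V))" using \<pi>_cont image_compactin by blast
  moreover have "\<pi> ` (topspace TH - ?V) = carrier G - U"
    unfolding TH_space using \<pi>_surj by (auto simp: image_iff)
  ultimately have "closedin T (carrier G - U)" using T_Hausdorff compactin_imp_closedin by metis
  then have "openin T (topspace T - (carrier G - U))" by blast
  moreover have "topspace T - (carrier G - U) = U" using U T_space by blast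
  ultimately show ?thesis by simp
qed

lemma preimage_openin:
  assumes "openin T U"
  shows "openin TH {\<phi> \<in> carrier H. \<pi> \<phi> \<in> U}"
  using \<pi>_cont assms unfolding continuous_map_def TH_space by blast

definition \<gamma> :: "(nat \<times> bool) list \<Rightarrow> 'a" where
  "\<gamma> u = \<pi> (F.embed (word_class {..<n} u))"

lemma \<gamma>_eval:
  assumes "u \<in> free_words {..<n}"
  shows "\<gamma> u = word_eval G (\<lambda>i. \<pi> (free_gen p n i)) u"
proof -
  have "\<pi> \<circ> F.embed \<in> hom \<Phi> G" using Group.hom_compose[OF F.embed_hom \<pi>_hom[unfolded H_eq]] .
  from free_group_hom_eval[OF is_group this assms] show ?thesis by (simp add: \<gamma>_def free_gen_def)
qed

lemma gen_carrier: "i < n \<Longrightarrow> \<pi> (free_gen p n i) \<in> carrier G"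
  using free_gen_carrier[OF prime_p] \<pi>.hom_closed by blast

lemma gens_carrier: "(\<lambda>i. \<pi> (free_gen p n i)) ` {..<n} \<subseteq> carrier G"
  using gen_carrier by auto

lemma \<gamma>_append: "u \<in> free_words {..<n} \<Longrightarrow> v \<in> free_words {..<n} \<Longrightarrow> \<gamma> (u @ v) = \<gamma> u \<otimes> \<gamma> v"
  using word_eval_append[OF is_group gens_carrier] by (simp add: \<gamma>_eval)

lemma \<gamma>_closed: "u \<in> free_words {..<n} \<Longrightarrow> \<gamma> u \<in> carrier G"
  using word_eval_closed[OF is_group gens_carrier] by (simp add: \<gamma>_eval)

lemma words_dense:
  assumes "openin T U" and "U \<noteq> {}"
  shows "\<exists>u\<in>free_words {..<n}. \<gamma> u \<in> U"
proof -
  have "{\<phi> \<in> carrier H. \<pi> \<phi> \<in> U} \<noteq> {}"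
    using assms(2) openin_subset[OF assms(1)] unfolding T_space \<pi>_surj[symmetric] by blast
  then obtain a where "a \<in> carrier \<Phi>" "F.embed a \<in> {\<phi> \<in> carrier H. \<pi> \<phi> \<in> U}"
    using F.hat_openin_dense preimage_openin[OF assms(1)] unfolding TH_eq by blast
  then show ?thesis by (auto simp: free_group_carrier \<gamma>_def)
qed

lemma gens_dense: "T closure_of (generate G ((\<lambda>i. \<pi> (free_gen p n i)) ` {..<n})) = carrier G"
proof -
  have "x \<in> T closure_of (generate G ((\<lambda>i. \<pi> (free_gen p n i)) ` {..<n}))" if x: "x \<in> carrier G" for x
    unfolding in_closure_of
  proof (intro conjI allI impI)
    show "x \<in> topspace T" using x T_space by simp
    fix U assume "x \<in> U \<and> openin T U"
    then obtain u where "u \<in> free_words {..<n}" "\<gamma> u \<in> U" using words_dense by blast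
    then show "\<exists>y. y \<in> generate G ((\<lambda>i. \<pi> (free_gen p n i)) ` {..<n}) \<and> y \<in> U"
      using word_eval_generate[OF is_group] \<gamma>_eval by metis
  qed
  then show ?thesis using closure_of_subset_topspace[of T] T_space by blast
qed

text \<open>A Tietze argument. Lifting generators both ways gives maps \<beta> and \<alpha> between
  the two free groups over \<open>G\<close>; the new kernel is generated by the old relators moved
  along \<alpha> and by the relations identifying each new generator with its image under
  \<open>\<alpha> \<circ> \<beta>\<close>. It ensures that the infimum defining the relation rank is
  taken over a nonempty set.\<close>

lemma presentation_on_generators:
  assumes ker: "kernel H G \<pi> = closed_normal_closure H TH R" and fR: "finite R" and RH: "R \<subseteq> carrier H"
    and S: "finite S" "S \<subseteq> carrier G" "T closure_of (generate G S) = carrier G"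
  shows "\<exists>R'. finite R' \<and> pro_p_presentation p G T (card S) R'"
proof -
  define d where "d = card S"
  let ?K = "free_pro_p_group p d" and ?TK = "free_pro_p_topology p d"
  interpret K: completed_group "free_group {..<d}" p by (rule completed_free_group[OF prime_p])
  have K_eq: "?K = K.Ghat" and TK_eq: "?TK = K.That"
    by (simp_all add: free_pro_p_group_def free_pro_p_topology_def)
  interpret KK: group ?K unfolding K_eq by (rule K.hat_group)
  obtain s where s: "bij_betw s {..<d} S" using S(1) unfolding d_def by (metis ex_bij_betw_nat_finite atLeast0LessThan)
  have "\<exists>\<phi>. \<phi> \<in> carrier H \<and> \<pi> \<phi> = s i" if "i < d" for i
  proof -
    have "s i \<in> carrier G" using s S(2) that by (auto simp: bij_betw_def)
    then show ?thesis using \<pi>_surj by (metis imageE)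
  qed
  then obtain z where z: "\<And>i. i < d \<Longrightarrow> z i \<in> carrier H \<and> \<pi> (z i) = s i" by metis
  obtain \<beta> where \<beta>: "\<beta> \<in> hom ?K H" "continuous_map ?TK TH \<beta>" "\<And>i. i < d \<Longrightarrow> \<beta> (free_gen p d i) = z i"
    using free_pro_p_extend[OF prime_p, of d z n] z by blast
  define \<psi> where "\<psi> = \<pi> \<circ> \<beta>"
  have \<psi>: "\<psi> \<in> hom ?K G" unfolding \<psi>_def using Group.hom_compose[OF \<beta>(1) \<pi>_hom] .
  have \<psi>c: "continuous_map ?TK T \<psi>" unfolding \<psi>_def using continuous_map_compose[OF \<beta>(2) \<pi>_cont] .
  interpret \<psi>: group_hom ?K G \<psi> using \<psi> by (simp add: group_hom_def group_hom_axioms_def is_group KK.is_group)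
  have \<psi>_surj: "\<psi> ` carrier ?K = carrier G"
  proof
    have "S \<subseteq> \<psi> ` carrier ?K"
    proof
      fix x assume "x \<in> S"
      then obtain i where "i < d" "x = s i" using s by (auto simp: bij_betw_def)
      then have "x = \<psi> (free_gen p d i)" using \<beta>(3) z by (simp add: \<psi>_def)
      then show "x \<in> \<psi> ` carrier ?K" using free_gen_carrier[OF prime_p \<open>i < d\<close>] by blast
    qed
    then have "generate G S \<subseteq> \<psi> ` carrier ?K" using generate_subgroup_incl \<psi>.img_is_subgroup by blast
    \<comment> \<open>The image is compact, hence closed, and contains a dense subgroup; this gives
      surjectivity.\<close>
    moreover have "closedin T (\<psi> ` carrier ?K)"
    proof -
      have "compactin ?TK (topspace ?TK)" using K.hat_compact unfolding TK_eq compact_space_def .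
      then have "compactin T (\<psi> ` carrier ?K)"
        using image_compactin[OF _ \<psi>c] K.hat_topspace by (fastforce simp: TK_eq K_eq)
      then show ?thesis using T_Hausdorff compactin_imp_closedin by blast
    qed
    ultimately show "carrier G \<subseteq> \<psi> ` carrier ?K" using closure_of_minimal S(3) by metis
  qed (use \<psi>.hom_closed in blast)
  have "\<exists>\<phi>. \<phi> \<in> carrier ?K \<and> \<psi> \<phi> = \<pi> (free_gen p n j)" if "j < n" for j
    using gen_carrier[OF that] \<psi>_surj by (metis imageE)
  then obtain v where v: "\<And>j. j < n \<Longrightarrow> v j \<in> carrier ?K \<and> \<psi> (v j) = \<pi> (free_gen p n j)" by metis
  obtain \<alpha> where \<alpha>: "\<alpha> \<in> hom H ?K" "continuous_map TH ?TK \<alpha>" "\<And>j. j < n \<Longrightarrow> \<alpha> (free_gen p n j) = v j"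
    using free_pro_p_extend[OF prime_p, of n v d] v by blast
  have \<psi>\<alpha>: "\<psi> (\<alpha> \<phi>) = \<pi> \<phi>" if \<phi>: "\<phi> \<in> carrier H" for \<phi>
  proof -
    have "(\<psi> \<circ> \<alpha>) \<phi> = \<pi> \<phi>"
    proof (rule F.hat_maps_eq[OF _ _ T_Hausdorff _ \<phi>[unfolded H_eq]])
      show "continuous_map F.That T (\<psi> \<circ> \<alpha>)" using continuous_map_compose[OF \<alpha>(2) \<psi>c] unfolding TH_eq .
      show "continuous_map F.That T \<pi>" using \<pi>_cont unfolding TH_eq .
      fix a assume a: "a \<in> carrier \<Phi>"
      have h1: "(\<psi> \<circ> \<alpha>) \<circ> F.embed \<in> hom \<Phi> G"
        using Group.hom_compose[OF F.embed_hom Group.hom_compose[OF \<alpha>(1) \<psi>, unfolded H_eq]] .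
      have h2: "\<pi> \<circ> F.embed \<in> hom \<Phi> G" using Group.hom_compose[OF F.embed_hom \<pi>_hom[unfolded H_eq]] .
      have "((\<psi> \<circ> \<alpha>) \<circ> F.embed) a = (\<pi> \<circ> F.embed) a"
        by (rule free_group_hom_eqI[OF is_group h1 h2 _ a]) (use \<alpha>(3) v in \<open>simp add: free_gen_def[symmetric]\<close>)
      then show "(\<psi> \<circ> \<alpha>) (F.embed a) = \<pi> (F.embed a)" by simp
    qed
    then show ?thesis by simp
  qed
  have \<alpha>c: "\<alpha> \<phi> \<in> carrier ?K" if "\<phi> \<in> carrier H" for \<phi> using \<alpha>(1) that by (auto simp: hom_def)
  have \<beta>c: "\<beta> \<phi> \<in> carrier H" if "\<phi> \<in> carrier ?K" for \<phi> using \<beta>(1) that by (auto simp: hom_def)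
  define \<theta> where "\<theta> = \<alpha> \<circ> \<beta>"
  have \<theta>: "\<theta> \<in> hom ?K ?K" unfolding \<theta>_def using Group.hom_compose[OF \<beta>(1) \<alpha>(1)] .
  have \<theta>cont: "continuous_map ?TK ?TK \<theta>" unfolding \<theta>_def using continuous_map_compose[OF \<beta>(2) \<alpha>(2)] .
  have \<psi>\<theta>: "\<psi> (\<theta> \<phi>) = \<psi> \<phi>" if "\<phi> \<in> carrier ?K" for \<phi>
    using \<psi>\<alpha>[OF \<beta>c[OF that]] by (simp add: \<theta>_def \<psi>_def)
  define R' where "R' = \<alpha> ` R \<union> (\<lambda>i. \<theta> (free_gen p d i) \<otimes>\<^bsub>?K\<^esub> inv\<^bsub>?K\<^esub> (free_gen p d i)) ` {..<d}"
  have fR': "finite R'" unfolding R'_def using fR by simp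
  have gc: "free_gen p d i \<in> carrier ?K" if "i < d" for i using free_gen_carrier[OF prime_p that] .
  have \<theta>c: "\<theta> \<phi> \<in> carrier ?K" if "\<phi> \<in> carrier ?K" for \<phi> using \<theta> that by (auto simp: hom_def)
  have R'K: "R' \<subseteq> carrier ?K" unfolding R'_def using RH \<alpha>c gc \<theta>c by auto
  have R_ker: "R \<subseteq> kernel H G \<pi>" unfolding ker closed_normal_closure_def by blast
  have "kernel ?K G \<psi> = closed_normal_closure ?K ?TK R'"
  proof
    show "closed_normal_closure ?K ?TK R' \<subseteq> kernel ?K G \<psi>"
      unfolding closed_normal_closure_def
    proof (rule Inter_lower, intro CollectI conjI)
      show "kernel ?K G \<psi> \<lhd> ?K" by (rule \<psi>.normal_kernel)
      have "closedin T {\<one>}" using T_Hausdorff T_space one_closed by (simp add: closedin_Hausdorff_singleton)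
      then have "closedin ?TK {x \<in> topspace ?TK. \<psi> x \<in> {\<one>}}" using \<psi>c by (rule closedin_continuous_map_preimage[rotated])
      moreover have "{x \<in> topspace ?TK. \<psi> x \<in> {\<one>}} = kernel ?K G \<psi>"
        using K.hat_topspace by (auto simp: kernel_def K_eq TK_eq)
      ultimately show "closedin ?TK (kernel ?K G \<psi>)" by simp
      show "R' \<subseteq> kernel ?K G \<psi>"
      proof
        fix x assume x: "x \<in> R'"
        then have xc: "x \<in> carrier ?K" using R'K by blast
        have "\<psi> x = \<one>"
        proof (cases "x \<in> \<alpha> ` R")
          case True
          then obtain r where "r \<in> R" "x = \<alpha> r" by blast
          then show ?thesis using \<psi>\<alpha> RH R_ker by (auto simp: kernel_def)
        next
          case False
          then obtain i where i: "i < d" "x = \<theta> (free_gen p d i) \<otimes>\<^bsub>?K\<^esub> inv\<^bsub>?K\<^esub> (free_gen p d i)"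
            using x unfolding R'_def by auto
          then show ?thesis using gc[OF i(1)] \<theta>c \<psi>\<theta> by simp
        qed
        then show "x \<in> kernel ?K G \<psi>" using xc by (simp add: kernel_def)
      qed
    qed
    show "kernel ?K G \<psi> \<subseteq> closed_normal_closure ?K ?TK R'"
      unfolding closed_normal_closure_def
    proof (rule Inter_greatest, rule subsetI)
      fix M \<phi> assume "M \<in> {N. N \<lhd> ?K \<and> closedin ?TK N \<and> R' \<subseteq> N}" and \<phi>: "\<phi> \<in> kernel ?K G \<psi>"
      then have M: "M \<lhd> ?K" "closedin ?TK M" "R' \<subseteq> M" by auto
      interpret M: normal M ?K by (rule M(1))
      have \<phi>c: "\<phi> \<in> carrier ?K" and \<phi>1: "\<pi> (\<beta> \<phi>) = \<one>" using \<phi> by (auto simp: kernel_def \<psi>_def)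
      interpret \<alpha>: group_hom H ?K \<alpha>
        using \<alpha>(1) by (simp add: group_hom_def group_hom_axioms_def H.is_group KK.is_group)
      \<comment> \<open>A closed normal subgroup containing \<open>R\<close>, hence the whole kernel
        of \<pi>, in particular \<open>\<beta> \<phi>\<close>. This puts
        \<open>\<theta> \<phi>\<close> into \<open>M\<close>, and the second kind of relators
        carries the conclusion over to \<phi>.\<close>
      define P where "P = {x \<in> carrier H. \<alpha> x \<in> M}"
      have "P \<lhd> H"
        unfolding H.normal_inv_iff
      proof (intro conjI ballI)
        show "subgroup P H"
          by (rule H.subgroupI) (auto simp: P_def intro: M.m_closed M.m_inv_closed exI[of _ "\<one>\<^bsub>H\<^esub>"])
        fix x h assume x: "x \<in> carrier H" and h: "h \<in> P"
        then show "x \<otimes>\<^bsub>H\<^esub> h \<otimes>\<^bsub>H\<^esub> inv\<^bsub>H\<^esub> x \<in> P" using M.inv_op_closed2[OF \<alpha>.hom_closed[OF x]] by (auto simp: P_def)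
      qed
      moreover have "closedin TH P"
        using closedin_continuous_map_preimage[OF \<alpha>(2) M(2)] TH_space by (simp add: P_def)
      moreover have "R \<subseteq> P" using RH M(3) by (auto simp: P_def R'_def)
      ultimately have "closed_normal_closure H TH R \<subseteq> P" unfolding closed_normal_closure_def by blast
      moreover have "\<beta> \<phi> \<in> closed_normal_closure H TH R"
        unfolding ker[symmetric] using \<beta>c[OF \<phi>c] \<phi>1 by (simp add: kernel_def)
      ultimately have \<theta>M: "\<theta> \<phi> \<in> M" by (auto simp: P_def \<theta>_def)
      have "\<theta> \<phi> \<otimes>\<^bsub>?K\<^esub> inv\<^bsub>?K\<^esub> \<phi> \<in> M"
        by (rule free_pro_p_endo_mod[OF prime_p M(1,2) \<theta> \<theta>cont _ \<phi>c]) (use M(3) in \<open>auto simp: R'_def\<close>)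
      then have "inv\<^bsub>?K\<^esub> (\<theta> \<phi> \<otimes>\<^bsub>?K\<^esub> inv\<^bsub>?K\<^esub> \<phi>) \<otimes>\<^bsub>?K\<^esub> \<theta> \<phi> \<in> M"
        using \<theta>M M.m_inv_closed by (intro M.m_closed)
      moreover have "inv\<^bsub>?K\<^esub> (\<theta> \<phi> \<otimes>\<^bsub>?K\<^esub> inv\<^bsub>?K\<^esub> \<phi>) \<otimes>\<^bsub>?K\<^esub> \<theta> \<phi> = \<phi>"
        using \<phi>c \<theta>c[OF \<phi>c] by (simp add: KK.inv_mult_group KK.m_assoc)
      ultimately show "\<phi> \<in> M" by (simp only:)
    qed
  qed
  then have "pro_p_presentation p G T d R'"
    unfolding pro_p_presentation_def using R'K \<psi> \<psi>c \<psi>_surj by blast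
  then show ?thesis using fR' d_def by blast
qed

end

section \<open>Finite \<open>p\<close>-groups and open subgroups\<close>

text \<open>Orbits have \<open>p\<close>-power size, so if \<open>x\<close> were the only fixed
  point, \<open>card E\<close> would be \<open>1\<close> modulo \<open>p\<close>.\<close>

lemma (in group_action) p_group_other_fixed_point:
  assumes p: "Factorial_Ring.prime (p::nat)" and o: "order G = p ^ m" and fE: "finite E" and pE: "p dvd card E"
    and x: "x \<in> E" and fix_x: "\<And>g. g \<in> carrier G \<Longrightarrow> \<phi> g x = x"
  shows "\<exists>y\<in>E. y \<noteq> x \<and> (\<forall>g\<in>carrier G. \<phi> g y = y)"
proof (rule ccontr)
  assume none: "\<not> ?thesis"
  let ?O = "orbits G E \<phi>"
  have ox: "orbit G \<phi> x = {x}"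
    using orbit_refl[OF x] fix_x by (auto simp: orbit_def)
  have xO: "{x} \<in> ?O" unfolding orbits_def using x ox by force
  have O_img: "?O = orbit G \<phi> ` E" by (auto simp: orbits_def)
  have fO: "finite ?O" unfolding O_img using fE by simp
  have sub: "orb \<subseteq> E" if "orb \<in> ?O" for orb using orbits_coverture that by blast
  have p_dvd: "p dvd card orb" if orb: "orb \<in> ?O - {{x}}" for orb
  proof -
    obtain y where y: "y \<in> E" "orb = orbit G \<phi> y" using orb by (auto simp: orbits_def)
    then have "y \<noteq> x" using orb ox by auto
    then obtain g where g: "g \<in> carrier G" "\<phi> g y \<noteq> y" using none y by blast
    have two: "y \<in> orb" "\<phi> g y \<in> orb" using y orbit_refl g by (auto simp: orbit_def)
    have "card orb dvd p ^ m" using orbit_stabilizer_theorem[OF y(1)] o y(2) by (metis dvd_triv_left)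
    then obtain l where l: "card orb = p ^ l" using p divides_primepow_nat by blast
    have "card orb \<noteq> 1" using two g by (metis card_1_singletonE singletonD)
    then have "l \<noteq> 0" using l by (intro notI) simp
    then show ?thesis using l by simp
  qed
  have "card E = (\<Sum>orb\<in>?O. card orb)"
    using disjoint_sum[OF fE, of "\<lambda>_. 1::nat"] by simp
  also have "\<dots> = 1 + (\<Sum>orb\<in>?O - {{x}}. card orb)" using fO xO by (simp add: sum.remove)
  finally have "p dvd 1 + (\<Sum>orb\<in>?O - {{x}}. card orb)" using pE by simp
  moreover have "p dvd (\<Sum>orb\<in>?O - {{x}}. card orb)" using p_dvd by (rule dvd_sum)
  ultimately have "p dvd 1" by (metis dvd_add_left_iff)
  then show False using p by simp
qed

context group
begin

text \<open>The inverse turns right translation into a homomorphism, and \<open>restrict\<close>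
  makes the permutations extensional, as \<open>Bij\<close> demands.\<close>

lemma rcosets_action:
  assumes N: "subgroup N G"
  shows "group_action (G\<lparr>carrier := N\<rparr>) (rcosets N) (\<lambda>q. restrict (\<lambda>C. C #> inv q) (rcosets N))"
proof -
  let ?E = "rcosets N" and ?\<phi> = "\<lambda>q. restrict (\<lambda>C. C #> inv q) (rcosets N)"
  have Nc: "N \<subseteq> carrier G" using N subgroup.subset by blast
  have closed: "C #> q \<in> ?E" if "C \<in> ?E" "q \<in> carrier G" for C q
  proof -
    from that obtain g where "g \<in> carrier G" "C = N #> g" by (auto simp: RCOSETS_def)
    then show ?thesis using that coset_mult_assoc[OF Nc] rcosetsI[OF Nc] by simp
  qed
  have sub: "C \<subseteq> carrier G" if "C \<in> ?E" for C using that subgroup.rcosets_carrier[OF N is_group] by blast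
  have bij: "?\<phi> q \<in> Bij ?E" if q: "q \<in> N" for q
  proof -
    have qc: "q \<in> carrier G" using q Nc by blast
    have "bij_betw (\<lambda>C. C #> inv q) ?E ?E"
      by (rule bij_betw_byWitness[of _ "\<lambda>C. C #> q"])
        (use qc closed sub in \<open>auto simp: coset_mult_assoc\<close>)
    then have "bij_betw (?\<phi> q) ?E ?E" by (rule bij_betw_cong[THEN iffD1, rotated]) simp
    then show ?thesis by (simp add: Bij_def)
  qed
  have "?\<phi> \<in> hom (G\<lparr>carrier := N\<rparr>) (BijGroup ?E)"
  proof (rule homI)
    fix q r assume "q \<in> carrier (G\<lparr>carrier := N\<rparr>)" "r \<in> carrier (G\<lparr>carrier := N\<rparr>)"
    then have qr: "q \<in> N" "r \<in> N" by auto
    then have c: "q \<in> carrier G" "r \<in> carrier G" using Nc by auto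
    have "?\<phi> (q \<otimes> r) = compose ?E (?\<phi> q) (?\<phi> r)"
      unfolding compose_def
    proof (rule restrict_ext)
      fix C assume C: "C \<in> ?E"
      have "C #> inv (q \<otimes> r) = C #> inv r #> inv q"
        using c sub[OF C] by (simp add: inv_mult_group coset_mult_assoc)
      then show "C #> inv (q \<otimes> r) = ?\<phi> q (?\<phi> r C)" using C closed c by simp
    qed
    then show "?\<phi> (q \<otimes>\<^bsub>G\<lparr>carrier := N\<rparr>\<^esub> r) = ?\<phi> q \<otimes>\<^bsub>BijGroup ?E\<^esub> ?\<phi> r"
      using bij qr by (simp add: BijGroup_def)
  qed (use bij in \<open>auto simp: BijGroup_def\<close>)
  then show ?thesis
    using subgroup.subgroup_is_group[OF N is_group] group_BijGroup
    by (simp add: group_action_def group_hom_def group_hom_axioms_def)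
qed

text \<open>\<open>N\<close> acts by translation on its own cosets and fixes the trivial one, so it
  fixes another coset \<open>N #> g\<close>; being fixed means that \<open>g\<close> conjugates
  \<open>N\<close> into itself.\<close>

lemma p_group_normalizer_grows:
  assumes p: "Factorial_Ring.prime (p::nat)" and o: "order G = p ^ m" and N: "subgroup N G" and ne: "N \<noteq> carrier G"
  shows "\<exists>g\<in>carrier G - N. \<forall>q\<in>N. g \<otimes> q \<otimes> inv g \<in> N"
proof -
  have fG: "finite (carrier G)" using o p by (metis order_gt_0_iff_finite prime_gt_0_nat zero_less_power)
  have Nc: "N \<subseteq> carrier G" using N subgroup.subset by blast
  have fN: "finite N" using fG Nc finite_subset by blast
  have lag: "card (rcosets N) * card N = p ^ m" using lagrange[OF N] o by simp
  have "card (rcosets N) dvd p ^ m" using lag by (metis dvd_triv_left)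
  then obtain l where l: "card (rcosets N) = p ^ l" using p divides_primepow_nat by blast
  have "l \<noteq> 0"
  proof
    assume "l = 0"
    then have "card N = card (carrier G)" using lag l o by (simp add: order_def)
    then show False using card_subset_eq[OF fG Nc] ne by blast
  qed
  then have pd: "p dvd card (rcosets N)" using l by simp
  have "card N dvd p ^ m" using lag by (metis dvd_triv_right)
  then obtain k where k: "order (G\<lparr>carrier := N\<rparr>) = p ^ k" using p divides_primepow_nat by (auto simp: order_def)
  have NN: "N \<in> rcosets N" using subgroup.subgroup_in_rcosets[OF N is_group] .
  interpret A: group_action "G\<lparr>carrier := N\<rparr>" "rcosets N" "\<lambda>q. restrict (\<lambda>C. C #> inv q) (rcosets N)"
    by (rule rcosets_action[OF N])
  have fin: "finite (rcosets N)" using l p prime_gt_0_nat by (intro card_ge_0_finite) simp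
  have fixN: "restrict (\<lambda>C. C #> inv q) (rcosets N) N = N" if "q \<in> carrier (G\<lparr>carrier := N\<rparr>)" for q
  proof -
    have "inv q \<in> N" using that subgroup.m_inv_closed[OF N] by simp
    then have "N #> inv q = N" using coset_join2[OF _ N] Nc by blast
    then show ?thesis using NN by simp
  qed
  obtain C where C0: "C \<in> rcosets N" "C \<noteq> N"
    "\<forall>q\<in>carrier (G\<lparr>carrier := N\<rparr>). restrict (\<lambda>C. C #> inv q) (rcosets N) C = C"
    using A.p_group_other_fixed_point[OF p k fin pd NN fixN] by blast
  have C: "C \<in> rcosets N" "C \<noteq> N" "\<And>q. q \<in> N \<Longrightarrow> C #> inv q = C" using C0 by auto
  obtain g where g: "g \<in> carrier G" "C = N #> g" using C(1) by (auto simp: RCOSETS_def)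
  have "g \<notin> N" using C(2) g coset_join2[OF g(1) N] by blast
  moreover have "g \<otimes> q \<otimes> inv g \<in> N" if q: "q \<in> N" for q
  proof -
    have qc: "q \<in> carrier G" using q Nc by blast
    have "N #> (g \<otimes> q) = N #> g"
      using C(3)[of "inv q"] q g qc subgroup.m_inv_closed[OF N] coset_mult_assoc[OF Nc g(1) qc] by simp
    then show ?thesis using rcos_eq_iff[OF N] g qc by simp
  qed
  ultimately show ?thesis using g(1) by blast
qed

text \<open>Among the proper subgroups containing \<open>Q\<close>, one of largest order is normal,
  because its normalizer is strictly larger.\<close>

lemma p_group_proper_subgroup_in_normal:
  assumes p: "Factorial_Ring.prime (p::nat)" and o: "order G = p ^ m" and Q: "subgroup Q G" and ne: "Q \<noteq> carrier G"
  shows "\<exists>N. N \<lhd> G \<and> Q \<subseteq> N \<and> N \<noteq> carrier G"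
proof -
  have fG: "finite (carrier G)" using o p by (metis order_gt_0_iff_finite prime_gt_0_nat zero_less_power)
  define P where "P N \<longleftrightarrow> subgroup N G \<and> Q \<subseteq> N \<and> N \<noteq> carrier G" for N
  have "P Q" using Q ne by (simp add: P_def)
  moreover have "card N < Suc (card (carrier G))" if "P N" for N
    using that card_mono[OF fG, of N] subgroup.subset by (force simp: P_def)
  ultimately obtain N where N: "P N" and max: "\<And>N'. P N' \<Longrightarrow> card N' \<le> card N"
    using ex_has_greatest_nat[of P Q card "Suc (card (carrier G))"] by (metis less_imp_le)
  have sN: "subgroup N G" and QN: "Q \<subseteq> N" and neN: "N \<noteq> carrier G" using N by (auto simp: P_def)
  have Nc: "N \<subseteq> carrier G" using sN subgroup.subset by blast
  have fN: "finite N" using fG Nc finite_subset by blast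
  \<comment> \<open>The normalizer, with both conjugations required so that closure under inverses
    is immediate. \<open>Z_half\<close> recovers one from the other by finiteness.\<close>
  define Z where "Z = {g \<in> carrier G. \<forall>q\<in>N. g \<otimes> q \<otimes> inv g \<in> N \<and> inv g \<otimes> q \<otimes> g \<in> N}"
  have Z_half: "g \<in> Z" if g: "g \<in> carrier G" and h: "\<And>q. q \<in> N \<Longrightarrow> g \<otimes> q \<otimes> inv g \<in> N" for g
  proof -
    have "inj_on (\<lambda>q. g \<otimes> q \<otimes> inv g) N" using g Nc by (intro inj_onI) (auto simp: m_assoc subset_iff)
    then have surj: "(\<lambda>q. g \<otimes> q \<otimes> inv g) ` N = N" using h fN by (intro endo_inj_surj) auto
    have "inv g \<otimes> q \<otimes> g \<in> N" if q: "q \<in> N" for q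
    proof -
      obtain r where r: "r \<in> N" "q = g \<otimes> r \<otimes> inv g" using surj q by blast
      have "r \<in> carrier G" using r(1) Nc by blast
      then have "inv g \<otimes> q \<otimes> g = r" using r(2) g by (simp add: m_assoc inv_solve_left')
      then show ?thesis using r by simp
    qed
    then show ?thesis using g h by (simp add: Z_def)
  qed
  have sZ: "subgroup Z G"
  proof (rule subgroupI)
    show "Z \<subseteq> carrier G" by (auto simp: Z_def)
    have "\<one> \<in> Z" using Nc by (auto simp: Z_def subset_iff)
    then show "Z \<noteq> {}" by blast
    show "inv a \<in> Z" if "a \<in> Z" for a using that by (auto simp: Z_def)
    show "a \<otimes> b \<in> Z" if a: "a \<in> Z" and b: "b \<in> Z" for a b
    proof (rule Z_half)
      have c: "a \<in> carrier G" "b \<in> carrier G" using a b by (auto simp: Z_def)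
      then show "a \<otimes> b \<in> carrier G" by simp
      fix q assume q: "q \<in> N"
      then have "a \<otimes> (b \<otimes> q \<otimes> inv b) \<otimes> inv a \<in> N" using a b by (auto simp: Z_def)
      moreover have "q \<in> carrier G" using q Nc by blast
      ultimately show "a \<otimes> b \<otimes> q \<otimes> inv (a \<otimes> b) \<in> N" using c by (simp add: inv_mult_group m_assoc)
    qed
  qed
  have NZ: "N \<subseteq> Z"
    using sN Nc by (auto simp: Z_def intro!: subgroup.m_closed[OF sN] subgroup.m_inv_closed[OF sN])
  obtain g where g: "g \<in> carrier G - N" "\<forall>q\<in>N. g \<otimes> q \<otimes> inv g \<in> N"
    using p_group_normalizer_grows[OF p o sN neN] by blast
  then have "g \<in> Z" using Z_half by blast
  then have "N \<subset> Z" using NZ g by blast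
  moreover have "finite Z" using fG by (rule finite_subset[rotated]) (auto simp: Z_def)
  ultimately have "card N < card Z" by (simp add: psubset_card_mono)
  then have "\<not> P Z" using max by (meson not_less)
  then have "Z = carrier G" using sZ QN NZ by (auto simp: P_def)
  then have "N \<lhd> G" unfolding normal_inv_iff using sN by (auto simp: Z_def)
  then show ?thesis using QN neN by blast
qed

end

section \<open>Open subgroups of a given index\<close>

context pro_p_quotient
begin

text \<open>Membership in an open subgroup depends on a single coordinate of a preimage in the free
  pro-\<open>p\<close> group. In a coordinate fine enough for \<open>U\<close> and \<open>V\<close>,
  every element agrees with a word.\<close>

lemma open_subgroup_word_determined:
  assumes U: "subgroup U G" "openin T U" and V: "subgroup V G" "openin T V"
    and eq: "\<And>u. u \<in> free_words {..<n} \<Longrightarrow> \<gamma> u \<in> U \<longleftrightarrow> \<gamma> u \<in> V"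
  shows "U = V"
proof -
  have loc: "\<exists>N\<in>F.\<N>. \<forall>\<phi>\<in>carrier H. \<forall>\<psi>\<in>carrier H. \<phi> N = \<psi> N \<longrightarrow> (\<pi> \<phi> \<in> U \<longleftrightarrow> \<pi> \<psi> \<in> U)"
    if U: "subgroup U G" "openin T U" for U
  proof -
    have 1: "\<one>\<^bsub>H\<^esub> \<in> {\<phi> \<in> carrier H. \<pi> \<phi> \<in> U}" using subgroup.one_closed[OF U(1)] by simp
    have "\<forall>\<phi>\<in>{\<phi> \<in> carrier H. \<pi> \<phi> \<in> U}. \<exists>N\<in>F.\<N>. \<forall>\<psi>\<in>carrier H. \<psi> N = \<phi> N \<longrightarrow> \<psi> \<in> {\<phi> \<in> carrier H. \<pi> \<phi> \<in> U}"
      using preimage_openin[OF U(2)] unfolding TH_eq F.hat_openin_iff H_eq by (rule conjunct2)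
    from bspec[OF this 1] obtain N where N: "N \<in> F.\<N>"
      "\<And>\<psi>. \<psi> \<in> carrier H \<Longrightarrow> \<psi> N = \<one>\<^bsub>H\<^esub> N \<Longrightarrow> \<pi> \<psi> \<in> U" by blast
    have "\<pi> \<phi> \<in> U" if \<phi>: "\<phi> \<in> carrier H" and \<psi>: "\<psi> \<in> carrier H" and e: "\<phi> N = \<psi> N" and \<psi>U: "\<pi> \<psi> \<in> U" for \<phi> \<psi>
    proof -
      have "(\<phi> \<otimes>\<^bsub>H\<^esub> inv\<^bsub>H\<^esub> \<psi>) N = (\<psi> \<otimes>\<^bsub>H\<^esub> inv\<^bsub>H\<^esub> \<psi>) N" using F.hat_mult[OF N(1)] e by (simp add: H_eq)
      also have "\<psi> \<otimes>\<^bsub>H\<^esub> inv\<^bsub>H\<^esub> \<psi> = \<one>\<^bsub>H\<^esub>" using \<psi> by (rule H.r_inv)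
      finally have "\<pi> (\<phi> \<otimes>\<^bsub>H\<^esub> inv\<^bsub>H\<^esub> \<psi>) \<in> U" by (rule N(2)[rotated]) (use \<phi> \<psi> in simp)
      then have "\<pi> (\<phi> \<otimes>\<^bsub>H\<^esub> inv\<^bsub>H\<^esub> \<psi>) \<otimes> \<pi> \<psi> \<in> U" using \<psi>U subgroup.m_closed[OF U(1)] by blast
      moreover have "\<pi> (\<phi> \<otimes>\<^bsub>H\<^esub> inv\<^bsub>H\<^esub> \<psi>) \<otimes> \<pi> \<psi> = \<pi> \<phi>" using \<phi> \<psi> by (simp add: m_assoc)
      ultimately show ?thesis by (simp only:)
    qed
    then show ?thesis using N(1) by (intro bexI[of _ N]) (blast | simp)+
  qed
  obtain M where M: "M \<in> F.\<N>" "\<forall>\<phi>\<in>carrier H. \<forall>\<psi>\<in>carrier H. \<phi> M = \<psi> M \<longrightarrow> (\<pi> \<phi> \<in> U \<longleftrightarrow> \<pi> \<psi> \<in> U)"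
    using loc[OF U] by blast
  obtain N where N: "N \<in> F.\<N>" "\<forall>\<phi>\<in>carrier H. \<forall>\<psi>\<in>carrier H. \<phi> N = \<psi> N \<longrightarrow> (\<pi> \<phi> \<in> V \<longleftrightarrow> \<pi> \<psi> \<in> V)"
    using loc[OF V] by blast
  have MN: "M \<inter> N \<in> F.\<N>" using F.N_inter M(1) N(1) .
  have "\<pi> \<phi> \<in> U \<longleftrightarrow> \<pi> \<phi> \<in> V" if \<phi>: "\<phi> \<in> carrier H" for \<phi>
  proof -
    obtain a where a: "a \<in> carrier \<Phi>" "F.embed a (M \<inter> N) = \<phi> (M \<inter> N)"
      using F.embed_dense[OF \<phi>[unfolded H_eq] MN] by blast
    obtain u where u: "u \<in> free_words {..<n}" "a = word_class {..<n} u" using a(1) by (auto simp: free_group_carrier)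
    have e: "F.embed a \<in> carrier H" using F.embed_carrier[OF a(1)] by (simp add: H_eq)
    have "F.embed a M = \<phi> M" "F.embed a N = \<phi> N"
      using F.hat_agree[OF e[unfolded H_eq] \<phi>[unfolded H_eq] MN _ _ a(2)] M(1) N(1) by auto
    then have "\<pi> \<phi> \<in> U \<longleftrightarrow> \<gamma> u \<in> U" "\<pi> \<phi> \<in> V \<longleftrightarrow> \<gamma> u \<in> V"
      using M(2) N(2) e \<phi> unfolding \<gamma>_def u(2)[symmetric] by metis+
    then show ?thesis using eq[OF u(1)] by simp
  qed
  moreover have "U \<subseteq> \<pi> ` carrier H" "V \<subseteq> \<pi> ` carrier H" using U V \<pi>_surj subgroup.subset by blast+
  ultimately show ?thesis by blast
qed

text \<open>An open subgroup of index \<open>k\<close> is recovered from the action of the finitely many generators on its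
  cosets, numbered by \<open>{..<k}\<close>.  Without finiteness \<^const>\<open>num_open_subgroups\<close> would take the junk value \<open>0\<close>.\<close>

lemma finite_open_subgroups_index:
  "finite {U. subgroup U G \<and> openin T U \<and> finite (rcosets U) \<and> card (rcosets U) = k}"
proof -
  let ?X = "{U. subgroup U G \<and> openin T U \<and> finite (rcosets U) \<and> card (rcosets U) = k}"
  define L where "L = {..<n} \<times> (UNIV :: bool set)"
  define \<tau> where "\<tau> U = (SOME f. bij_betw f (rcosets U) {..<k})" for U
  have \<tau>: "bij_betw (\<tau> U) (rcosets U) {..<k}" if "U \<in> ?X" for U
  proof -
    have "\<exists>f. bij_betw f (rcosets U) {..<k}" using that finite_same_card_bij[of "rcosets U" "{..<k}"] by auto
    then show ?thesis unfolding \<tau>_def by (rule someI_ex)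
  qed
  \<comment> \<open>The transition table of the generators and their inverses on coset numbers. With
    the number of the coset \<open>U\<close> itself it decides which words land in \<open>U\<close>,
    and there are finitely many such pairs.\<close>
  define t where "t U = restrict (\<lambda>(i, l). \<tau> U (inv_into (rcosets U) (\<tau> U) i #> \<gamma> [l])) ({..<k} \<times> L)" for U
  define run where "run = (\<lambda>(f :: nat \<times> nat \<times> bool \<Rightarrow> nat) i u. fold (\<lambda>l i. f (i, l)) u i)"
  have move: "C #> g \<in> rcosets U" if "U \<in> ?X" "C \<in> rcosets U" "g \<in> carrier G" for U C g
  proof -
    from that obtain h where "h \<in> carrier G" "C = U #> h" by (auto simp: RCOSETS_def)
    then show ?thesis using that coset_mult_assoc rcosetsI subgroup.subset[of U G] by simp
  qed
  have run: "run (t U) (\<tau> U C) u = \<tau> U (C #> \<gamma> u)"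
    if U: "U \<in> ?X" and "C \<in> rcosets U" "u \<in> free_words {..<n}" for U C u
    using that(2,3)
  proof (induction u arbitrary: C)
    case Nil
    have "C \<subseteq> carrier G" using U Nil(1) subgroup.rcosets_carrier[OF _ is_group] by blast
    moreover have "\<gamma> [] = \<one>" by (simp add: \<gamma>_eval)
    ultimately show ?case by (simp add: run_def)
  next
    case (Cons l u)
    then have l: "l \<in> L" and u: "u \<in> free_words {..<n}" and lw: "[l] \<in> free_words {..<n}" by (cases l; auto simp: L_def)+
    have C: "C \<subseteq> carrier G" using U Cons.prems(1) subgroup.rcosets_carrier[OF _ is_group] by blast
    have mv: "C #> \<gamma> [l] \<in> rcosets U" using move[OF U Cons.prems(1) \<gamma>_closed[OF lw]] .
    have "\<tau> U C \<in> {..<k}" using \<tau>[OF U] Cons.prems(1) by (auto simp: bij_betw_def)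
    then have "t U (\<tau> U C, l) = \<tau> U (C #> \<gamma> [l])"
      using l \<tau>[OF U] Cons.prems(1) by (simp add: t_def bij_betw_def)
    then have "run (t U) (\<tau> U C) (l # u) = run (t U) (\<tau> U (C #> \<gamma> [l])) u" by (simp add: run_def)
    also have "\<dots> = \<tau> U (C #> \<gamma> [l] #> \<gamma> u)" using Cons.IH[OF mv u] .
    also have "C #> \<gamma> [l] #> \<gamma> u = C #> \<gamma> (l # u)"
      using coset_mult_assoc[OF C \<gamma>_closed[OF lw] \<gamma>_closed[OF u]] \<gamma>_append[OF lw u] by simp
    finally show ?case .
  qed
  have mem: "\<gamma> u \<in> U \<longleftrightarrow> run (t U) (\<tau> U U) u = \<tau> U U" if U: "U \<in> ?X" and u: "u \<in> free_words {..<n}" for U u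
  proof -
    have s: "subgroup U G" using U by simp
    have UU: "U \<in> rcosets U" using subgroup.subgroup_in_rcosets[OF s is_group] .
    have "run (t U) (\<tau> U U) u = \<tau> U U \<longleftrightarrow> U #> \<gamma> u = U"
      unfolding run[OF U UU u] using \<tau>[OF U] move[OF U UU \<gamma>_closed[OF u]] UU
      by (metis bij_betw_def inj_on_eq_iff)
    also have "\<dots> \<longleftrightarrow> \<gamma> u \<in> U" using coset_join1[OF _ \<gamma>_closed[OF u] s] coset_join2[OF \<gamma>_closed[OF u] s] by blast
    finally show ?thesis by simp
  qed
  have inj: "inj_on (\<lambda>U. (t U, \<tau> U U)) ?X"
  proof (rule inj_onI)
    fix U V assume U: "U \<in> ?X" and V: "V \<in> ?X" and "(t U, \<tau> U U) = (t V, \<tau> V V)"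
    then show "U = V" by (intro open_subgroup_word_determined) (auto simp: mem)
  qed
  have "(\<lambda>U. (t U, \<tau> U U)) ` ?X \<subseteq> PiE ({..<k} \<times> L) (\<lambda>_. {..<k}) \<times> {..<k}"
  proof (rule image_subsetI)
    fix U assume U: "U \<in> ?X"
    have im: "\<tau> U C \<in> {..<k}" if "C \<in> rcosets U" for C using \<tau>[OF U] that by (auto simp: bij_betw_def)
    have "t U \<in> PiE ({..<k} \<times> L) (\<lambda>_. {..<k})"
    proof (rule PiE_I)
      fix x assume "x \<in> {..<k} \<times> L"
      then obtain i l where x: "x = (i, l)" "i < k" "l \<in> L" by auto
      have "inv_into (rcosets U) (\<tau> U) i \<in> rcosets U"
        using \<tau>[OF U] x(2) by (metis bij_betw_def inv_into_into lessThan_iff)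
      moreover have "[l] \<in> free_words {..<n}" using x(3) by (cases l) (auto simp: L_def)
      ultimately show "t U x \<in> {..<k}" using x im[OF move[OF U _ \<gamma>_closed]] by (simp add: t_def)
    qed (simp add: t_def)
    moreover have "\<tau> U U \<in> {..<k}" using U im subgroup.subgroup_in_rcosets[OF _ is_group] by blast
    ultimately show "(t U, \<tau> U U) \<in> PiE ({..<k} \<times> L) (\<lambda>_. {..<k}) \<times> {..<k}" by simp
  qed
  moreover have "finite (PiE ({..<k} \<times> L) (\<lambda>_. {..<k}) \<times> {..<k})"
    by (intro finite_cartesian_product finite_PiE) (auto simp: L_def)
  ultimately have "finite ((\<lambda>U. (t U, \<tau> U U)) ` ?X)" using finite_subset by blast
  then show ?thesis using inj finite_image_iff by blast
qed

end

section \<open>Minimality of the generators and the degree of the relators\<close>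

section \<open>The inequality between generators and relations\<close>

lemma (in group) word_eval_single:
  assumes y: "y i \<in> carrier G" and one: "\<And>j. j \<in> S \<Longrightarrow> j \<noteq> i \<Longrightarrow> y j = \<one>"
  shows "u \<in> free_words S \<Longrightarrow> word_eval G y u = y i [^] (exponent_sum i u)"
proof (induction u)
  case Nil then show ?case by (simp add: exponent_sum_def)
next
  case (Cons xb u)
  obtain j b where xb: "xb = (j, b)" by (cases xb)
  have e: "exponent_sum i (xb # u) = (if j = i then (if b then 1 else - 1) else 0) + exponent_sum i u"
    by (simp add: exponent_sum_def xb)
  have IH: "word_eval G y u = y i [^] exponent_sum i u" using Cons by simp
  show ?case
  proof (cases "j = i")
    case True
    define c :: int where "c = (if b then 1 else - 1)"
    have "y i [^] c = (if b then y i else inv (y i))" using y int_pow_neg[OF y, of 1] by (simp add: c_def)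
    then have "word_eval G y (xb # u) = y i [^] c \<otimes> y i [^] exponent_sum i u" using IH True xb by simp
    also have "\<dots> = y i [^] (c + exponent_sum i u)" using y by (simp add: int_pow_mult)
    also have "c + exponent_sum i u = exponent_sum i (xb # u)" using e True by (simp add: c_def)
    finally show ?thesis .
  next
    case False
    then have "y j = \<one>" using one Cons.prems xb by simp
    then have "word_eval G y (xb # u) = y i [^] exponent_sum i u" using IH y xb by simp
    then show ?thesis using False e by simp
  qed
qed

lemma (in group) int_pow_coprime_one:
  assumes x: "x \<in> carrier G" and "x [^] (a::int) = \<one>" and "x [^] (b::int) = \<one>" and "coprime a b"
  shows "x = \<one>"
proof -
  obtain s t where st: "s * a + t * b = 1" using bezout_int[of a b] assms(4) by (auto simp: coprime_iff_gcd_eq_1)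
  have "x = x [^] (a * s + b * t)" using x st by (simp add: mult.commute)
  also have "\<dots> = (x [^] a) [^] s \<otimes> (x [^] b) [^] t" using x by (simp add: int_pow_mult int_pow_pow)
  also have "\<dots> = \<one>" using assms by (simp add: int_pow_one)
  finally show ?thesis .
qed

context pro_p_quotient
begin

sublocale M: filtered_group \<Phi> p "trunc_ideal n p" magnus_class
  by (rule magnus_filtered[OF prime_p])

lemma D_in_N: "m \<ge> 1 \<Longrightarrow> M.D m \<in> F.\<N>"
  using M.D_normal M.index_D_power unfolding p_power_normal_subgroups_def by blast

text \<open>Burnside's basis theorem: if a relation had nonzero exponent sum modulo \<open>p\<close> in the generator \<open>i\<close>,
  the images of the other generators would already generate a dense subgroup.\<close>

lemma gens_dense_without:
  assumes i: "i < n" and \<kappa>: "\<kappa> \<in> kernel H G \<pi>" and u: "u \<in> free_words {..<n}" "word_class {..<n} u \<in> \<kappa> (M.D 2)"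
    and ne: "\<not> int p dvd exponent_sum i u"
  shows "T closure_of (generate G ((\<lambda>j. \<pi> (free_gen p n j)) ` ({..<n} - {i}))) = carrier G"
proof -
  let ?S = "(\<lambda>j. \<pi> (free_gen p n j)) ` ({..<n} - {i})"
  have SG: "?S \<subseteq> carrier G" using gen_carrier by auto
  have gS: "subgroup (generate G ?S) G" using generate_is_subgroup[OF SG] .
  have \<kappa>c: "\<kappa> \<in> carrier H" and \<kappa>1: "\<pi> \<kappa> = \<one>" using \<kappa> by (auto simp: kernel_def)
  \<comment> \<open>The preimage of the subgroup generated without \<open>i\<close>. For density it
    suffices that \<open>C\<close> maps onto every finite quotient of the free group.\<close>
  define C where "C = {\<chi>' \<in> carrier H. \<pi> \<chi>' \<in> generate G ?S}"
  have sC: "subgroup C H"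
  proof (rule H.subgroupI)
    show "C \<subseteq> carrier H" by (auto simp: C_def)
    have "\<one>\<^bsub>H\<^esub> \<in> C" using subgroup.one_closed[OF gS] by (simp add: C_def)
    then show "C \<noteq> {}" by blast
  qed (auto simp: C_def subgroup.m_closed[OF gS] subgroup.m_inv_closed[OF gS])
  have onto: "(\<lambda>\<xi>. \<xi> N) ` C = carrier (\<Phi> Mod N)" if N: "N \<in> F.\<N>" for N
  proof (rule ccontr)
    assume neq: "(\<lambda>\<xi>. \<xi> N) ` C \<noteq> carrier (\<Phi> Mod N)"
    interpret N: normal N \<Phi> by (rule F.N_normal[OF N])
    interpret P: group "\<Phi> Mod N" by (rule N.factorgroup_is_group)
    interpret co: group_hom H "\<Phi> Mod N" "\<lambda>\<xi>. \<xi> N"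
      using F.hat_coord_hom[OF N] F.hat_group P.is_group by (simp add: group_hom_def group_hom_axioms_def H_eq)
    obtain k where "card (rcosets\<^bsub>\<Phi>\<^esub> N) = p ^ k" using N by (auto simp: p_power_normal_subgroups_def)
    then have oP: "order (\<Phi> Mod N) = p ^ k" by (simp add: order_def FactGroup_def)
    \<comment> \<open>A proper image would lie in a proper normal subgroup \<open>Q\<close>, and the
      quotient by \<open>Q\<close> is a nontrivial \<open>p\<close>-group in which all generators
      other than \<open>i\<close> die.\<close>
    obtain Q where Q: "Q \<lhd> \<Phi> Mod N" "(\<lambda>\<xi>. \<xi> N) ` C \<subseteq> Q" "Q \<noteq> carrier (\<Phi> Mod N)"
      using P.p_group_proper_subgroup_in_normal[OF prime_p oP co.subgroup_img_is_subgroup[OF sC] neq] by blast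
    interpret Q: normal Q "\<Phi> Mod N" by (rule Q(1))
    let ?B = "(\<Phi> Mod N) Mod Q"
    interpret B: group ?B by (rule Q.factorgroup_is_group)
    define h where "h = (\<lambda>X. Q #>\<^bsub>\<Phi> Mod N\<^esub> X) \<circ> (\<lambda>a. N #>\<^bsub>\<Phi>\<^esub> a)"
    have h: "h \<in> hom \<Phi> ?B" unfolding h_def using Group.hom_compose[OF N.r_coset_hom_Mod Q.r_coset_hom_Mod] .
    define y where "y j = h (word_class {..<n} [(j, True)])" for j
    have wc: "word_class {..<n} [(j, True)] \<in> carrier \<Phi>" if "j < n" for j using that by (auto simp: free_group_carrier)
    have yc: "y j \<in> carrier ?B" if "j < n" for j using h wc[OF that] by (auto simp: y_def hom_def)
    have h1: "h a = \<one>\<^bsub>?B\<^esub> \<longleftrightarrow> N #>\<^bsub>\<Phi>\<^esub> a \<in> Q" if a: "a \<in> carrier \<Phi>" for a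
    proof -
      have c: "N #>\<^bsub>\<Phi>\<^esub> a \<in> carrier (\<Phi> Mod N)" using a by (auto simp: carrier_FactGroup)
      show ?thesis using P.coset_join1[OF _ c Q.subgroup_axioms] P.coset_join2[OF c Q.subgroup_axioms] by (auto simp: h_def)
    qed
    have y1: "y j = \<one>\<^bsub>?B\<^esub>" if "j \<in> {..<n}" "j \<noteq> i" for j
    proof -
      have "free_gen p n j \<in> C"
        using that free_gen_carrier[OF prime_p] by (auto simp: C_def intro!: generate.incl)
      then have "free_gen p n j N \<in> Q" using Q(2) by blast
      then show ?thesis using h1[OF wc] that F.embed_apply[OF N] by (simp add: y_def free_gen_def)
    qed
    \<comment> \<open>Fine enough for two purposes: a word approximating \<kappa> here has the right
      image modulo \<open>N\<close> and, modulo \<open>p\<close>, the same exponent sum in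
      \<open>i\<close> as \<open>u\<close>.\<close>
    define N2 where "N2 = N \<inter> M.D 2"
    have N2: "N2 \<in> F.\<N>" unfolding N2_def using F.N_inter[OF N D_in_N] by simp
    obtain a where a: "a \<in> carrier \<Phi>" "a \<in> \<kappa> N2" using F.hat_nonempty[OF \<kappa>c[unfolded H_eq] N2] by blast
    obtain v where v: "v \<in> free_words {..<n}" "a = word_class {..<n} v" using a(1) by (auto simp: free_group_carrier)
    have aN: "a \<in> \<kappa> N" "a \<in> \<kappa> (M.D 2)"
      using F.hat_mono[OF \<kappa>c[unfolded H_eq] N2] N D_in_N[of 2] a(2) by (auto simp: N2_def)
    have "M.D 2 #>\<^bsub>\<Phi>\<^esub> a = M.D 2 #>\<^bsub>\<Phi>\<^esub> word_class {..<n} u"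
      using F.hat_mem(2)[OF \<kappa>c[unfolded H_eq] D_in_N aN(2)] F.hat_mem(2)[OF \<kappa>c[unfolded H_eq] D_in_N u(2)] by simp
    then have "magnus_class a - magnus_class (word_class {..<n} u) \<in> trunc_ideal n p 2"
      using M.D_rcos_eq_iff[OF a(1)] u(1) by (auto simp: free_group_carrier)
    then have "magnus v - magnus u \<in> trunc_ideal n p 2" by (simp add: v u magnus_class_word)
    then have "int p dvd nc_coeff (magnus v - magnus u) [i]" using i unfolding trunc_ideal_def by fastforce
    then have "int p dvd exponent_sum i v - exponent_sum i u" by (simp add: magnus_linear_coeff)
    then have nv: "\<not> int p dvd exponent_sum i v" using ne by (metis dvd_diff_right_iff)
    have "\<kappa> \<in> C" using \<kappa>c \<kappa>1 subgroup.one_closed[OF gS] by (simp add: C_def)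
    then have "\<kappa> N \<in> Q" using Q(2) by blast
    then have "N #>\<^bsub>\<Phi>\<^esub> a \<in> Q" using F.hat_mem(2)[OF \<kappa>c[unfolded H_eq] N aN(1)] by simp
    then have "h a = \<one>\<^bsub>?B\<^esub>" using h1[OF a(1)] by simp
    \<comment> \<open>The quotient is cyclic, generated by \<open>y i\<close>. Killing \<kappa>
      makes a power of \<open>y i\<close> with exponent prime to \<open>p\<close> trivial, and so
      \<open>y i\<close> itself.\<close>
    moreover have ev: "h (word_class {..<n} w) = y i [^]\<^bsub>?B\<^esub> exponent_sum i w" if "w \<in> free_words {..<n}" for w
      using free_group_hom_eval[OF B.is_group h that] B.word_eval_single[where y = y and i = i and S = "{..<n}" and u = w, OF yc[OF i] y1 that]
      unfolding y_def by simp
    ultimately have p1: "y i [^]\<^bsub>?B\<^esub> exponent_sum i v = \<one>\<^bsub>?B\<^esub>" using v by simp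
    have "card (rcosets\<^bsub>\<Phi> Mod N\<^esub> Q) dvd p ^ k" using P.lagrange[OF Q.subgroup_axioms] oP by (metis dvd_triv_left)
    then obtain l where "card (rcosets\<^bsub>\<Phi> Mod N\<^esub> Q) = p ^ l" using prime_p divides_primepow_nat by blast
    then have oB: "order ?B = p ^ l" by (simp add: order_def FactGroup_def)
    have "y i [^]\<^bsub>?B\<^esub> (int (p ^ l)) = \<one>\<^bsub>?B\<^esub>"
      unfolding int_pow_int using B.pow_order_eq_1[OF yc[OF i]] oB by simp
    moreover have "coprime (exponent_sum i v) (int (p ^ l))"
      using prime_imp_coprime[of "int p" "exponent_sum i v"] nv prime_p by (simp add: coprime_commute)
    ultimately have yi: "y i = \<one>\<^bsub>?B\<^esub>" using B.int_pow_coprime_one[OF yc[OF i] p1] by blast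
    have "h a = \<one>\<^bsub>?B\<^esub>" if a: "a \<in> carrier \<Phi>" for a
    proof -
      obtain w where w: "w \<in> free_words {..<n}" "a = word_class {..<n} w" using a by (auto simp: free_group_carrier)
      show ?thesis unfolding w(2) ev[OF w(1)] yi by (rule B.int_pow_one)
    qed
    then have "carrier (\<Phi> Mod N) \<subseteq> Q" using h1 by (auto simp: carrier_FactGroup)
    then show False using Q(3) Q.subset by blast
  qed
  have "x \<in> T closure_of (generate G ?S)" if x: "x \<in> carrier G" for x
    unfolding in_closure_of
  proof (intro conjI allI impI)
    show "x \<in> topspace T" using x T_space by simp
    fix U assume xU: "x \<in> U \<and> openin T U"
    obtain \<phi> where \<phi>: "\<phi> \<in> carrier H" "\<pi> \<phi> = x" using x \<pi>_surj by (metis imageE)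
    then have 1: "\<phi> \<in> {\<phi> \<in> carrier H. \<pi> \<phi> \<in> U}" using xU by simp
    have "\<forall>\<phi>\<in>{\<phi> \<in> carrier H. \<pi> \<phi> \<in> U}. \<exists>N\<in>F.\<N>. \<forall>\<psi>\<in>carrier H. \<psi> N = \<phi> N \<longrightarrow> \<psi> \<in> {\<phi> \<in> carrier H. \<pi> \<phi> \<in> U}"
      using preimage_openin[of U] xU unfolding TH_eq F.hat_openin_iff H_eq by blast
    from bspec[OF this 1] obtain N where N: "N \<in> F.\<N>" "\<And>\<psi>. \<psi> \<in> carrier H \<Longrightarrow> \<psi> N = \<phi> N \<Longrightarrow> \<pi> \<psi> \<in> U" by blast
    have "\<phi> N \<in> (\<lambda>\<xi>. \<xi> N) ` C"
      unfolding onto[OF N(1)] using F.hat_coset[OF \<phi>(1)[unfolded H_eq] N(1)] by (auto simp: carrier_FactGroup)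
    then obtain \<psi> where "\<psi> \<in> C" "\<psi> N = \<phi> N" by auto
    then show "\<exists>y. y \<in> generate G ?S \<and> y \<in> U" using N(2) by (auto simp: C_def)
  qed
  then show ?thesis using closure_of_subset_topspace[of T] T_space by blast
qed

text \<open>Otherwise the generator \<open>i\<close> could be omitted, contradicting that
  \<open>n\<close> is the least number of topological generators.\<close>

lemma kernel_exponent_sum:
  assumes n: "generator_rank G T = n" and i: "i < n" and \<kappa>: "\<kappa> \<in> kernel H G \<pi>"
    and u: "u \<in> free_words {..<n}" "word_class {..<n} u \<in> \<kappa> (M.D 2)"
  shows "int p dvd exponent_sum i u"
proof (rule ccontr)
  let ?S = "(\<lambda>j. \<pi> (free_gen p n j)) ` ({..<n} - {i})"
  assume "\<not> int p dvd exponent_sum i u"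
  then have "T closure_of (generate G ?S) = carrier G" using gens_dense_without[OF i \<kappa> u] by blast
  moreover have "?S \<subseteq> carrier G" using gen_carrier by auto
  ultimately have "card ?S \<in> {card S | S. finite S \<and> S \<subseteq> carrier G \<and> T closure_of (generate G S) = carrier G}"
    by blast
  then have "generator_rank G T \<le> card ?S" unfolding generator_rank_def by (rule cInf_lower) simp
  also have "\<dots> \<le> card ({..<n} - {i})" by (rule card_image_le) simp
  also have "\<dots> < n" using i by simp
  finally show False using n by simp
qed

text \<open>The Magnus image modulo \<open>p\<close> of an element of the completion: its coefficient at \<open>w\<close> is read off
  from any word approximating the element beyond the length of \<open>w\<close>.\<close>

definition muhat :: "free_pro_p \<Rightarrow> nc_series" where
  "muhat \<phi> = Abs_nc_series (\<lambda>w. nc_coeff (magnus_class (SOME c. c \<in> \<phi> (M.D (Suc (length w))))) w mod int p)"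

text \<open>Two words in the same coset of \<open>D (Suc (length w))\<close> have coefficients at
  \<open>w\<close> that agree modulo \<open>p\<close>. Membership in the coset at depth
  \<open>m\<close> thus fixes all coefficients of words shorter than \<open>m\<close>.\<close>

lemma muhat_approx:
  assumes \<phi>: "\<phi> \<in> carrier H" and m: "m \<ge> 1" and c: "c \<in> \<phi> (M.D m)"
  shows "muhat \<phi> - magnus_class c \<in> trunc_ideal n p m"
  unfolding trunc_ideal_def
proof (intro CollectI allI impI)
  fix w assume w: "set w \<subseteq> {..<n}" "length w < m"
  let ?D = "M.D (Suc (length w))"
  have DN: "?D \<in> F.\<N>" by (rule D_in_N) simp
  define c0 where "c0 = (SOME c. c \<in> \<phi> ?D)"
  have c0: "c0 \<in> \<phi> ?D" unfolding c0_def using F.hat_nonempty[OF \<phi>[unfolded H_eq] DN] by (metis someI)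
  have c': "c \<in> \<phi> ?D" using F.hat_mono[OF \<phi>[unfolded H_eq] D_in_N[OF m] DN M.D_mono] w c by auto
  have "?D #>\<^bsub>\<Phi>\<^esub> c0 = ?D #>\<^bsub>\<Phi>\<^esub> c"
    using F.hat_mem(2)[OF \<phi>[unfolded H_eq] DN c0] F.hat_mem(2)[OF \<phi>[unfolded H_eq] DN c'] by simp
  then have "magnus_class c0 - magnus_class c \<in> trunc_ideal n p (Suc (length w))"
    using M.D_rcos_eq_iff[OF F.hat_mem(1)[OF \<phi>[unfolded H_eq] DN c0] F.hat_mem(1)[OF \<phi>[unfolded H_eq] DN c']] by blast
  then have 1: "int p dvd nc_coeff (magnus_class c0) w - nc_coeff (magnus_class c) w"
    using w(1) by (simp add: trunc_ideal_def)
  have "nc_coeff (muhat \<phi>) w = nc_coeff (magnus_class c0) w mod int p"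
    by (simp add: muhat_def Abs_nc_series_inverse c0_def)
  then have "nc_coeff (muhat \<phi>) w mod int p = nc_coeff (magnus_class c) w mod int p"
    using 1 by (simp add: mod_eq_dvd_iff)
  then show "int p dvd nc_coeff (muhat \<phi> - magnus_class c) w" by (simp add: mod_eq_dvd_iff)
qed

lemma muhat_locally:
  assumes \<phi>: "\<phi> \<in> carrier H" and \<psi>: "\<psi> \<in> carrier H" and m: "m \<ge> 1" and eq: "\<phi> (M.D m) = \<psi> (M.D m)"
  shows "muhat \<phi> - muhat \<psi> \<in> trunc_ideal n p m"
proof -
  obtain c where "c \<in> \<phi> (M.D m)" using F.hat_nonempty[OF \<phi>[unfolded H_eq] D_in_N[OF m]] by blast
  then show ?thesis
    using muhat_approx[OF \<phi> m] muhat_approx[OF \<psi> m] eq add_trans[OF trunc_ideal_additive] add_sym[OF trunc_ideal_additive] by metis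
qed

lemma muhat_embed:
  assumes "u \<in> free_words {..<n}" and "m \<ge> 1"
  shows "muhat (F.embed (word_class {..<n} u)) - magnus u \<in> trunc_ideal n p m"
proof -
  have c: "word_class {..<n} u \<in> carrier \<Phi>" using assms by (auto simp: free_group_carrier)
  show ?thesis
    using muhat_approx[OF F.embed_carrier[OF c, folded H_eq] assms(2) F.embed_mem[OF c D_in_N[OF assms(2)]]] assms
    by (simp add: magnus_class_word)
qed

lemma muhat_mult:
  assumes \<phi>: "\<phi> \<in> carrier H" and \<psi>: "\<psi> \<in> carrier H"
  shows "muhat (\<phi> \<otimes>\<^bsub>H\<^esub> \<psi>) - muhat \<phi> * muhat \<psi> \<in> trunc_ideal n p m"
proof (cases "m \<ge> 1")
  case m: True
  note DN = D_in_N[OF m]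
  obtain a where a: "a \<in> carrier \<Phi>" "a \<in> \<phi> (M.D m)" using F.hat_nonempty[OF \<phi>[unfolded H_eq] DN] by blast
  obtain b where b: "b \<in> carrier \<Phi>" "b \<in> \<psi> (M.D m)" using F.hat_nonempty[OF \<psi>[unfolded H_eq] DN] by blast
  have ab: "a \<otimes>\<^bsub>\<Phi>\<^esub> b \<in> (\<phi> \<otimes>\<^bsub>H\<^esub> \<psi>) (M.D m)"
    using F.hat_mult_mem[where \<phi> = \<phi> and \<psi> = \<psi>, OF DN a(2) b(2)] by (simp add: H_eq)
  have 1: "muhat (\<phi> \<otimes>\<^bsub>H\<^esub> \<psi>) - magnus_class (a \<otimes>\<^bsub>\<Phi>\<^esub> b) \<in> trunc_ideal n p m"
    by (rule muhat_approx[OF H.m_closed[OF \<phi> \<psi>] m ab])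
  have 2: "magnus_class (a \<otimes>\<^bsub>\<Phi>\<^esub> b) - magnus_class a * magnus_class b \<in> trunc_ideal n p m"
    by (rule M.mu_mult[OF a(1) b(1)])
  have 3: "(muhat \<phi> - magnus_class a) * muhat \<psi> \<in> trunc_ideal n p m"
    using muhat_approx[OF \<phi> m a(2)] by (rule trunc_ideal_right)
  have 4: "magnus_class a * (muhat \<psi> - magnus_class b) \<in> trunc_ideal n p m"
    using muhat_approx[OF \<psi> m b(2)] by (rule trunc_ideal_left)
  have "muhat (\<phi> \<otimes>\<^bsub>H\<^esub> \<psi>) - muhat \<phi> * muhat \<psi> = (muhat (\<phi> \<otimes>\<^bsub>H\<^esub> \<psi>) - magnus_class (a \<otimes>\<^bsub>\<Phi>\<^esub> b)) +
    (magnus_class (a \<otimes>\<^bsub>\<Phi>\<^esub> b) - magnus_class a * magnus_class b) - (muhat \<phi> - magnus_class a) * muhat \<psi>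
     - magnus_class a * (muhat \<psi> - magnus_class b)"
    by (simp add: algebra_simps)
  then show ?thesis
    using add_diff[OF trunc_ideal_additive add_diff[OF trunc_ideal_additive add_plus[OF trunc_ideal_additive 1 2] 3] 4]
    by (simp only:)
qed (auto simp: trunc_ideal_def)

lemma muhat_one: "muhat \<one>\<^bsub>H\<^esub> - 1 \<in> trunc_ideal n p m"
proof (cases "m \<ge> 1")
  case m: True
  have "word_class {..<n} [] \<in> \<one>\<^bsub>H\<^esub> (M.D m)"
    using F.hat_one[OF D_in_N[OF m]] subgroup.one_closed[OF F.N_subgroup[OF D_in_N[OF m]]]
    by (simp add: H_eq free_group_one)
  from muhat_approx[OF H.one_closed m this] show ?thesis by (simp add: magnus_class_word)
qed (auto simp: trunc_ideal_def)

lemma muhat_1: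
  assumes \<phi>: "\<phi> \<in> carrier H"
  shows "muhat \<phi> - 1 \<in> trunc_ideal n p 1"
proof -
  obtain a where a: "a \<in> carrier \<Phi>" "a \<in> \<phi> (M.D 1)" using F.hat_nonempty[OF \<phi>[unfolded H_eq] D_in_N[of 1]] by auto
  from add_trans[OF trunc_ideal_additive muhat_approx[OF \<phi> _ a(2)] M.mu_1[OF a(1)]] show ?thesis by simp
qed

text \<open>Enlarging the truncation ideals by any set \<open>W\<close> keeps the congruences of
  \<open>muhat\<close>; taking \<open>W\<close> from the relators is what later lets the map descend
  to \<open>G\<close>.\<close>

lemma filtered_rel_ideal:
  "filtered_group H p (rel_ideal n p W) muhat"
proof -
  have p0: "p > 0" using prime_p prime_gt_0_nat by blast
  show ?thesis
  proof unfold_locales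
    show "of_nat p \<in> rel_ideal n p W m" for m using trunc_ideal_p[of p 1 n m] by (simp add: rel_ideal.trunc)
    show "rel_ideal n p W (Suc m) \<subseteq> rel_ideal n p W m" for m by (rule rel_ideal_mono) simp
    show "muhat (g \<otimes>\<^bsub>H\<^esub> h) - muhat g * muhat h \<in> rel_ideal n p W m" if "g \<in> carrier H" "h \<in> carrier H" for g h m
      using muhat_mult[OF that] by (rule rel_ideal.trunc)
    show "muhat g - 1 \<in> rel_ideal n p W 1" if "g \<in> carrier H" for g using muhat_1[OF that] by (rule rel_ideal.trunc)
    show "muhat \<one>\<^bsub>H\<^esub> - 1 \<in> rel_ideal n p W m" for m using muhat_one by (rule rel_ideal.trunc)
  qed (use prime_p rel_ideal_0 rel_ideal_additive rel_ideal.left rel_ideal.right rel_ideal_mult rel_ideal_finite[OF p0] in auto)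
qed

end

section \<open>The filtration on the presented group\<close>

locale presented_pro_p = pro_p_quotient +
  fixes R :: "free_pro_p set"
  assumes RH: "R \<subseteq> carrier H" and kernel_eq: "kernel H G \<pi> = closed_normal_closure H TH R"
begin

definition W :: "nc_series set" where "W = (\<lambda>r. muhat r - 1) ` R"

abbreviation E :: "nat \<Rightarrow> nc_series set" where "E \<equiv> rel_ideal n p W"

sublocale FH: filtered_group H p E muhat
  by (rule filtered_rel_ideal)

text \<open>\<open>FH.D m\<close> is normal and contains the relators; it is closed because
  membership depends on one coordinate. So it contains their closed normal closure.\<close>

lemma kernel_congruence: "kernel H G \<pi> \<subseteq> FH.D m"
proof (cases "m \<ge> 1")
  case m: True
  have "closedin TH {\<phi> \<in> carrier H. muhat \<phi> - 1 \<in> E m}"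
    unfolding H_eq TH_eq
  proof (rule F.hat_locally_constant_openin(2)[OF D_in_N[OF m]])
    fix \<phi> \<psi> assume a: "\<phi> \<in> carrier F.Ghat" "\<psi> \<in> carrier F.Ghat" "\<phi> (M.D m) = \<psi> (M.D m)" "muhat \<phi> - 1 \<in> E m"
    have "muhat \<psi> - muhat \<phi> \<in> E m" using muhat_locally[of \<psi> \<phi> m] a m by (auto simp: H_eq intro: rel_ideal.trunc)
    then show "muhat \<psi> - 1 \<in> E m" using FH.E_trans a(4) by blast
  qed
  moreover have "R \<subseteq> FH.D m" using RH by (auto simp: FH.congruence_subgroup_def W_def intro: rel_ideal.rel)
  ultimately show ?thesis
    unfolding kernel_eq closed_normal_closure_def using FH.D_normal[of m] by (auto simp: FH.congruence_subgroup_def)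
next
  case False
  then have "m = 0" by simp
  then show ?thesis by (auto simp: FH.congruence_subgroup_def FH.E_0 kernel_def)
qed

text \<open>The preimage is arbitrary: by \<open>kernel_congruence\<close>, another choice changes
  the value only within every \<open>E m\<close>.\<close>

definition muG :: "'a \<Rightarrow> nc_series" where
  "muG g = muhat (SOME \<phi>. \<phi> \<in> carrier H \<and> \<pi> \<phi> = g)"

lemma muG:
  assumes \<phi>: "\<phi> \<in> carrier H"
  shows "muG (\<pi> \<phi>) - muhat \<phi> \<in> E m"
proof -
  define \<psi> where "\<psi> = (SOME \<psi>. \<psi> \<in> carrier H \<and> \<pi> \<psi> = \<pi> \<phi>)"
  have \<psi>: "\<psi> \<in> carrier H" "\<pi> \<psi> = \<pi> \<phi>"
    using someI[of "\<lambda>\<psi>. \<psi> \<in> carrier H \<and> \<pi> \<psi> = \<pi> \<phi>" \<phi>] \<phi> by (auto simp: \<psi>_def)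
  have "\<psi> \<otimes>\<^bsub>H\<^esub> inv\<^bsub>H\<^esub> \<phi> \<in> kernel H G \<pi>" using \<psi> \<phi> by (simp add: kernel_def)
  then have "muhat (\<psi> \<otimes>\<^bsub>H\<^esub> inv\<^bsub>H\<^esub> \<phi>) - 1 \<in> E m" using kernel_congruence[of m] by (auto simp: FH.congruence_subgroup_def)
  then have "muhat \<psi> - muhat \<phi> \<in> E m" using FH.mu_div[OF \<psi>(1) \<phi>] by blast
  then show ?thesis by (simp add: muG_def \<psi>_def)
qed

sublocale FG: filtered_group G p E muG
proof unfold_locales
  fix g h m assume "g \<in> carrier G" "h \<in> carrier G"
  then have "g \<in> \<pi> ` carrier H" "h \<in> \<pi> ` carrier H" by (simp_all only: \<pi>_surj)
  then obtain \<phi> \<psi> where \<phi>: "\<phi> \<in> carrier H" "g = \<pi> \<phi>" and \<psi>: "\<psi> \<in> carrier H" "h = \<pi> \<psi>" by blast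
  have 1: "muG (g \<otimes> h) - muhat (\<phi> \<otimes>\<^bsub>H\<^esub> \<psi>) \<in> E m" using muG[of "\<phi> \<otimes>\<^bsub>H\<^esub> \<psi>"] \<phi> \<psi> by simp
  have 2: "muhat (\<phi> \<otimes>\<^bsub>H\<^esub> \<psi>) - muhat \<phi> * muhat \<psi> \<in> E m" using FH.mu_mult \<phi> \<psi> by blast
  have 3: "(muG g - muhat \<phi>) * muG h \<in> E m" using muG \<phi> by (auto intro: rel_ideal.right)
  have 4: "muhat \<phi> * (muG h - muhat \<psi>) \<in> E m" using muG \<psi> by (auto intro: rel_ideal.left)
  have "muG (g \<otimes> h) - muG g * muG h = (muG (g \<otimes> h) - muhat (\<phi> \<otimes>\<^bsub>H\<^esub> \<psi>)) + (muhat (\<phi> \<otimes>\<^bsub>H\<^esub> \<psi>) - muhat \<phi> * muhat \<psi>)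
    - (muG g - muhat \<phi>) * muG h - muhat \<phi> * (muG h - muhat \<psi>)" by (simp add: algebra_simps)
  then show "muG (g \<otimes> h) - muG g * muG h \<in> E m"
    using FH.E_diff[OF FH.E_diff[OF FH.E_plus[OF 1 2] 3] 4] by (simp only:)
next
  fix g assume "g \<in> carrier G"
  then obtain \<phi> where \<phi>: "\<phi> \<in> carrier H" "g = \<pi> \<phi>" using \<pi>_surj by (metis imageE)
  show "muG g - 1 \<in> E 1" using FH.E_trans[OF muG[OF \<phi>(1)] FH.mu_1[OF \<phi>(1)]] \<phi>(2) by simp
next
  fix m show "muG \<one> - 1 \<in> E m" using FH.E_trans[OF muG[OF H.one_closed] FH.mu_one] by simp
qed (rule prime_p FH.E_0 FH.E_add FH.E_p FH.E_fin FH.E_Suc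
    | (rule FH.E_left FH.E_right FH.E_mult, assumption+))+

lemma muG_span:
  assumes K: "additive_subgroup_set K" "E m \<subseteq> K" "muG ` carrier G \<subseteq> K"
  shows "K = UNIV"
\<comment> \<open>The maximum with \<open>1\<close> is needed because words are approximated only at
  positive depth.\<close>
proof (rule magnus_span[OF K(1), of n p "max m 1"])
  have tr: "trunc_ideal n p (max m 1) \<subseteq> E m" using trunc_ideal_mono[of m "max m 1"] by (auto intro: rel_ideal.trunc)
  then show "trunc_ideal n p (max m 1) \<subseteq> K" using K(2) by blast
  show "magnus ` free_words {..<n} \<subseteq> K"
  proof (rule image_subsetI)
    fix u assume u: "u \<in> free_words {..<n}"
    let ?e = "F.embed (word_class {..<n} u)"
    have e: "?e \<in> carrier H" using F.embed_carrier u by (auto simp: H_eq free_group_carrier)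
    have "muhat ?e - magnus u \<in> E m" using muhat_embed[OF u, of "max m 1"] tr by auto
    then have "muG (\<pi> ?e) - magnus u \<in> E m" using FH.E_trans[OF muG[OF e]] by blast
    moreover have "muG (\<pi> ?e) \<in> K" using K(3) \<pi>.hom_closed[OF e] by blast
    ultimately show "magnus u \<in> K" using add_mem_iff[OF K(1)] K(2) by blast
  qed
qed

text \<open>Elements of the free pro-\<open>p\<close> group with the same coordinate at
  \<open>M.D m\<close> differ in \<open>G\<close> by an element of \<open>FG.D m\<close>, so the
  preimage of \<open>U\<close> is open; \<pi> is a quotient map. This makes the subgroups found by
  linear algebra count for \<open>num_open_subgroups\<close>.\<close>

lemma congruence_overgroup_open:
  assumes m: "m \<ge> 1" and U: "subgroup U G" and D: "FG.D m \<subseteq> U"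
  shows "openin T U"
proof (rule quotient_openin)
  show "U \<subseteq> carrier G" using U subgroup.subset by blast
  show "openin TH {\<phi> \<in> carrier H. \<pi> \<phi> \<in> U}"
    unfolding H_eq TH_eq
  proof (rule F.hat_locally_constant_openin(1)[OF D_in_N[OF m]])
    fix \<phi> \<psi> assume "\<phi> \<in> carrier F.Ghat" "\<psi> \<in> carrier F.Ghat" and eq: "\<phi> (M.D m) = \<psi> (M.D m)" and \<phi>U: "\<pi> \<phi> \<in> U"
    then have \<phi>: "\<phi> \<in> carrier H" and \<psi>: "\<psi> \<in> carrier H" by (simp_all add: H_eq)
    have "muhat \<psi> - muhat \<phi> \<in> E m" using muhat_locally[OF \<psi> \<phi> m] eq by (auto intro: rel_ideal.trunc)
    then have "muG (\<pi> \<psi>) - muG (\<pi> \<phi>) \<in> E m"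
      using FH.E_trans[OF FH.E_trans[OF muG[OF \<psi>]] FH.E_sym[OF muG[OF \<phi>]]] by blast
    then have "\<pi> \<psi> \<otimes> inv (\<pi> \<phi>) \<in> FG.D m" using FG.mu_div[of "\<pi> \<psi>" "\<pi> \<phi>" m] \<phi> \<psi> by (simp add: FG.congruence_subgroup_def)
    then have "\<pi> \<psi> \<otimes> inv (\<pi> \<phi>) \<otimes> \<pi> \<phi> \<in> U" using D \<phi>U subgroup.m_closed[OF U] by blast
    moreover have "\<pi> \<psi> \<otimes> inv (\<pi> \<phi>) \<otimes> \<pi> \<phi> = \<pi> \<psi>" using \<phi> \<psi> by (simp add: m_assoc)
    ultimately show "\<pi> \<psi> \<in> U" by (simp only:)
  qed
qed

text \<open>The constant terms of \<open>muhat r\<close> and \<open>1\<close> agree modulo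
  \<open>p\<close>, and the linear coefficients of a relator are exponent sums, divisible by
  \<open>p\<close> since the generating set is minimal.\<close>

lemma W_trunc_2:
  assumes "generator_rank G T = n"
  shows "W \<subseteq> trunc_ideal n p 2"
proof
  fix f assume "f \<in> W"
  then obtain r where r: "r \<in> R" "f = muhat r - 1" by (auto simp: W_def)
  have rH: "r \<in> carrier H" using r RH by blast
  have rk: "r \<in> kernel H G \<pi>" using r(1) unfolding kernel_eq closed_normal_closure_def by blast
  have D2: "M.D 2 \<in> F.\<N>" by (rule D_in_N) simp
  obtain a where a: "a \<in> carrier \<Phi>" "a \<in> r (M.D 2)" using F.hat_nonempty[OF rH[unfolded H_eq] D2] by blast
  obtain u where u: "u \<in> free_words {..<n}" "a = word_class {..<n} u" using a(1) by (auto simp: free_group_carrier)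
  have "magnus u - 1 \<in> trunc_ideal n p 2"
    unfolding trunc_ideal_def
  proof (intro CollectI allI impI)
    fix w assume w: "set w \<subseteq> {..<n}" "length w < 2"
    show "int p dvd nc_coeff (magnus u - 1) w"
    proof (cases w)
      case (Cons i v)
      then have "w = [i]" "i < n" using w by auto
      then show ?thesis
        using kernel_exponent_sum[OF assms _ rk u(1)] a(2) u(2) by (simp add: magnus_linear_coeff)
    qed simp
  qed
  moreover have "muhat r - magnus u \<in> trunc_ideal n p 2"
    using muhat_approx[OF rH _ a(2)] u by (simp add: magnus_class_word)
  ultimately show "f \<in> trunc_ideal n p 2" using r(2) add_trans[OF trunc_ideal_additive] by blast
qed

lemma num_open_subgroups_ge:
  assumes i: "1 \<le> i" and k: "k \<le> FG.level (2 * i) - FG.level i"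
  shows "p ^ (k * (FG.level (2 * i) - FG.level i - k)) \<le> num_open_subgroups G T (p ^ (FG.level i + k))"
proof -
  obtain \<H> where \<H>: "finite \<H>" "card \<H> = p ^ (k * (FG.level (2 * i) - FG.level i - k))"
    "\<And>U. U \<in> \<H> \<Longrightarrow> subgroup U G \<and> FG.D (2 * i) \<subseteq> U \<and> finite (rcosets U) \<and> card (rcosets U) = p ^ (FG.level i + k)"
    using FG.many_congruence_subgroups[OF i k] by blast
  have "\<H> \<subseteq> {U. subgroup U G \<and> openin T U \<and> finite (rcosets U) \<and> card (rcosets U) = p ^ (FG.level i + k)}"
    using \<H>(3) congruence_overgroup_open[of "2 * i"] i by auto
  then show ?thesis
    unfolding num_open_subgroups_def \<H>(2)[symmetric] by (rule card_mono[OF finite_open_subgroups_index])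
qed

text \<open>The quotient by \<open>E (Suc m)\<close> is squeezed at \<open>x = 3/4\<close>: its
  dimension is at least \<open>(3/2) ^ m\<close> by Golod--Shafarevich, while the ordered products
  bound it in terms of the subexponential levels of \<open>G\<close>.\<close>

lemma admissible_relations:
  assumes fR: "finite R" and n: "generator_rank G T = n" and adm: "admissible G T"
    and r: "real (card R) \<le> (real n)\<^sup>2 / 4" and d: "n \<ge> 3 \<or> n = 2 \<and> R = {}"
  shows False
proof -
  obtain \<epsilon> N0 where \<epsilon>: "\<epsilon> > 0"
    and growth: "\<And>m. m \<ge> N0 \<Longrightarrow> real (num_open_subgroups G T m) \<le> real m powr (log 2 (real m) powr (2 - \<epsilon>))"
    using adm unfolding admissible_def eventually_sequentially by blast
  have mono: "FG.level i \<le> FG.level j" if "1 \<le> i" "i \<le> j" for i j using FG.level_mono that by blast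
  obtain K where K: "\<And>m. m \<ge> 1 \<Longrightarrow> FG.level m \<le> K * (5 / 4) ^ m"
    using subgroup_count_growth[of FG.level p \<epsilon> "num_open_subgroups G T" N0, OF mono FG.p_gt_1 \<epsilon> num_open_subgroups_ge growth]
    by blast
  have fW: "finite W" using fR by (simp add: W_def)
  have "card W \<le> card R" unfolding W_def by (rule card_image_le[OF fR])
  then have rW: "real (card W) \<le> (real n)\<^sup>2 / 4" using r by linarith
  have dW: "n \<ge> 3 \<or> n = 2 \<and> W = {}" using d by (auto simp: W_def)
  have "\<exists>N. (3 / 2) ^ m \<le> N \<and>
    N * (3 / 4) ^ Suc m \<le> (\<Prod>w\<in>{1..<Suc m}. (1 / (1 - (3 / 4 :: real) ^ w)) ^ (FG.level (Suc w) - FG.level w))" for m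
  proof -
    obtain N where N: "add_index UNIV (E (Suc m)) \<le> p ^ N"
      "real N * (3 / 4) ^ Suc m \<le> (\<Prod>w\<in>{1..<Suc m}. (1 / (1 - (3 / 4) ^ w)) ^ (FG.level (Suc w) - FG.level w))"
      using FG.index_E_le[of "Suc m" "3 / 4"] muG_span[of _ "Suc m"] by auto
    have p1: "p > 1" by (rule FG.p_gt_1)
    have "(3 / 2) ^ m \<le> log p (add_index UNIV (E (Suc m)))"
      by (rule golod_shafarevich_growth[OF p1 fW W_trunc_2[OF n] rW dW])
    also have "\<dots> \<le> log p (real p ^ N)"
    proof (subst log_le_cancel_iff)
      show "real (add_index UNIV (E (Suc m))) \<le> real p ^ N" using N(1) by (metis of_nat_le_iff of_nat_power)
    qed (use p1 rel_index_pos[OF _ fW W_trunc_2[OF n]] in auto)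
    also have "\<dots> = N" using p1 by (simp add: log_nat_power)
    finally show ?thesis using N(2) by blast
  qed
  then show False using no_growth_bound[of FG.level K] mono K by blast
qed

end

theorem theorem3p5:
  fixes G :: "('a, 'b) monoid_scheme" and T :: "'a topology" and p :: nat
  assumes "finitely_presented_pro_p_group p G T"
    and "generator_rank G T > 1"
    and "\<not> (generator_rank G T = 2 \<and> relation_rank p G T = 1)"
    and "admissible G T"
  shows "real (relation_rank p G T) > (real (generator_rank G T))\<^sup>2 / 4"
proof (rule ccontr)
  assume neg: "\<not> real (relation_rank p G T) > (real (generator_rank G T))\<^sup>2 / 4"
  define d where "d = generator_rank G T"
  define r where "r = relation_rank p G T"
  obtain n R0 where pro_p: "pro_p_group p G T" and R0: "finite R0" "pro_p_presentation p G T n R0"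
    using assms(1) unfolding finitely_presented_pro_p_group_def by blast
  have p: "Factorial_Ring.prime p" and gr: "group G" and Ts: "topspace T = carrier G" and Th: "Hausdorff_space T"
    using pro_p unfolding pro_p_group_def profinite_group_def topological_group_def by auto
  have quotient: "pro_p_quotient G T p m \<pi>"
    if "\<pi> \<in> hom (free_pro_p_group p m) G" "continuous_map (free_pro_p_topology p m) T \<pi>"
      "\<pi> ` carrier (free_pro_p_group p m) = carrier G" for m \<pi>
    using that p gr Ts Th by (simp add: pro_p_quotient_def pro_p_quotient_axioms_def)
  obtain \<pi>0 where \<pi>0: "\<pi>0 \<in> hom (free_pro_p_group p n) G" "continuous_map (free_pro_p_topology p n) T \<pi>0"
    "\<pi>0 ` carrier (free_pro_p_group p n) = carrier G"
    "kernel (free_pro_p_group p n) G \<pi>0 = closed_normal_closure (free_pro_p_group p n) (free_pro_p_topology p n) R0"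
    and R0c: "R0 \<subseteq> carrier (free_pro_p_group p n)"
    using R0(2) unfolding pro_p_presentation_def by blast
  interpret Q0: pro_p_quotient G T p n \<pi>0 by (rule quotient[OF \<pi>0(1-3)])
  let ?gens = "{card S | S. finite S \<and> S \<subseteq> carrier G \<and> T closure_of (generate G S) = carrier G}"
  have "card ((\<lambda>i. \<pi>0 (free_gen p n i)) ` {..<n}) \<in> ?gens"
    using Q0.gens_dense Q0.gens_carrier by blast
  then have "?gens \<noteq> {}" by blast
  \<comment> \<open>An infimum of natural numbers is attained once the set is nonempty; the same
    argument provides \<open>R\<close> below.\<close>
  then have "d \<in> ?gens" unfolding d_def generator_rank_def by (rule Inf_nat_def1)
  then obtain S where S: "finite S" "S \<subseteq> carrier G" "T closure_of (generate G S) = carrier G" "card S = d" by blast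
  let ?rels = "{card R | R. finite R \<and> pro_p_presentation p G T (generator_rank G T) R}"
  obtain R1 where "finite R1" "pro_p_presentation p G T (generator_rank G T) R1"
    using Q0.presentation_on_generators[OF \<pi>0(4) R0(1) R0c S(1-3)] unfolding S(4) d_def by (elim exE conjE)
  then have "card R1 \<in> ?rels" by (intro CollectI exI[of _ R1]) simp
  then have "?rels \<noteq> {}" by blast
  then have "r \<in> ?rels" unfolding r_def relation_rank_def by (rule Inf_nat_def1)
  then obtain R where R: "finite R" "pro_p_presentation p G T d R" "card R = r" unfolding d_def by blast
  obtain \<pi> where \<pi>: "\<pi> \<in> hom (free_pro_p_group p d) G" "continuous_map (free_pro_p_topology p d) T \<pi>"
    "\<pi> ` carrier (free_pro_p_group p d) = carrier G"
    "kernel (free_pro_p_group p d) G \<pi> = closed_normal_closure (free_pro_p_group p d) (free_pro_p_topology p d) R"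
    and Rc: "R \<subseteq> carrier (free_pro_p_group p d)"
    using R(2) unfolding pro_p_presentation_def by blast
  interpret P: presented_pro_p G T p d \<pi> R
    using quotient[OF \<pi>(1-3)] \<pi>(4) Rc by (simp add: presented_pro_p_def presented_pro_p_axioms_def)
  have rd: "real r \<le> (real d)\<^sup>2 / 4" using neg by (simp add: d_def r_def)
  \<comment> \<open>For \<open>d = 2\<close> the assumed bound leaves \<open>r \<le> 1\<close>, and
    the excluded pair leaves only \<open>r = 0\<close>.\<close>
  have "d \<ge> 3 \<or> d = 2 \<and> R = {}"
  proof (cases "d = 2")
    case True
    then have "real r \<le> 1" using rd by simp
    then have "r = 0" using assms(3) True by (auto simp: d_def r_def)
    then show ?thesis using True R by simp
  qed (use assms(2) in \<open>simp add: d_def\<close>)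
  then show False using P.admissible_relations[OF R(1) _ assms(4)] rd R(3) by (simp add: d_def)
qed

end
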